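(* Let $S\subset\mathbb{R}^3$ be a regular surface, let $\triangle VAB$ be an arbitrary small geodesic triangle on $S$ with angle $\angle AVB=\mu<\pi$ at $V$, and let $p:S\to\mathbb{R}^+$ and $q:S\to\mathbb{R}^+$ be two continuous functions taking only positive values. Let $\{\alpha_n\}_{n\ge 1}$ and $\{\beta_n\}_{n\ge 1}$ be the sequences of angles produced from $\triangle VAB$, $p$ and $q$ by the recursive construction described in the context. Then both sequences converge, and $$\lim_{n\to\infty}\alpha_n=\frac{q(V)\,(\pi-\mu)}{p(V)+q(V)+p(V)\,q(V)},\qquad \lim_{n\to\infty}\beta_n=\frac{p(V)\,(\pi-\mu)}{p(V)+q(V)+p(V)\,q(V)}.$$
   Context: A geodesic on a regular (smooth) surface $S\subset\mathbb{R}^3$ is a unit speed curve $\mathbf c(s)$ on $S$ whose second derivative $\mathbf c''(s)$ is zero or perpendicular to $S$. If two geodesics start at a point $P$ with initial velocities $v$ and $w$ and pass through points $X$ and $Y$ respectively, then the angle $\angle XPY=\angle YPX$ is the angle between $v$ and $w$. Small triangle: a geodesic triangle $\triangle VAB$ on $S$ is formed by two geodesics intersecting at $V$ and a third geodesic intersecting the first two transversally at $A$ and $B$. It is called small if it (the closed region bounded by its three sides) is contained in an open set $W\subset S$ that is a normal neighborhood of all its points, i.e. there is $\delta>0$ such that for every $x\in W$ the exponential map $\exp_x$ is a diffeomorphism of the ball $B_\delta(0)\subset T_xS$ onto its image and this image contains $W$. For points $P,Q$ of the triangle, $PQ$ denotes the geodesic segment joining them (the unique geodesic of length less than $\delta$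 joining them). Recursive construction: put $A_1=A$, $B_1=B$, $\alpha_1=\angle VA_1B_1$. Given $A_k$ on the side $VA$ and $B_k$ on the side $VB$ ($k\ge 1$), set $$\beta_k=\frac{\angle VB_kA_k}{1+q(B_k)}.$$ Consider the geodesic starting at $B_k$ into the triangle $\triangle VA_kB_k$, dividing the angle $\angle VB_kA_k$ so that it makes angle $\beta_k$ with the segment $B_kV$ (and hence angle $q(B_k)\beta_k$ with the segment $B_kA_k$). Let $A_{k+1}$ be the point where this geodesic meets the segment $VA_k$, so that $\beta_k=\angle VB_kA_{k+1}$. Next set $$\alpha_{k+1}=\frac{\angle VA_{k+1}B_k}{1+p(A_{k+1})}.$$ Consider the geodesic starting at $A_{k+1}$ into the triangle $\triangle VA_{k+1}B_k$, dividing the angle $\angle VA_{k+1}B_k$ so that it makes angle $\alpha_{k+1}$ with the segment $A_{k+1}V$ (and hence angle $p(A_{k+1})\alpha_{k+1}$ with the segment $A_{k+1}B_k$). Let $B_{k+1}$ be the point where this geodesic meets the segment $VB_k$, so that $\alpha_{k+1}=\angle VA_{k+1}B_{k+1}$. Iterating gives sequences of points $\{A_k\}$, $\{B_k\}$ and angles $\{\alpha_k\}$, $\{\beta_k\}$. *)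

theory Defs
  imports "HOL-Analysis.Analysis"
begin

text \<open>
  \<open>Ck_on k U f\<close> is used for open \<open>U\<close> only: \<open>f\<close> is \<open>k\<close> times continuously differentiable on \<open>U\<close>,
  expressed through iterated partial derivatives.
\<close>

primrec Ck_on ::
  "nat \<Rightarrow> 'a::euclidean_space set \<Rightarrow> ('a \<Rightarrow> 'b::real_normed_vector) \<Rightarrow> bool" where
  "Ck_on 0 U f = continuous_on U f"
| "Ck_on (Suc k) U f =
     ((\<forall>x\<in>U. f differentiable (at x)) \<and>
      (\<forall>i\<in>Basis. Ck_on k U (\<lambda>x. frechet_derivative f (at x) i)))"

definition smooth_on ::
  "'a::euclidean_space set \<Rightarrow> ('a \<Rightarrow> 'b::real_normed_vector) \<Rightarrow> bool" where
  "smooth_on U f \<longleftrightarrow> open U \<and> (\<forall>k. Ck_on k U f)"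

text \<open>
  On arbitrary subsets of Euclidean space (here: pieces of tangent planes and of surfaces)
  smoothness means having smooth extensions locally.
\<close>

definition smooth_map_on ::
  "'a::euclidean_space set \<Rightarrow> ('a \<Rightarrow> 'b::real_normed_vector) \<Rightarrow> bool" where
  "smooth_map_on D f \<longleftrightarrow>
     (\<forall>x\<in>D. \<exists>U g. x \<in> U \<and> smooth_on U g \<and> (\<forall>y\<in>D \<inter> U. f y = g y))"

definition diffeo_onto_image ::
  "'a::euclidean_space set \<Rightarrow> ('a \<Rightarrow> 'b::euclidean_space) \<Rightarrow> bool" where
  "diffeo_onto_image D f \<longleftrightarrow>
     inj_on f D \<and> smooth_map_on D f \<and> smooth_map_on (f ` D) (the_inv_into D f)"

definition regular_surface :: "(real^3) set \<Rightarrow> bool" where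
  "regular_surface S \<longleftrightarrow>
     (\<forall>P\<in>S. \<exists>N U (X :: real^2 \<Rightarrow> real^3) Y.
        open N \<and> P \<in> N \<and> smooth_on U X \<and>
        homeomorphism U (S \<inter> N) X Y \<and>
        (\<forall>u\<in>U. inj (frechet_derivative X (at u))))"

definition tangent_plane :: "(real^3) set \<Rightarrow> real^3 \<Rightarrow> (real^3) set" where
  "tangent_plane S P =
     {v. \<exists>c \<epsilon>. 0 < \<epsilon> \<and> smooth_on {-\<epsilon><..<\<epsilon>} c \<and> c ` {-\<epsilon><..<\<epsilon>} \<subseteq> S \<and>
            c 0 = P \<and> (c has_vector_derivative v) (at 0)}"

abbreviation velocity :: "(real \<Rightarrow> real^3) \<Rightarrow> real \<Rightarrow> real^3" where
  "velocity c s \<equiv> vector_derivative c (at s)"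

definition geodesic_on :: "(real^3) set \<Rightarrow> real \<Rightarrow> real \<Rightarrow> (real \<Rightarrow> real^3) \<Rightarrow> bool" where
  "geodesic_on S a b c \<longleftrightarrow>
     smooth_on {a<..<b} c \<and> c ` {a<..<b} \<subseteq> S \<and>
     (\<forall>s\<in>{a<..<b}. norm (velocity c s) = 1 \<and>
        (\<forall>w\<in>tangent_plane S (c s). velocity (velocity c) s \<bullet> w = 0))"

text \<open>
  A geodesic arc is the restriction to \<open>{0..l}\<close> of a geodesic that is defined on a slightly larger
  open interval, so that two-sided derivatives make sense at the endpoints.
  As geodesics have unit speed, \<open>l\<close> is the length of the arc.
\<close>

definition geodesic_arc ::
  "(real^3) set \<Rightarrow> (real \<Rightarrow> real^3) \<Rightarrow> real \<Rightarrow> real^3 \<Rightarrow> real^3 \<Rightarrow> bool" where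
  "geodesic_arc S c l P Q \<longleftrightarrow>
     0 < l \<and> (\<exists>a b. a < 0 \<and> l < b \<and> geodesic_on S a b c) \<and> c 0 = P \<and> c l = Q"

text \<open>
  \<open>exp_graph S P v Q\<close>: \<open>v\<close> is in the domain of the exponential map at \<open>P\<close>, with value \<open>Q\<close>.
  On a regular surface \<open>Q\<close> is unique, since a geodesic is determined by its initial velocity.
\<close>

definition exp_graph :: "(real^3) set \<Rightarrow> real^3 \<Rightarrow> real^3 \<Rightarrow> real^3 \<Rightarrow> bool" where
  "exp_graph S P v Q \<longleftrightarrow>
     (if v = 0 then Q = P
      else \<exists>c. geodesic_arc S c (norm v) P Q \<and> velocity c 0 = v /\<^sub>R norm v)"

definition exp_map :: "(real^3) set \<Rightarrow> real^3 \<Rightarrow> real^3 \<Rightarrow> real^3" where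
  "exp_map S P v = (THE Q. exp_graph S P v Q)"

definition tangent_ball :: "(real^3) set \<Rightarrow> real^3 \<Rightarrow> real \<Rightarrow> (real^3) set" where
  "tangent_ball S P \<delta> = {v \<in> tangent_plane S P. norm v < \<delta>}"

definition normal_nbhd_of_all_points :: "(real^3) set \<Rightarrow> (real^3) set \<Rightarrow> real \<Rightarrow> bool" where
  "normal_nbhd_of_all_points S W \<delta> \<longleftrightarrow>
     openin (top_of_set S) W \<and> 0 < \<delta> \<and>
     (\<forall>P\<in>W. (\<forall>v\<in>tangent_ball S P \<delta>. \<exists>Q. exp_graph S P v Q) \<and>
            diffeo_onto_image (tangent_ball S P \<delta>) (exp_map S P) \<and>
            W \<subseteq> exp_map S P ` tangent_ball S P \<delta>)"

text \<open>
  The two notions below are meant for distinct points of a normal neighborhood of all its points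
  with radius \<open>\<delta>\<close>. There the arc of length less than \<open>\<delta>\<close> from \<open>P\<close> to \<open>Q\<close> is unique;
  \<open>segment S \<delta> P Q\<close> is its trace and \<open>direction S \<delta> P Q\<close> its initial velocity.
\<close>

definition segment :: "(real^3) set \<Rightarrow> real \<Rightarrow> real^3 \<Rightarrow> real^3 \<Rightarrow> (real^3) set" where
  "segment S \<delta> P Q = \<Union> {c ` {0..l} | c l. geodesic_arc S c l P Q \<and> l < \<delta>}"

definition direction :: "(real^3) set \<Rightarrow> real \<Rightarrow> real^3 \<Rightarrow> real^3 \<Rightarrow> real^3" where
  "direction S \<delta> P Q =
     (THE u. \<exists>c l. geodesic_arc S c l P Q \<and> l < \<delta> \<and> u = velocity c 0)"

definition vector_angle :: "real^3 \<Rightarrow> real^3 \<Rightarrow> real" where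
  "vector_angle v w = arccos ((v \<bullet> w) / (norm v * norm w))"

text \<open>The vertex of the angle is the middle one of the three points.\<close>

definition geodesic_angle ::
  "(real^3) set \<Rightarrow> real \<Rightarrow> real^3 \<Rightarrow> real^3 \<Rightarrow> real^3 \<Rightarrow> real" where
  "geodesic_angle S \<delta> X P Y = vector_angle (direction S \<delta> P X) (direction S \<delta> P Y)"

text \<open>
  \<open>T\<close> is a closed topological disc with boundary curve \<open>C\<close>. A simple closed curve inside a normal
  neighborhood (which is part of an embedded open disc) bounds exactly one such region in that disc.
\<close>

definition region_bounded_by :: "(real^3) set \<Rightarrow> (real^3) set \<Rightarrow> bool" where
  "region_bounded_by T C \<longleftrightarrow>
     (\<exists>(f :: real^2 \<Rightarrow> real^3) g. homeomorphism (cball 0 1) T f g \<and> f ` sphere 0 1 = C)"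

definition geodesic_triangle ::
  "(real^3) set \<Rightarrow> real^3 \<Rightarrow> real^3 \<Rightarrow> real^3 \<Rightarrow> (real^3) set \<Rightarrow> bool" where
  "geodesic_triangle S V A B T \<longleftrightarrow>
     (\<exists>c\<^sub>A l\<^sub>A c\<^sub>B l\<^sub>B c l.
        geodesic_arc S c\<^sub>A l\<^sub>A V A \<and> geodesic_arc S c\<^sub>B l\<^sub>B V B \<and> geodesic_arc S c l A B \<and>
        c\<^sub>A ` {0..l\<^sub>A} \<inter> c\<^sub>B ` {0..l\<^sub>B} = {V} \<and>
        c\<^sub>A ` {0..l\<^sub>A} \<inter> c ` {0..l} = {A} \<and>
        c\<^sub>B ` {0..l\<^sub>B} \<inter> c ` {0..l} = {B} \<and>
        \<not> collinear {0, velocity c\<^sub>A l\<^sub>A, velocity c 0} \<and>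
        \<not> collinear {0, velocity c\<^sub>B l\<^sub>B, velocity c l} \<and>
        region_bounded_by T (c\<^sub>A ` {0..l\<^sub>A} \<union> c\<^sub>B ` {0..l\<^sub>B} \<union> c ` {0..l}))"

definition small_triangle ::
  "(real^3) set \<Rightarrow> (real^3) set \<Rightarrow> real \<Rightarrow> real^3 \<Rightarrow> real^3 \<Rightarrow> real^3 \<Rightarrow> (real^3) set \<Rightarrow> bool" where
  "small_triangle S W \<delta> V A B T \<longleftrightarrow>
     geodesic_triangle S V A B T \<and> T \<subseteq> W \<and> normal_nbhd_of_all_points S W \<delta>"

text \<open>
  In the triangle \<open>V P X\<close>, a geodesic starts at the vertex \<open>P\<close>, runs inside the triangle, and meets
  the side \<open>V X\<close> at \<open>Y\<close>; at \<open>P\<close> it makes angle \<open>\<theta>\<close> with the side \<open>P V\<close> and \<open>\<phi>\<close> with the side \<open>P X\<close>.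
\<close>

definition dividing_geodesic ::
  "(real^3) set \<Rightarrow> (real^3) set \<Rightarrow> real \<Rightarrow> real^3 \<Rightarrow> real^3 \<Rightarrow> real^3 \<Rightarrow> real \<Rightarrow> real \<Rightarrow> real^3 \<Rightarrow> bool"
  where
  "dividing_geodesic S W \<delta> V P X \<theta> \<phi> Y \<longleftrightarrow>
     (\<exists>c l R.
        region_bounded_by R (segment S \<delta> V P \<union> segment S \<delta> V X \<union> segment S \<delta> P X) \<and> R \<subseteq> W \<and>
        geodesic_arc S c l P Y \<and> c ` {0..l} \<subseteq> R \<and>
        vector_angle (velocity c 0) (direction S \<delta> P V) = \<theta> \<and>
        vector_angle (velocity c 0) (direction S \<delta> P X) = \<phi> \<and>
        Y \<in> segment S \<delta> V X)"

end

theory Submission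
  imports Defs
begin

text \<open>
  All angles of the construction vary continuously, so a limit of the broken line away from \<open>V\<close>
  would contradict \<open>p, q > 0\<close> or \<open>\<mu> < \<pi>\<close>; hence \<open>A\<^sub>n, B\<^sub>n \<longlongrightarrow> V\<close>. On a small scale geodesics are close
  to their chords, so the angle sum of the shrinking triangles tends to that of a Euclidean triangle.
  Thus \<open>\<alpha>\<^sub>n + (1 + q) \<beta>\<^sub>n\<close> and \<open>(1 + p) \<alpha>\<^sub>n\<^sub>+\<^sub>1 + \<beta>\<^sub>n\<close> both tend to \<open>\<pi> - \<mu>\<close>, a linear recursion with
  ratio \<open>1 / ((1 + p) (1 + q))\<close>.

  Continuity of directions: local charts and Gronwall's inequality make \<open>exp\<^sub>P v\<close> jointly continuous
  in \<open>(P, v)\<close>. It is injective in \<open>v\<close> on a normal neighborhood, so by invariance of domain \<open>v\<close> depends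
  continuously on \<open>P\<close> and \<open>exp\<^sub>P v\<close>.
\<close>


subsection \<open>Iterated partial derivatives\<close>

text \<open>The definition of a normal neighborhood makes each \<open>exp_P\<close> a diffeomorphism
  separately and says nothing about its dependence on \<open>P\<close>, whereas the vertices of the
  triangles move. This is why a stability theory for geodesics comes before everything else.

  The exclusion of limits away from \<open>V\<close> is one contradiction used three times. The
  undivided angle is (1 + q) or (1 + p) times the divided one, yet at such a limit both tend to the
  same value, which must then be 0. If neither side collapses, this value is the angle of the limit
  triangle at B; it is nonzero, since otherwise the geodesic from B to A would follow the side back
  to \<open>V\<close> and, as \<mu> < \<pi>, could not reach A. If exactly one side collapses, the
  value is the exterior angle \<pi> - \<mu>.

  The shrinking triangles have no a priori limiting shape, so no angle except the one at
  \<open>V\<close> is known to converge at that stage. The chord comparison therefore concerns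
  differences of angles, and the chord triangles have angle sum exactly \<pi> whatever their
  shape.\<close>

lemma Ck_on_cong:
  assumes "open U" "\<And>x. x \<in> U \<Longrightarrow> f x = g x"
  shows "Ck_on k U f \<longleftrightarrow> Ck_on k U g"
  using assms(2)
proof (induction k arbitrary: f g)
  case 0
  then show ?case by (simp cong: continuous_on_cong)
next
  case (Suc k)
  have d: "(f has_derivative D) (at x) \<longleftrightarrow> (g has_derivative D) (at x)" if "x \<in> U" for x D
    using has_derivative_transform_within_open[OF _ assms(1) that, of f D UNIV g]
      has_derivative_transform_within_open[OF _ assms(1) that, of g D UNIV f] Suc.prems by auto
  then have fd: "frechet_derivative f (at x) = frechet_derivative g (at x)" if "x \<in> U" for x
    using that by (simp add: frechet_derivative_def)
  have "f differentiable (at x) \<longleftrightarrow> g differentiable (at x)" if "x \<in> U" for x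
    using d[OF that] by (simp add: differentiable_def)
  moreover have "Ck_on k U (\<lambda>x. frechet_derivative f (at x) i)
      \<longleftrightarrow> Ck_on k U (\<lambda>x. frechet_derivative g (at x) i)" for i
    by (rule Suc.IH) (simp add: fd)
  ultimately show ?case by auto
qed

lemma Ck_on_const: "Ck_on k U (\<lambda>_. c)"
  by (induction k arbitrary: c) auto

lemma Ck_on_add:
  assumes "open U" "Ck_on k U f" "Ck_on k U g"
  shows "Ck_on k U (\<lambda>x. f x + g x)"
  using assms(2,3)
proof (induction k arbitrary: f g)
  case 0
  then show ?case by (auto intro: continuous_intros)
next
  case (Suc k)
  have fd: "frechet_derivative (\<lambda>x. f x + g x) (at x) i
      = frechet_derivative f (at x) i + frechet_derivative g (at x) i" if "x \<in> U" for x i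
  proof -
    have "((\<lambda>x. f x + g x) has_derivative
        (\<lambda>i. frechet_derivative f (at x) i + frechet_derivative g (at x) i)) (at x)"
      using Suc.prems that by (intro has_derivative_add) (auto simp: frechet_derivative_works[symmetric])
    from frechet_derivative_at[OF this] show ?thesis by metis
  qed
  have "Ck_on k U (\<lambda>x. frechet_derivative (\<lambda>x. f x + g x) (at x) i)" if "i \<in> Basis" for i
    using Suc that by (subst Ck_on_cong[OF assms(1) fd]) auto
  then show ?case using Suc.prems by auto
qed

lemma Ck_on_scaleR:
  assumes "open U" "Ck_on k U f"
  shows "Ck_on k U (\<lambda>x. a *\<^sub>R f x)"
  using assms(2)
proof (induction k arbitrary: f)
  case 0
  then show ?case by (auto intro: continuous_intros)
next
  case (Suc k)
  have fd: "frechet_derivative (\<lambda>x. a *\<^sub>R f x) (at x) i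
      = a *\<^sub>R frechet_derivative f (at x) i" if "x \<in> U" for x i
  proof -
    have "((\<lambda>x. a *\<^sub>R f x) has_derivative (\<lambda>i. a *\<^sub>R frechet_derivative f (at x) i)) (at x)"
      using Suc.prems that by (intro has_derivative_scaleR_right) (auto simp: frechet_derivative_works[symmetric])
    from frechet_derivative_at[OF this] show ?thesis by metis
  qed
  have "Ck_on k U (\<lambda>x. frechet_derivative (\<lambda>x. a *\<^sub>R f x) (at x) i)" if "i \<in> Basis" for i
    using Suc that by (subst Ck_on_cong[OF assms(1) fd]) auto
  then show ?case using Suc.prems by auto
qed

lemma Ck_on_sum:
  assumes "open U" "finite I" "\<And>i. i \<in> I \<Longrightarrow> Ck_on k U (f i)"
  shows "Ck_on k U (\<lambda>x. \<Sum>i\<in>I. f i x)"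
  using assms(2,3)
proof (induction I rule: finite_induct)
  case (insert i I)
  then show ?case using Ck_on_add[OF assms(1), of k "f i"] by simp
qed (simp add: Ck_on_const)

text \<open>A partial derivative of \<open>f (a + h x)\<close> is a combination of partial
  derivatives of \<open>f\<close> with the constant coefficients \<open>h i \<bullet> b\<close>, so
  sums and scalings suffice for the induction. Affine substitutions cover all later uses: time
  shifts, reversals, lines in a chart and restriction to smaller sets.\<close>

lemma Ck_on_affine:
  fixes f :: "'b::euclidean_space \<Rightarrow> 'c::real_normed_vector" and h :: "'a::euclidean_space \<Rightarrow> 'b"
  assumes "open U" "open V" "bounded_linear h" "\<And>x. x \<in> V \<Longrightarrow> a + h x \<in> U" "Ck_on k U f"
  shows "Ck_on k V (\<lambda>x. f (a + h x))"
  using assms(5)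
proof (induction k arbitrary: f)
  case 0
  then show ?case
    using assms(3,4) by (auto intro!: continuous_on_compose2[of U f] continuous_on_add
        continuous_on_const bounded_linear.continuous_on[OF assms(3)] continuous_on_id)
next
  case (Suc k)
  have hd: "((\<lambda>x. f (a + h x)) has_derivative
      (\<lambda>y. frechet_derivative f (at (a + h x)) (h y))) (at x)" if "x \<in> V" for x
  proof -
    have 1: "((\<lambda>x. a + h x) has_derivative h) (at x)"
      using has_derivative_add[OF has_derivative_const bounded_linear_imp_has_derivative[OF assms(3)]]
      by auto
    have 2: "(f has_derivative frechet_derivative f (at (a + h x))) (at (a + h x))"
      using Suc.prems assms(4)[OF that] by (auto simp: frechet_derivative_works[symmetric])
    show ?thesis using diff_chain_at[OF 1 2] by (simp add: o_def)
  qed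
  have fd: "frechet_derivative (\<lambda>x. f (a + h x)) (at x) i
      = (\<Sum>b\<in>Basis. (h i \<bullet> b) *\<^sub>R frechet_derivative f (at (a + h x)) b)" if "x \<in> V" for x i
  proof -
    have "linear (frechet_derivative f (at (a + h x)))"
      using Suc.prems assms(4)[OF that] by (auto intro: linear_frechet_derivative)
    then have "frechet_derivative f (at (a + h x)) (\<Sum>b\<in>Basis. (h i \<bullet> b) *\<^sub>R b)
        = (\<Sum>b\<in>Basis. (h i \<bullet> b) *\<^sub>R frechet_derivative f (at (a + h x)) b)"
      by (simp add: linear_sum linear_scale)
    then show ?thesis
      using fun_cong[OF frechet_derivative_at[OF hd[OF that]], of i] by (simp add: euclidean_representation)
  qed
  have "Ck_on k V (\<lambda>x. frechet_derivative (\<lambda>x. f (a + h x)) (at x) i)" if "i \<in> Basis" for i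
  proof -
    have "Ck_on k V (\<lambda>x. (\<Sum>b\<in>Basis. (h i \<bullet> b) *\<^sub>R frechet_derivative f (at (a + h x)) b))"
      using Suc.prems
      by (intro Ck_on_sum Ck_on_scaleR assms Suc.IH[of "\<lambda>x. frechet_derivative f (at x) _"]) auto
    then show ?thesis by (subst Ck_on_cong[OF assms(2) fd]) auto
  qed
  then show ?case using hd by (auto simp: differentiable_def)
qed

lemma smooth_on_affine:
  fixes f :: "'b::euclidean_space \<Rightarrow> 'c::real_normed_vector" and h :: "'a::euclidean_space \<Rightarrow> 'b"
  assumes "smooth_on U f" "open V" "bounded_linear h" "\<And>x. x \<in> V \<Longrightarrow> a + h x \<in> U"
  shows "smooth_on V (\<lambda>x. f (a + h x))"
  using assms Ck_on_affine[of U V h a _ f] by (auto simp: smooth_on_def)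

lemma smooth_on_subset:
  assumes "smooth_on U f" "open V" "V \<subseteq> U"
  shows "smooth_on V f"
  using smooth_on_affine[OF assms(1,2) bounded_linear_ident, of 0] assms(3) by auto

lemma smooth_on_curve:
  assumes "smooth_on I (c :: real \<Rightarrow> 'a::real_normed_vector)" "s \<in> I"
  shows smooth_on_curve_derivative: "(c has_vector_derivative vector_derivative c (at s)) (at s)"
    and smooth_on_curve_derivative2: "((\<lambda>s. vector_derivative c (at s)) has_vector_derivative
          vector_derivative (\<lambda>s. vector_derivative c (at s)) (at s)) (at s)"
proof -
  have I: "open I" and c2: "Ck_on (Suc (Suc 0)) I c"
    using assms by (auto simp: smooth_on_def)
  have d: "c differentiable (at t)" if "t \<in> I" for t
    using c2 that by simp
  then show "(c has_vector_derivative vector_derivative c (at s)) (at s)"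
    using assms(2) vector_derivative_works by blast
  have "(\<lambda>x. frechet_derivative c (at x) 1) differentiable (at s)"
    using c2 assms(2) by simp
  then obtain D where "((\<lambda>x. frechet_derivative c (at x) 1) has_derivative D) (at s)"
    by (auto simp: differentiable_def)
  \<comment> \<open>The only basis vector of the reals is 1, so iterated partial derivatives of a
    curve are iterated vector derivatives.\<close>
  moreover have *: "frechet_derivative c (at t) 1 = vector_derivative c (at t)" if "t \<in> I" for t
    using frechet_derivative_eq_vector_derivative[OF d[OF that]] by simp
  ultimately have "((\<lambda>s. vector_derivative c (at s)) has_derivative D) (at s)"
    by (rule has_derivative_transform_within_open[OF _ I assms(2)]) (use * in auto)
  then show "((\<lambda>s. vector_derivative c (at s)) has_vector_derivative
          vector_derivative (\<lambda>s. vector_derivative c (at s)) (at s)) (at s)"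
    using vector_derivative_works by (auto simp: differentiable_def)
qed

subsection \<open>Bounded Lipschitz functions\<close>

text \<open>Boundedness is included because a product of Lipschitz functions need not be Lipschitz
  unless the factors are bounded.\<close>

definition lipb :: "'a::metric_space set \<Rightarrow> ('a \<Rightarrow> 'b::real_normed_vector) \<Rightarrow> bool" where
  "lipb K f \<longleftrightarrow> (\<exists>M L. 0 \<le> M \<and> (\<forall>x\<in>K. norm (f x) \<le> M) \<and> L-lipschitz_on K f)"

lemma lipbD_bounded: "lipb K f \<Longrightarrow> \<exists>M\<ge>0. \<forall>x\<in>K. norm (f x) \<le> M"
  by (auto simp: lipb_def)

lemma lipbD_lipschitz: "lipb K f \<Longrightarrow> \<exists>L\<ge>0. \<forall>x\<in>K. \<forall>y\<in>K. norm (f x - f y) \<le> L * dist x y"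
  unfolding lipb_def lipschitz_on_def dist_norm by blast

lemma lipbI:
  assumes "\<And>x. x \<in> K \<Longrightarrow> norm (f x) \<le> M" "\<And>x y. x \<in> K \<Longrightarrow> y \<in> K \<Longrightarrow> norm (f x - f y) \<le> L * dist x y"
  shows "lipb K f"
  unfolding lipb_def
proof (intro exI conjI ballI)
  show "(max L 0)-lipschitz_on K f"
  proof (rule lipschitz_onI)
    fix x y assume "x \<in> K" "y \<in> K"
    then have "norm (f x - f y) \<le> L * dist x y" using assms by blast
    also have "\<dots> \<le> max L 0 * dist x y" by (intro mult_right_mono) auto
    finally show "dist (f x) (f y) \<le> max L 0 * dist x y" by (simp add: dist_norm)
  qed simp
  show "norm (f x) \<le> max M 0" if "x \<in> K" for x using assms(1)[OF that] by simp
qed simp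

lemma lipb_const: "lipb K (\<lambda>_. c)"
  by (rule lipbI[where M = "norm c" and L = 0]) auto

lemma lipb_add:
  assumes "lipb K f" "lipb K g"
  shows "lipb K (\<lambda>x. f x + g x)"
proof -
  obtain M L M' L' where *: "\<forall>x\<in>K. norm (f x) \<le> M" "L-lipschitz_on K f"
      "\<forall>x\<in>K. norm (g x) \<le> M'" "L'-lipschitz_on K g"
    using assms unfolding lipb_def by blast
  have "\<forall>x\<in>K. norm (f x + g x) \<le> \<bar>M + M'\<bar>"
    using * by (smt (verit) norm_triangle_ineq)
  then show ?thesis
    unfolding lipb_def using lipschitz_on_add[OF *(2,4)] by (metis abs_ge_zero)
qed

lemma lipb_bilinear:
  assumes "bounded_bilinear h" "lipb K f" "lipb K g"
  shows "lipb K (\<lambda>x. h (f x) (g x))"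
proof -
  interpret bounded_bilinear h by fact
  obtain M L M' L' where *: "\<And>x. x \<in> K \<Longrightarrow> norm (f x) \<le> M" "L \<ge> 0"
      "\<And>x y. x \<in> K \<Longrightarrow> y \<in> K \<Longrightarrow> norm (f x - f y) \<le> L * dist x y"
      "\<And>x. x \<in> K \<Longrightarrow> norm (g x) \<le> M'" "L' \<ge> 0" "M \<ge> 0" "M' \<ge> 0"
      "\<And>x y. x \<in> K \<Longrightarrow> y \<in> K \<Longrightarrow> norm (g x - g y) \<le> L' * dist x y"
    using lipbD_bounded[OF assms(2)] lipbD_bounded[OF assms(3)]
      lipbD_lipschitz[OF assms(2)] lipbD_lipschitz[OF assms(3)] by metis
  obtain C where C: "C > 0" "\<And>a b. norm (h a b) \<le> norm a * norm b * C"
    using pos_bounded by auto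
  show ?thesis
  proof (rule lipbI)
    fix x assume x: "x \<in> K"
    have "norm (h (f x) (g x)) \<le> norm (f x) * norm (g x) * C" by (rule C)
    also have "\<dots> \<le> M * M' * C"
      using * x C by (intro mult_right_mono mult_mono) auto
    finally show "norm (h (f x) (g x)) \<le> M * M' * C" .
  next
    fix x y assume x: "x \<in> K" "y \<in> K"
    have "h (f x) (g x) - h (f y) (g y) = h (f x - f y) (g x) + h (f y) (g x - g y)"
      by (simp add: diff_left diff_right)
    also have "norm \<dots> \<le> norm (f x - f y) * norm (g x) * C + norm (f y) * norm (g x - g y) * C"
      by (rule order_trans[OF norm_triangle_ineq add_mono[OF C(2) C(2)]])
    also have "\<dots> \<le> (L * dist x y) * M' * C + M * (L' * dist x y) * C"
      using * x C by (intro mult_right_mono mult_mono add_mono) auto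
    also have "\<dots> = (L * M' * C + M * L' * C) * dist x y" by (simp add: algebra_simps)
    finally show "norm (h (f x) (g x) - h (f y) (g y)) \<le> (L * M' * C + M * L' * C) * dist x y" .
  qed
qed

lemmas lipb_scaleR = lipb_bilinear[OF bounded_bilinear_scaleR]
lemmas lipb_inner = lipb_bilinear[OF bounded_bilinear_inner]
lemmas lipb_mult = lipb_bilinear[OF bounded_bilinear_mult]

lemma lipb_minus: "lipb K f \<Longrightarrow> lipb K (\<lambda>x. - f x)"
  using lipb_scaleR[OF lipb_const[of K "-1"]] by fastforce

lemma lipb_diff: "lipb K f \<Longrightarrow> lipb K g \<Longrightarrow> lipb K (\<lambda>x. f x - g x)"
  using lipb_add[of K f "\<lambda>x. - g x"] lipb_minus[of K g] by simp

lemma lipb_inverse: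
  fixes f :: "_ \<Rightarrow> real"
  assumes "lipb K f" "0 < m" "\<And>x. x \<in> K \<Longrightarrow> m \<le> f x"
  shows "lipb K (\<lambda>x. inverse (f x))"
proof -
  obtain L where L: "L \<ge> 0" "\<forall>x\<in>K. \<forall>y\<in>K. norm (f x - f y) \<le> L * dist x y"
    using lipbD_lipschitz[OF assms(1)] by auto
  show ?thesis
  proof (rule lipbI)
    fix x assume x: "x \<in> K"
    show "norm (inverse (f x)) \<le> inverse m"
      using assms(2) assms(3)[OF x] by (auto intro!: le_imp_inverse_le)
  next
    fix x y assume x: "x \<in> K" "y \<in> K"
    have p: "m \<le> f x" "m \<le> f y" using assms x by auto
    have "inverse (f x) - inverse (f y) = inverse (f x) * (f y - f x) * inverse (f y)"
      using p assms(2) by (simp add: field_simps)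
    also have "norm \<dots> = inverse (f x) * norm (f x - f y) * inverse (f y)"
      using p assms(2) by (simp add: abs_mult abs_minus_commute)
    also have "\<dots> \<le> inverse m * (L * dist x y) * inverse m"
      using p assms(2) L x by (intro mult_mono) (auto intro!: le_imp_inverse_le)
    finally show "norm (inverse (f x) - inverse (f y)) \<le> (inverse m * L * inverse m) * dist x y"
      by (simp add: mult_ac)
  qed
qed

lemma lipb_compose:
  assumes "lipb K f" "1-lipschitz_on J g" "g ` J \<subseteq> K"
  shows "lipb J (\<lambda>x. f (g x))"
proof -
  obtain M L where *: "\<forall>x\<in>K. norm (f x) \<le> M" "L \<ge> 0" "\<forall>x\<in>K. \<forall>y\<in>K. norm (f x - f y) \<le> L * dist x y"
    using lipbD_bounded[OF assms(1)] lipbD_lipschitz[OF assms(1)] by metis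
  show ?thesis
  proof (rule lipbI)
    fix x y assume x: "x \<in> J" "y \<in> J"
    then have "norm (f (g x) - f (g y)) \<le> L * dist (g x) (g y)"
      using *(3) assms(3) by (simp add: image_subset_iff)
    also have "\<dots> \<le> L * dist x y"
      using lipschitz_onD[OF assms(2) x] * by (intro mult_left_mono) auto
    finally show "norm (f (g x) - f (g y)) \<le> L * dist x y" .
  qed (use * assms(3) in auto)
qed

text \<open>Compactness of the ball bounds the partial derivatives, and its convexity lets the mean
  value inequality turn this bound into a Lipschitz constant.\<close>

lemma Ck_on_1_imp_lipb:
  fixes f :: "'a::euclidean_space \<Rightarrow> 'b::real_normed_vector"
  assumes "Ck_on 1 U f" "cball a r \<subseteq> U"
  shows "lipb (cball a r) f"
proof -
  have d: "(f has_derivative frechet_derivative f (at x)) (at x)" if "x \<in> U" for x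
    using assms(1) that by (simp add: frechet_derivative_works[symmetric])
  have cont: "continuous_on (cball a r) (\<lambda>x. frechet_derivative f (at x) i)" if "i \<in> Basis" for i
    using assms that by (auto intro: continuous_on_subset)
  have "\<exists>B. \<forall>x\<in>cball a r. norm (frechet_derivative f (at x) i) \<le> B" if "i \<in> Basis" for i
    using compact_imp_bounded[OF compact_continuous_image[OF cont[OF that] compact_cball]]
    by (auto simp: bounded_iff)
  then obtain B where B: "\<And>i x. i \<in> Basis \<Longrightarrow> x \<in> cball a r \<Longrightarrow> norm (frechet_derivative f (at x) i) \<le> B i"
    by metis
  have on: "onorm (frechet_derivative f (at x)) \<le> (\<Sum>i\<in>Basis. B i)" if x: "x \<in> cball a r" for x
  proof (rule onorm_le)
    fix y
    have lin: "linear (frechet_derivative f (at x))"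
      using d x assms(2) has_derivative_linear by blast
    have "frechet_derivative f (at x) y = frechet_derivative f (at x) (\<Sum>i\<in>Basis. (y \<bullet> i) *\<^sub>R i)"
      by (simp add: euclidean_representation)
    also have "\<dots> = (\<Sum>i\<in>Basis. (y \<bullet> i) *\<^sub>R frechet_derivative f (at x) i)"
      using lin by (simp add: linear_sum linear_scale)
    also have "norm \<dots> \<le> (\<Sum>i\<in>Basis. norm y * B i)"
      by (intro sum_norm_le) (auto intro!: mult_mono B x simp: Basis_le_norm)
    also have "\<dots> = (\<Sum>i\<in>Basis. B i) * norm y" by (simp add: sum_distrib_left mult.commute)
    finally show "norm (frechet_derivative f (at x) y) \<le> (\<Sum>i\<in>Basis. B i) * norm y" .
  qed
  have "continuous_on (cball a r) f"
    using d assms(2) by (meson has_derivative_continuous continuous_at_imp_continuous_on subsetD)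
  then obtain M where M: "\<forall>x\<in>cball a r. norm (f x) \<le> M"
    using compact_imp_bounded[OF compact_continuous_image[OF _ compact_cball]] by (fastforce simp: bounded_iff)
  show ?thesis
  proof (rule lipbI)
    fix x y assume "x \<in> cball a r" "y \<in> cball a r"
    then show "norm (f x - f y) \<le> (\<Sum>i\<in>Basis. B i) * dist x y"
      unfolding dist_norm using on
      by (intro differentiable_bound[of "cball a r" f "\<lambda>x. frechet_derivative f (at x)"])
        (auto intro!: has_derivative_at_withinI d assms(2)[THEN subsetD])
  qed (use M in auto)
qed

text \<open>The squared distance is used because the norm is not differentiable where the two
  solutions meet.\<close>

lemma gronwall_norm:
  fixes y z :: "real \<Rightarrow> 'a::real_inner"
  assumes "a \<le> b" "\<And>t. t \<in> {a..b} \<Longrightarrow> (y has_vector_derivative y' t) (at t)"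
    "\<And>t. t \<in> {a..b} \<Longrightarrow> (z has_vector_derivative z' t) (at t)"
    "\<And>t. t \<in> {a..b} \<Longrightarrow> norm (y' t - z' t) \<le> L * norm (y t - z t)"
  shows "norm (y b - z b) \<le> norm (y a - z a) * exp (L * (b - a))"
proof -
  define d where "d t = y t - z t" for t
  \<comment> \<open>The exponential factor cancels the growth rate 2 L that the squared distance may
    have, so \<open>e\<close> is nonincreasing.\<close>
  define e where "e t = (d t \<bullet> d t) * exp (- 2 * L * (t - a))" for t
  have dd: "(d has_vector_derivative (y' t - z' t)) (at t)" if "t \<in> {a..b}" for t
    unfolding d_def using assms(2,3)[OF that] by (rule has_vector_derivative_diff)
  have ee: "(e has_real_derivative
      ((2 * (d t \<bullet> (y' t - z' t))) * exp (- 2 * L * (t - a)) + (d t \<bullet> d t) * (exp (- 2 * L * (t - a)) * (-2 * L)))) (at t)"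
    if "t \<in> {a..b}" for t
  proof -
    have "((\<lambda>t. d t \<bullet> d t) has_real_derivative 2 * (d t \<bullet> (y' t - z' t))) (at t)"
      using has_derivative_inner[OF dd[OF that, unfolded has_vector_derivative_def]
          dd[OF that, unfolded has_vector_derivative_def]]
      unfolding has_field_derivative_def
      by (rule has_derivative_eq_rhs) (simp add: fun_eq_iff inner_commute)
    then show ?thesis
      unfolding e_def by (auto intro!: derivative_eq_intros)
  qed
  have "e b \<le> e a"
  proof (rule DERIV_nonpos_imp_nonincreasing[OF assms(1)])
    fix t assume t: "a \<le> t" "t \<le> b"
    have "d t \<bullet> (y' t - z' t) \<le> norm (d t) * norm (y' t - z' t)" by (rule norm_cauchy_schwarz)
    also have "\<dots> \<le> norm (d t) * (L * norm (d t))"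
      using assms(4)[of t] t by (intro mult_left_mono) (auto simp: d_def)
    finally have "d t \<bullet> (y' t - z' t) \<le> L * (d t \<bullet> d t)"
      by (simp add: power2_norm_eq_inner[symmetric] power2_eq_square mult_ac)
    then have "(2 * (d t \<bullet> (y' t - z' t)) - 2 * L * (d t \<bullet> d t)) * exp (- 2 * L * (t - a)) \<le> 0"
      by (intro mult_nonpos_nonneg) auto
    then show "\<exists>y. (e has_real_derivative y) (at t) \<and> y \<le> 0"
      using ee[of t] t by (intro exI conjI) (auto simp: algebra_simps)
  qed
  then have "(norm (d b))\<^sup>2 * exp (- 2 * L * (b - a)) \<le> (norm (d a))\<^sup>2"
    by (simp add: e_def power2_norm_eq_inner)
  moreover have "exp (- 2 * L * (b - a)) = inverse (exp (2 * L * (b - a)))"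
    by (simp add: exp_minus)
  ultimately have "(norm (d b))\<^sup>2 \<le> (norm (d a))\<^sup>2 * exp (2 * L * (b - a))"
    by (simp add: exp_minus divide_simps)
  also have "\<dots> = (norm (d a) * exp (L * (b - a)))\<^sup>2"
    by (simp add: power_mult_distrib exp_double[symmetric] mult.assoc)
  finally show ?thesis
    unfolding d_def by (rule power2_le_imp_le) simp
qed


subsection \<open>Charts and the geodesic equation\<close>

definition Xd :: "(real^2 \<Rightarrow> real^3) \<Rightarrow> 2 \<Rightarrow> real^2 \<Rightarrow> real^3" where
  "Xd X i u = frechet_derivative X (at u) (axis i 1)"

text \<open>The coefficients E, F, G of the first fundamental form, for the indices 11, 12 and
  22.\<close>

definition first_form :: "(real^2 \<Rightarrow> real^3) \<Rightarrow> 2 \<Rightarrow> 2 \<Rightarrow> real^2 \<Rightarrow> real" where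
  "first_form X i j u = Xd X i u \<bullet> Xd X j u"

definition first_form_det :: "(real^2 \<Rightarrow> real^3) \<Rightarrow> real^2 \<Rightarrow> real" where
  "first_form_det X u = first_form X 1 1 u * first_form X 2 2 u - first_form X 1 2 u * first_form X 1 2 u"

definition dX :: "(real^2 \<Rightarrow> real^3) \<Rightarrow> real^2 \<Rightarrow> real^2 \<Rightarrow> real^3" where
  "dX X u \<xi> = \<xi>$1 *\<^sub>R Xd X 1 u + \<xi>$2 *\<^sub>R Xd X 2 u"

text \<open>The left inverse of \<open>dX X u\<close> that vanishes on normal vectors, written out by Cramer's rule.\<close>

definition pinv :: "(real^2 \<Rightarrow> real^3) \<Rightarrow> real^2 \<Rightarrow> real^3 \<Rightarrow> real^2" where
  "pinv X u w =
     ((first_form X 2 2 u * (w \<bullet> Xd X 1 u) - first_form X 1 2 u * (w \<bullet> Xd X 2 u)) * inverse (first_form_det X u)) *\<^sub>R axis 1 1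
   + ((first_form X 1 1 u * (w \<bullet> Xd X 2 u) - first_form X 1 2 u * (w \<bullet> Xd X 1 u)) * inverse (first_form_det X u)) *\<^sub>R axis 2 1"

text \<open>The part of the acceleration of \<open>X (u t)\<close> due to the second derivatives of
  \<open>X\<close>: with \<xi> = u' the acceleration is
  \<open>ddX X u \<xi> + dX X u \<xi>'\<close>.\<close>

definition ddX :: "(real^2 \<Rightarrow> real^3) \<Rightarrow> real^2 \<Rightarrow> real^2 \<Rightarrow> real^3" where
  "ddX X u \<xi> = \<xi>$1 *\<^sub>R dX (Xd X 1) u \<xi> + \<xi>$2 *\<^sub>R dX (Xd X 2) u \<xi>"

lemma vec2_eq: "(\<xi> :: real^2) = \<xi>$1 *\<^sub>R axis 1 1 + \<xi>$2 *\<^sub>R axis 2 1"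
  by (simp add: vec_eq_iff forall_2 axis_def)

lemma linear_dX: "linear (dX X u)"
  by (rule linearI) (auto simp: dX_def algebra_simps scaleR_add_left)

lemma bounded_linear_dX: "bounded_linear (dX X u)"
  using linear_dX linear_conv_bounded_linear by blast

lemma linear_pinv: "linear (pinv X u)"
  by (rule linearI) (auto simp: pinv_def algebra_simps inner_left_distrib scaleR_add_left)

lemma bounded_linear_pinv: "bounded_linear (pinv X u)"
  using linear_pinv linear_conv_bounded_linear by blast

lemma frechet_derivative_eq_dX:
  assumes "X differentiable (at u)"
  shows "frechet_derivative X (at u) = dX X u"
proof
  fix \<xi> :: "real^2"
  have lin: "linear (frechet_derivative X (at u))" by (rule linear_frechet_derivative[OF assms])
  have "frechet_derivative X (at u) \<xi> = frechet_derivative X (at u) (\<xi>$1 *\<^sub>R axis 1 1 + \<xi>$2 *\<^sub>R axis 2 1)"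
    using vec2_eq[of \<xi>] by simp
  also have "\<dots> = dX X u \<xi>"
    using lin by (simp add: linear_add linear_scale dX_def Xd_def)
  finally show "frechet_derivative X (at u) \<xi> = dX X u \<xi>" .
qed

lemma smooth_on_has_derivative_dX:
  assumes "smooth_on U X" "u \<in> U"
  shows "(X has_derivative dX X u) (at u)"
proof -
  have "Ck_on 1 U X" using assms(1) by (auto simp: smooth_on_def)
  then have "X differentiable (at u)" using assms(2) by simp
  then show ?thesis
    using frechet_derivative_works frechet_derivative_eq_dX by metis
qed

lemma smooth_on_Xd:
  assumes "smooth_on U X"
  shows "smooth_on U (Xd X i)"
  unfolding smooth_on_def
proof (intro conjI allI)
  show "open U" using assms by (simp add: smooth_on_def)
  fix k
  have "Ck_on (Suc k) U X" using assms by (auto simp: smooth_on_def)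
  moreover have "axis i 1 \<in> (Basis :: (real^2) set)" by (simp add: axis_in_Basis_iff)
  ultimately show "Ck_on k U (Xd X i)" by (auto simp: Xd_def[abs_def])
qed

lemma smooth_on_imp_lipb: "smooth_on U X \<Longrightarrow> cball a r \<subseteq> U \<Longrightarrow> lipb (cball a r) X"
  by (metis smooth_on_def Ck_on_1_imp_lipb)

lemma smooth_on_imp_continuous_on: "smooth_on U X \<Longrightarrow> continuous_on U X"
  unfolding smooth_on_def by (metis Ck_on.simps(1))

lemma lipschitz_on_fst: "1-lipschitz_on K fst"
  by (rule lipschitz_onI) (auto simp: dist_fst_le)

lemma lipb_fst: "lipb K f \<Longrightarrow> lipb (K \<times> B) (\<lambda>z. f (fst z))"
  by (rule lipb_compose[OF _ lipschitz_on_fst]) auto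

lemma lipb_snd: "lipb (K \<times> cball 0 r) snd"
  by (rule lipbI[where M = r and L = 1]) (auto simp: dist_snd_le dist_norm[symmetric])

lemma lipb_nth: "lipb K f \<Longrightarrow> lipb K (\<lambda>x. (f x :: real^2) $ i)"
  unfolding cart_eq_inner_axis by (intro lipb_inner lipb_const)

lemma lipb_Pair:
  assumes "lipb K f" "lipb K g"
  shows "lipb K (\<lambda>x. (f x, g x))"
proof -
  obtain M L M' L' where *: "\<And>x. x \<in> K \<Longrightarrow> norm (f x) \<le> M"
      "\<And>x y. x \<in> K \<Longrightarrow> y \<in> K \<Longrightarrow> norm (f x - f y) \<le> L * dist x y"
      "\<And>x. x \<in> K \<Longrightarrow> norm (g x) \<le> M'"
      "\<And>x y. x \<in> K \<Longrightarrow> y \<in> K \<Longrightarrow> norm (g x - g y) \<le> L' * dist x y"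
    using lipbD_bounded[OF assms(1)] lipbD_bounded[OF assms(2)]
      lipbD_lipschitz[OF assms(1)] lipbD_lipschitz[OF assms(2)] by metis
  show ?thesis
  proof (rule lipbI)
    fix x assume "x \<in> K"
    then show "norm (f x, g x) \<le> M + M'"
      using order_trans[OF norm_Pair_le add_mono] * by blast
  next
    fix x y assume x: "x \<in> K" "y \<in> K"
    show "norm ((f x, g x) - (f y, g y)) \<le> (L + L') * dist x y"
      using order_trans[OF norm_Pair_le add_mono[OF *(2)[OF x] *(4)[OF x]]] by (simp add: algebra_simps)
  qed
qed

section \<open>Inverse charts, tangent planes and the geodesic equation in coordinates\<close>

locale surface_chart =
  fixes S N :: "(real^3) set" and U :: "(real^2) set" and X :: "real^2 \<Rightarrow> real^3" and Y
  assumes open_N: "open N" and smooth: "smooth_on U X"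
    and homeo: "homeomorphism U (S \<inter> N) X Y"
    and inj: "\<forall>u\<in>U. inj (frechet_derivative X (at u))"
begin

lemma open_U: "open U"
  using smooth by (simp add: smooth_on_def)

lemma X_in: "u \<in> U \<Longrightarrow> X u \<in> S \<and> X u \<in> N" and Y_in: "P \<in> S \<Longrightarrow> P \<in> N \<Longrightarrow> Y P \<in> U"
  and YX: "u \<in> U \<Longrightarrow> Y (X u) = u" and XY: "P \<in> S \<Longrightarrow> P \<in> N \<Longrightarrow> X (Y P) = P"
  and cont_X: "continuous_on U X" and cont_Y: "continuous_on (S \<inter> N) Y"
  using homeo unfolding homeomorphism_def by blast+

lemmas X_deriv = smooth_on_has_derivative_dX[OF smooth]
lemmas Xd_smooth = smooth_on_Xd[OF smooth]
lemmas Xd_deriv = smooth_on_has_derivative_dX[OF Xd_smooth]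

lemma inj_dX: "u \<in> U \<Longrightarrow> inj (dX X u)"
  using inj frechet_derivative_at[OF X_deriv] by metis

lemma first_form_det_pos:
  assumes u: "u \<in> U"
  shows "0 < first_form_det X u"
proof -
  have z: "\<xi> = 0" if "dX X u \<xi> = 0" for \<xi>
    using inj_dX[OF u] linear_dX that linear_injective_0 by blast
  have "dX X u (axis 2 1) = Xd X 2 u" by (simp add: dX_def axis_def)
  then have "Xd X 2 u \<noteq> 0" using z[of "axis 2 1"] by auto
  then have g: "0 < first_form X 2 2 u" by (simp add: first_form_def)
  \<comment> \<open>\<open>dX X u \<zeta>\<close> is G times the component of X_1 orthogonal to X_2,
    so its squared length is G (E G - F^2).\<close>
  define \<zeta> :: "real^2" where "\<zeta> = first_form X 2 2 u *\<^sub>R axis 1 1 + (- first_form X 1 2 u) *\<^sub>R axis 2 1"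
  have c: "\<zeta>$1 = first_form X 2 2 u" "\<zeta>$2 = - first_form X 1 2 u" by (auto simp: \<zeta>_def axis_def)
  then have "dX X u \<zeta> \<noteq> 0" using z[of \<zeta>] g by auto
  then have "0 < dX X u \<zeta> \<bullet> dX X u \<zeta>" by simp
  also have "\<dots> = first_form X 2 2 u * first_form_det X u"
    by (simp add: dX_def c first_form_det_def first_form_def inner_add_left inner_add_right inner_commute algebra_simps)
  finally show ?thesis using g by (simp add: zero_less_mult_iff)
qed

lemma pinv_dX:
  assumes "u \<in> U"
  shows "pinv X u (dX X u \<xi>) = \<xi>"
proof -
  let ?E = "first_form X 1 1 u" and ?F = "first_form X 1 2 u" and ?G = "first_form X 2 2 u"
  have 1: "dX X u \<xi> \<bullet> Xd X 1 u = \<xi>$1 * ?E + \<xi>$2 * ?F" "dX X u \<xi> \<bullet> Xd X 2 u = \<xi>$1 * ?F + \<xi>$2 * ?G"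
    by (simp_all add: dX_def first_form_def inner_add_left inner_add_right inner_commute)
  have 2: "?G * (\<xi>$1 * ?E + \<xi>$2 * ?F) - ?F * (\<xi>$1 * ?F + \<xi>$2 * ?G) = \<xi>$1 * first_form_det X u"
    "?E * (\<xi>$1 * ?F + \<xi>$2 * ?G) - ?F * (\<xi>$1 * ?E + \<xi>$2 * ?F) = \<xi>$2 * first_form_det X u"
    by (auto simp: first_form_det_def algebra_simps)
  show ?thesis
    unfolding pinv_def 1 2 using first_form_det_pos[OF assms] vec2_eq[of \<xi>] by (simp add: mult.assoc)
qed

lemma pinv_normal: "w \<bullet> Xd X 1 u = 0 \<Longrightarrow> w \<bullet> Xd X 2 u = 0 \<Longrightarrow> pinv X u w = 0"
  by (simp add: pinv_def)

text \<open>A regular surface provides only a continuous inverse chart \<open>Y\<close>; this bound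
  makes \<open>Y\<close> locally Lipschitz. Near \<open>u0\<close> the map \<open>X\<close> minus
  its derivative at \<open>u0\<close> has a Lipschitz constant of at most half the lower bound
  \<open>m\<close> of that derivative.\<close>

lemma lower_lipschitz:
  assumes u0: "u0 \<in> U"
  shows "\<exists>r>0. \<exists>C>0. cball u0 r \<subseteq> U \<and>
    (\<forall>u\<in>cball u0 r. \<forall>v\<in>cball u0 r. norm (u - v) \<le> C * norm (X u - X v))"
proof -
  obtain m where m: "m > 0" "\<And>\<xi>. m * norm \<xi> \<le> norm (dX X u0 \<xi>)"
    using linear_inj_bounded_below_pos[OF linear_dX inj_dX[OF u0]] by metis
  have cont: "continuous_on U (Xd X i)" for i
    by (rule smooth_on_imp_continuous_on[OF Xd_smooth])
  \<comment> \<open>Two coordinates with deviation \<open>m / 4\<close> each give the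
    \<open>m / 2\<close> required below.\<close>
  have "\<exists>d>0. \<forall>u. dist u u0 < d \<longrightarrow> dist (Xd X i u) (Xd X i u0) < m / 4" for i
    using cont[of i] u0 open_U m(1) continuous_on_eq_continuous_at[OF open_U]
    by (metis continuous_at_eps_delta dist_norm divide_pos_pos zero_less_numeral)
  then obtain d where d: "\<And>i. d i > 0" "\<And>i u. dist u u0 < d i \<Longrightarrow> dist (Xd X i u) (Xd X i u0) < m / 4"
    by metis
  obtain e where e: "e > 0" "cball u0 e \<subseteq> U" using open_U u0 open_contains_cball by blast
  define r where "r = min e (min (d 1) (d 2) / 2)"
  have r: "r > 0" "cball u0 r \<subseteq> U" using e d(1)[of 1] d(1)[of 2] by (auto simp: r_def)
  define f where "f u = X u - dX X u0 u" for u
  have fd: "(f has_derivative (\<lambda>\<xi>. dX X u \<xi> - dX X u0 \<xi>)) (at u)" if "u \<in> U" for u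
    unfolding f_def using X_deriv[OF that] bounded_linear_imp_has_derivative[OF bounded_linear_dX]
    by (rule has_derivative_diff)
  have on: "onorm (\<lambda>\<xi>. dX X u \<xi> - dX X u0 \<xi>) \<le> m / 2" if u: "u \<in> cball u0 r" for u
  proof (rule onorm_le)
    fix \<xi> :: "real^2"
    have du: "dist u u0 < d 1" "dist u u0 < d 2"
      using u d(1)[of 1] d(1)[of 2] by (auto simp: r_def dist_commute)
    have "dX X u \<xi> - dX X u0 \<xi> = \<xi>$1 *\<^sub>R (Xd X 1 u - Xd X 1 u0) + \<xi>$2 *\<^sub>R (Xd X 2 u - Xd X 2 u0)"
      by (simp add: dX_def algebra_simps)
    also have "norm \<dots> \<le> norm \<xi> * (m / 4) + norm \<xi> * (m / 4)"
    proof (rule order_trans[OF norm_triangle_ineq add_mono])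
      show "norm (\<xi>$1 *\<^sub>R (Xd X 1 u - Xd X 1 u0)) \<le> norm \<xi> * (m / 4)"
        unfolding norm_scaleR using d(2)[OF du(1)] component_le_norm_cart[of \<xi> 1]
        by (intro mult_mono) (auto simp: dist_norm)
      show "norm (\<xi>$2 *\<^sub>R (Xd X 2 u - Xd X 2 u0)) \<le> norm \<xi> * (m / 4)"
        unfolding norm_scaleR using d(2)[OF du(2)] component_le_norm_cart[of \<xi> 2]
        by (intro mult_mono) (auto simp: dist_norm)
    qed
    finally show "norm (dX X u \<xi> - dX X u0 \<xi>) \<le> m / 2 * norm \<xi>" by simp
  qed
  have fl: "norm (f u - f v) \<le> m / 2 * norm (u - v)" if "u \<in> cball u0 r" "v \<in> cball u0 r" for u v
    using on that
    by (intro differentiable_bound[of "cball u0 r" f "\<lambda>u \<xi>. dX X u \<xi> - dX X u0 \<xi>"])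
      (auto intro!: has_derivative_at_withinI fd r(2)[THEN subsetD])
  have "norm (u - v) \<le> (2 / m) * norm (X u - X v)" if "u \<in> cball u0 r" "v \<in> cball u0 r" for u v
  proof -
    have "X u - X v = dX X u0 (u - v) + (f u - f v)"
      by (simp add: f_def linear_diff[OF linear_dX])
    then have "norm (dX X u0 (u - v)) \<le> norm (X u - X v) + norm (f u - f v)"
      by (metis norm_triangle_ineq4 add_diff_cancel_right')
    then have "m * norm (u - v) \<le> norm (X u - X v) + m / 2 * norm (u - v)"
      using m(2)[of "u - v"] fl[OF that] by linarith
    then show ?thesis using m(1) by (simp add: field_simps)
  qed
  then show ?thesis using r m(1) by (intro exI[of _ r] conjI exI[of _ "2 / m"]) auto
qed

text \<open>\<open>Y\<close> lives on \<open>S \<inter> N\<close>, which is not an open subset of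
  space, so the chain rule does not apply to it. Instead the first order expansions of
  \<open>c\<close> and of \<open>X\<close> along u = Y o c are subtracted, and \<open>pinv\<close>
  is applied, which cancels \<open>dX\<close>.\<close>

lemma curve_in_chart_deriv:
  assumes "open J" "s \<in> J" "c ` J \<subseteq> S" "c s \<in> N" and c: "(c has_vector_derivative w) (at s)"
  shows curve_deriv: "((\<lambda>t. Y (c t)) has_vector_derivative pinv X (Y (c s)) w) (at s)"
    and curve_velocity_in_range: "dX X (Y (c s)) (pinv X (Y (c s)) w) = w"
proof -
  define u where "u t = Y (c t)" for t
  have cs: "c s \<in> S" using assms by auto
  have us: "u s \<in> U" using Y_in[OF cs assms(4)] by (simp add: u_def)
  have cc: "isCont c s" using c by (rule has_vector_derivative_continuous)
  have ev1: "\<forall>\<^sub>F t in at s. c t \<in> S \<inter> N"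
  proof -
    have "\<forall>\<^sub>F t in at s. t \<in> J" using assms(1,2) by (rule eventually_at_in_open')
    moreover have "\<forall>\<^sub>F t in at s. c t \<in> N"
      using cc open_N assms(4) unfolding isCont_def by (rule topological_tendstoD)
    ultimately show ?thesis by eventually_elim (use assms(3) in auto)
  qed
  have lim: "(u \<longlongrightarrow> u s) (at s)"
    unfolding u_def using cs assms(4) ev1 cc
    by (intro continuous_on_tendsto_compose[OF cont_Y]) (auto simp: isCont_def)
  obtain r C where rC: "r > 0" "C > 0" "cball (u s) r \<subseteq> U"
    "\<forall>x\<in>cball (u s) r. \<forall>y\<in>cball (u s) r. norm (x - y) \<le> C * norm (X x - X y)"
    using lower_lipschitz[OF us] by metis
  have ev2: "\<forall>\<^sub>F t in at s. norm (u t - u s) \<le> C * norm (c t - c s) \<and> X (u t) = c t"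
    using ev1 tendstoD[OF lim rC(1)]
  proof eventually_elim
    case (elim t)
    then have "u t \<in> cball (u s) r" "X (u t) = c t" using XY by (auto simp: u_def dist_commute)
    moreover have "u s \<in> cball (u s) r" "X (u s) = c s" using rC(1) XY cs assms(4) by (auto simp: u_def)
    ultimately show ?case using rC(4) by fastforce
  qed
  have Xs: "X (u s) = c s" using XY cs assms(4) by (auto simp: u_def)
  have r1: "((\<lambda>t. (c t - c s - (t - s) *\<^sub>R w) /\<^sub>R norm (t - s)) \<longlongrightarrow> 0) (at s)"
    using c unfolding has_vector_derivative_def has_derivative_at_within by simp
  \<comment> \<open>The remainder of \<open>X\<close> is small relative to \<open>u t - u s\<close>;
    the lower Lipschitz bound makes it small relative to \<open>t - s\<close>.\<close>
  have r2: "((\<lambda>t. (X (u t) - X (u s) - dX X (u s) (u t - u s)) /\<^sub>R norm (t - s)) \<longlongrightarrow> 0) (at s)"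
  proof (rule tendstoI)
    fix \<epsilon> :: real assume \<epsilon>: "\<epsilon> > 0"
    define B where "B = norm w + 1"
    have B: "B > 0" by (simp add: B_def add_nonneg_pos)
    \<comment> \<open>Chosen so that \<eta> * C * B = \<epsilon> / 2, where \<open>B\<close> bounds
      the difference quotients of \<open>c\<close> near \<open>s\<close>.\<close>
    define \<eta> where "\<eta> = \<epsilon> / (2 * C * B)"
    have \<eta>: "\<eta> > 0" using \<epsilon> B rC(2) by (simp add: \<eta>_def)
    obtain d where d: "d > 0" "\<And>y. norm (y - u s) < d \<Longrightarrow>
        norm (X y - X (u s) - dX X (u s) (y - u s)) \<le> \<eta> * norm (y - u s)"
      using X_deriv[OF us] \<eta> unfolding has_derivative_at_alt by blast
    show "\<forall>\<^sub>F t in at s. dist ((X (u t) - X (u s) - dX X (u s) (u t - u s)) /\<^sub>R norm (t - s)) 0 < \<epsilon>"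
      using tendstoD[OF lim d(1)] tendstoD[OF r1 zero_less_one] ev2 eventually_neq_at_within[of s s UNIV]
    proof eventually_elim
      case (elim t)
      have p: "norm (t - s) > 0" using elim(4) by simp
      have "norm (c t - c s - (t - s) *\<^sub>R w) < norm (t - s)"
        using elim(2) p by (simp add: pos_divide_less_eq divide_inverse_commute[symmetric])
      then have "norm (c t - c s) \<le> B * norm (t - s)"
        using norm_triangle_sub[of "c t - c s" "(t - s) *\<^sub>R w"]
        unfolding norm_scaleR B_def distrib_right by (simp add: mult.commute)
      then have "C * norm (c t - c s) \<le> C * (B * norm (t - s))"
        using rC(2) by (intro mult_left_mono) auto
      then have "norm (u t - u s) \<le> C * (B * norm (t - s))" using elim(3) by linarith
      then have "\<eta> * norm (u t - u s) \<le> \<eta> * (C * (B * norm (t - s)))"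
        using \<eta> by (intro mult_left_mono) auto
      moreover have "norm (X (u t) - X (u s) - dX X (u s) (u t - u s)) \<le> \<eta> * norm (u t - u s)"
        using d(2)[of "u t"] elim(1) by (simp add: dist_norm)
      moreover have "\<eta> * (C * (B * norm (t - s))) = \<epsilon> / 2 * norm (t - s)"
        using rC(2) B by (simp add: \<eta>_def)
      ultimately have "norm (X (u t) - X (u s) - dX X (u s) (u t - u s)) \<le> \<epsilon> / 2 * norm (t - s)"
        by linarith
      then have "norm ((X (u t) - X (u s) - dX X (u s) (u t - u s)) /\<^sub>R norm (t - s)) \<le> \<epsilon> / 2"
        using p by (simp add: pos_divide_le_eq divide_inverse_commute[symmetric])
      then show ?case using \<epsilon> by simp
    qed
  qed
  let ?M = "pinv X (u s)"
  have "((\<lambda>t. ?M ((c t - c s - (t - s) *\<^sub>R w) /\<^sub>R norm (t - s)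
      - (X (u t) - X (u s) - dX X (u s) (u t - u s)) /\<^sub>R norm (t - s))) \<longlongrightarrow> ?M (0 - 0)) (at s)"
    by (intro bounded_linear.tendsto[OF bounded_linear_pinv] tendsto_diff r1 r2)
  then have "((\<lambda>t. ?M ((c t - c s - (t - s) *\<^sub>R w) /\<^sub>R norm (t - s)
      - (X (u t) - X (u s) - dX X (u s) (u t - u s)) /\<^sub>R norm (t - s))) \<longlongrightarrow> 0) (at s)"
    by (simp add: linear_0[OF linear_pinv])
  then have "((\<lambda>t. (u t - u s - (t - s) *\<^sub>R ?M w) /\<^sub>R norm (t - s)) \<longlongrightarrow> 0) (at s)"
  proof (rule Lim_transform_eventually)
    show "\<forall>\<^sub>F t in at s. ?M ((c t - c s - (t - s) *\<^sub>R w) /\<^sub>R norm (t - s)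
      - (X (u t) - X (u s) - dX X (u s) (u t - u s)) /\<^sub>R norm (t - s))
      = (u t - u s - (t - s) *\<^sub>R ?M w) /\<^sub>R norm (t - s)"
      using ev2
    proof eventually_elim
      case (elim t)
      have "(c t - c s - (t - s) *\<^sub>R w) /\<^sub>R norm (t - s)
        - (X (u t) - X (u s) - dX X (u s) (u t - u s)) /\<^sub>R norm (t - s)
        = (dX X (u s) (u t - u s) - (t - s) *\<^sub>R w) /\<^sub>R norm (t - s)"
        using elim Xs by (simp add: algebra_simps)
      then show ?case
        using linear_scale[OF linear_pinv] linear_diff[OF linear_pinv] pinv_dX[OF us] by simp
    qed
  qed
  then have ud: "(u has_vector_derivative ?M w) (at s)"
    unfolding has_vector_derivative_def has_derivative_at_within
    by (simp add: bounded_linear_scaleR_left)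
  then show "((\<lambda>t. Y (c t)) has_vector_derivative pinv X (Y (c s)) w) (at s)"
    by (simp add: u_def[abs_def])
  \<comment> \<open>Near \<open>s\<close> the curve \<open>c\<close> equals X o u, so the chain rule
    computes its velocity a second time and shows it to lie in the range of
    \<open>dX\<close>.\<close>
  have "((\<lambda>t. X (u t)) has_vector_derivative dX X (u s) (?M w)) (at s)"
    using diff_chain_at[OF ud[unfolded has_vector_derivative_def] X_deriv[OF us]]
    by (simp add: has_vector_derivative_def o_def linear_scale[OF linear_dX])
  moreover have "((\<lambda>t. X (u t)) has_vector_derivative w) (at s)"
  proof -
    have "\<forall>\<^sub>F t in nhds s. c t = X (u t)"
      using ev2 Xs by (auto simp: eventually_nhds_conv_at elim: eventually_mono)
    then show ?thesis
      using c Xs has_vector_derivative_cong_ev[where f = c and g = "\<lambda>t. X (u t)" and x = s and S = UNIV]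
      by (auto elim: eventually_mono)
  qed
  ultimately show "dX X (Y (c s)) (pinv X (Y (c s)) w) = w"
    using vector_derivative_unique_at by (metis u_def)
qed

lemma tangent_plane_eq:
  assumes "P \<in> S" "P \<in> N"
  shows "tangent_plane S P = range (dX X (Y P))"
proof (intro equalityI subsetI)
  fix v assume "v \<in> tangent_plane S P"
  then obtain c \<epsilon> where c: "0 < \<epsilon>" "c ` {-\<epsilon><..<\<epsilon>} \<subseteq> S" "c 0 = P" "(c has_vector_derivative v) (at 0)"
    by (auto simp: tangent_plane_def)
  have "dX X (Y (c 0)) (pinv X (Y (c 0)) v) = v"
    by (rule curve_velocity_in_range[of "{-\<epsilon><..<\<epsilon>}"]) (use c assms in auto)
  then show "v \<in> range (dX X (Y P))" using c(3) by (metis rangeI)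
next
  fix v assume "v \<in> range (dX X (Y P))"
  then obtain \<xi> where v: "v = dX X (Y P) \<xi>" by auto
  define u0 where "u0 = Y P"
  have u0: "u0 \<in> U" using assms Y_in by (simp add: u0_def)
  obtain e where e: "e > 0" "ball u0 e \<subseteq> U" using open_U u0 open_contains_ball by blast
  \<comment> \<open>A straight line in the chart realises \<open>v\<close>; \<epsilon> keeps it in
    the ball around \<open>u0\<close>, and the summand 1 covers \<xi> = 0.\<close>
  define \<epsilon> where "\<epsilon> = e / (norm \<xi> + 1)"
  have \<epsilon>: "\<epsilon> > 0" using e(1) by (simp add: \<epsilon>_def add_nonneg_pos)
  have mem: "u0 + t *\<^sub>R \<xi> \<in> U" if "t \<in> {-\<epsilon><..<\<epsilon>}" for t
  proof -
    have "\<bar>t\<bar> * norm \<xi> \<le> \<bar>t\<bar> * (norm \<xi> + 1)" by (intro mult_left_mono) auto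
    also have "\<dots> < \<epsilon> * (norm \<xi> + 1)" using that by (intro mult_strict_right_mono) (auto simp: add_nonneg_pos)
    also have "\<dots> = e" by (simp add: \<epsilon>_def add_nonneg_eq_0_iff)
    finally have "u0 + t *\<^sub>R \<xi> \<in> ball u0 e" by (simp add: dist_norm)
    then show ?thesis using e(2) by blast
  qed
  show "v \<in> tangent_plane S P"
    unfolding tangent_plane_def
  proof (intro CollectI exI[of _ "\<lambda>t. X (u0 + t *\<^sub>R \<xi>)"] exI[of _ \<epsilon>] conjI)
    show "smooth_on {-\<epsilon><..<\<epsilon>} (\<lambda>t. X (u0 + t *\<^sub>R \<xi>))"
      by (rule smooth_on_affine[OF smooth]) (use mem in \<open>auto intro: bounded_linear_scaleR_left\<close>)
    show "(\<lambda>t. X (u0 + t *\<^sub>R \<xi>)) ` {-\<epsilon><..<\<epsilon>} \<subseteq> S" using mem X_in by auto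
    show "X (u0 + 0 *\<^sub>R \<xi>) = P" using XY assms by (simp add: u0_def)
    have "((\<lambda>t. u0 + t *\<^sub>R \<xi>) has_derivative (\<lambda>t. t *\<^sub>R \<xi>)) (at 0)"
      by (auto intro!: derivative_eq_intros)
    from diff_chain_at[OF this, of X "dX X u0"] X_deriv[OF u0]
    show "((\<lambda>t. X (u0 + t *\<^sub>R \<xi>)) has_vector_derivative v) (at 0)"
      by (simp add: has_vector_derivative_def o_def linear_scale[OF linear_dX] v u0_def)
  qed (rule \<epsilon>)
qed

lemma Xd_tangent:
  assumes "P \<in> S" "P \<in> N"
  shows "Xd X i (Y P) \<in> tangent_plane S P"
proof -
  have "Xd X 1 (Y P) = dX X (Y P) (axis 1 1)" "Xd X 2 (Y P) = dX X (Y P) (axis 2 1)"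
    by (auto simp: dX_def axis_def)
  then show ?thesis using exhaust_2[of i] tangent_plane_eq[OF assms] by auto
qed

text \<open>The term \<open>- pinv X (u s) (ddX X (u s) (\<xi> s))\<close> is the Christoffel term
  of the geodesic equation. The acceleration \<open>ddX + dX \<xi>'\<close> is orthogonal to the
  surface, so \<open>pinv\<close> annihilates it, while \<open>pinv\<close> takes
  \<open>dX \<xi>'\<close> back to \<xi>'. Position and chart velocity thus solve a first order
  system.\<close>

lemma geodesic_ode:
  assumes g: "geodesic_on S a b c" and s: "s \<in> {a<..<b}" and cs: "c s \<in> N"
  defines "u \<equiv> \<lambda>t. Y (c t)" and "\<xi> \<equiv> \<lambda>t. pinv X (Y (c t)) (velocity c t)"
  shows geodesic_ode1: "(u has_vector_derivative \<xi> s) (at s)"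
    and geodesic_ode2: "(\<xi> has_vector_derivative - pinv X (u s) (ddX X (u s) (\<xi> s))) (at s)"
    and geodesic_second_derivative:
      "velocity (velocity c) s = ddX X (u s) (\<xi> s) - dX X (u s) (pinv X (u s) (ddX X (u s) (\<xi> s)))"
    and geodesic_velocity: "velocity c s = dX X (u s) (\<xi> s)"
proof -
  have sm: "smooth_on {a<..<b} c" and cS: "c ` {a<..<b} \<subseteq> S"
    using g by (auto simp: geodesic_on_def)
  have cd: "(c has_vector_derivative velocity c t) (at t)"
    and cdd: "(velocity c has_vector_derivative velocity (velocity c) t) (at t)" if "t \<in> {a<..<b}" for t
    using smooth_on_curve[OF sm that] by auto
  have "\<forall>\<^sub>F t in nhds s. t \<in> {a<..<b}" using s by (intro eventually_nhds_in_open) auto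
  moreover have "\<forall>\<^sub>F t in nhds s. c t \<in> N"
  proof -
    have "isCont c s" using cd[OF s] by (rule has_vector_derivative_continuous)
    then show ?thesis
      using open_N cs by (auto simp: continuous_at_open eventually_nhds)
  qed
  ultimately have "\<forall>\<^sub>F t in nhds s. t \<in> {a<..<b} \<and> c t \<in> N" by eventually_elim auto
  then obtain J where J: "open J" "s \<in> J" "\<And>t. t \<in> J \<Longrightarrow> t \<in> {a<..<b} \<and> c t \<in> N"
    by (auto simp: eventually_nhds)
  have JS: "c ` J \<subseteq> S" using cS J(3) by auto
  have ud: "(u has_vector_derivative \<xi> t) (at t)" and vel: "velocity c t = dX X (u t) (\<xi> t)" if "t \<in> J" for t
    using curve_in_chart_deriv[OF J(1) that JS _ cd] J(3)[OF that] by (auto simp: u_def \<xi>_def)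
  show "(u has_vector_derivative \<xi> s) (at s)" "velocity c s = dX X (u s) (\<xi> s)"
    using ud vel J(2) by auto
  have us: "u s \<in> U" unfolding u_def by (rule Y_in) (use cS s cs in auto)
  have Xdu: "((\<lambda>t. Xd X i (u t)) has_vector_derivative dX (Xd X i) (u s) (\<xi> s)) (at s)" for i
    using diff_chain_at[OF ud[OF J(2), unfolded has_vector_derivative_def] Xd_deriv[OF us]]
    by (simp add: has_vector_derivative_def o_def linear_scale[OF linear_dX])
  \<comment> \<open>The product rule below presupposes that \<xi>' exists; Cramer's formula writes
    \<xi> as a quotient of differentiable functions with nonzero denominator.\<close>
  have "\<xi> differentiable (at s)"
  proof -
    have "(\<lambda>t. Xd X i (u t)) differentiable (at s)" for i
      using Xdu[of i] by (auto simp: has_vector_derivative_def differentiable_def)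
    moreover have "velocity c differentiable (at s)"
      using cdd[OF s] by (auto simp: has_vector_derivative_def differentiable_def)
    moreover have "first_form_det X (u s) \<noteq> 0" using first_form_det_pos[OF us] by simp
    ultimately show ?thesis
      unfolding \<xi>_def pinv_def first_form_det_def first_form_def u_def by simp
  qed
  then obtain \<xi>' where \<xi>': "(\<xi> has_vector_derivative \<xi>') (at s)"
    using vector_derivative_works by blast
  have \<xi>c: "((\<lambda>t. \<xi> t $ i) has_vector_derivative \<xi>' $ i) (at s)" for i
    using bounded_linear.has_vector_derivative[OF bounded_linear_vec_nth \<xi>'] by simp
  have "((\<lambda>t. dX X (u t) (\<xi> t)) has_vector_derivative (ddX X (u s) (\<xi> s) + dX X (u s) \<xi>')) (at s)"
  proof -
    have "((\<lambda>t. \<xi> t $ i *\<^sub>R Xd X i (u t)) has_vector_derivative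
        (\<xi> s $ i *\<^sub>R dX (Xd X i) (u s) (\<xi> s) + \<xi>' $ i *\<^sub>R Xd X i (u s))) (at s)" for i
      by (rule has_vector_derivative_scaleR[OF _ Xdu])
        (simp add: has_real_derivative_iff_has_vector_derivative \<xi>c)
    from has_vector_derivative_add[OF this[of 1] this[of 2]] show ?thesis
      by (simp add: ddX_def dX_def[of X] algebra_simps)
  qed
  then have "(velocity c has_vector_derivative (ddX X (u s) (\<xi> s) + dX X (u s) \<xi>')) (at s)"
    by (rule has_vector_derivative_transform_within_open[OF _ J(1,2)]) (simp add: vel)
  then have acc: "velocity (velocity c) s = ddX X (u s) (\<xi> s) + dX X (u s) \<xi>'"
    by (rule vector_derivative_at)
  have "velocity (velocity c) s \<bullet> Xd X i (u s) = 0" for i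
  proof -
    have "Xd X i (Y (c s)) \<in> tangent_plane S (c s)"
      by (rule Xd_tangent) (use cs cS s in auto)
    then show ?thesis using g s by (auto simp: geodesic_on_def u_def)
  qed
  then have "pinv X (u s) (ddX X (u s) (\<xi> s) + dX X (u s) \<xi>') = 0"
    using pinv_normal acc by metis
  then have \<xi>'_eq: "\<xi>' = - pinv X (u s) (ddX X (u s) (\<xi> s))"
    by (simp add: linear_add[OF linear_pinv] pinv_dX[OF us] eq_neg_iff_add_eq_0 add.commute)
  show "(\<xi> has_vector_derivative - pinv X (u s) (ddX X (u s) (\<xi> s))) (at s)"
    using \<xi>' \<xi>'_eq by simp
  show "velocity (velocity c) s = ddX X (u s) (\<xi> s) - dX X (u s) (pinv X (u s) (ddX X (u s) (\<xi> s)))"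
    using acc \<xi>'_eq by (simp add: linear_neg[OF linear_dX])
qed

section \<open>Lipschitz bounds for the geodesic equation in a chart\<close>

lemma lipb_dX:
  assumes "cball u0 r \<subseteq> U"
  shows "lipb (cball u0 r \<times> cball 0 R) (\<lambda>z. dX X (fst z) (snd z))"
  unfolding dX_def
  by (intro lipb_add lipb_scaleR lipb_nth lipb_snd lipb_fst smooth_on_imp_lipb[OF Xd_smooth assms])

lemma lipb_ddX:
  assumes "cball u0 r \<subseteq> U"
  shows "lipb (cball u0 r \<times> cball 0 R) (\<lambda>z. ddX X (fst z) (snd z))"
  unfolding ddX_def dX_def
  by (intro lipb_add lipb_scaleR lipb_nth lipb_snd lipb_fst
      smooth_on_imp_lipb[OF smooth_on_Xd[OF Xd_smooth] assms])

text \<open>The determinant has a positive minimum on the compact ball, so its inverse is bounded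
  and Lipschitz there.\<close>

lemma lipb_pinv:
  assumes "cball u0 r \<subseteq> U" "lipb (cball u0 r \<times> K) w"
  shows "lipb (cball u0 r \<times> K) (\<lambda>z. pinv X (fst z) (w z))"
proof -
  have g: "lipb (cball u0 r) (first_form X i j)" for i j
    unfolding first_form_def[abs_def] by (intro lipb_inner smooth_on_imp_lipb[OF Xd_smooth assms(1)])
  have d: "lipb (cball u0 r) (first_form_det X)"
    unfolding first_form_det_def[abs_def] by (intro lipb_diff lipb_mult g)
  have "continuous_on (cball u0 r) (first_form_det X)"
    using d unfolding lipb_def by (auto intro: lipschitz_on_continuous_on)
  then have "\<exists>m>0. \<forall>u\<in>cball u0 r. m \<le> first_form_det X u"
  proof (cases "cball u0 r = {}")
    case False
    then obtain x where "x \<in> cball u0 r" "\<forall>u\<in>cball u0 r. first_form_det X x \<le> first_form_det X u"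
      using continuous_attains_inf[OF compact_cball _ \<open>continuous_on (cball u0 r) (first_form_det X)\<close>] by blast
    then show ?thesis using first_form_det_pos assms(1) by blast
  qed (auto intro: exI[of _ 1])
  then obtain m where m: "m > 0" "\<And>u. u \<in> cball u0 r \<Longrightarrow> m \<le> first_form_det X u" by auto
  show ?thesis
    unfolding pinv_def
    by (intro lipb_add lipb_scaleR lipb_mult lipb_diff lipb_inner lipb_fst lipb_const assms(2) g
        smooth_on_imp_lipb[OF Xd_smooth assms(1)] lipb_inverse[OF d m])
qed

end

lemma regular_surface_chart:
  assumes "regular_surface S" "P \<in> S"
  obtains N U X Y where "surface_chart S N U X Y" "P \<in> N"
  using assms unfolding regular_surface_def surface_chart_def by metis

section \<open>Local dependence of geodesics on their initial data\<close>

lemma geodesic_on_lipschitz: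
  assumes "geodesic_on S a b c" "s \<in> {a<..<b}" "t \<in> {a<..<b}"
  shows "norm (c s - c t) \<le> \<bar>s - t\<bar>"
proof -
  have d: "(c has_vector_derivative velocity c t) (at t)" "norm (velocity c t) = 1" if "t \<in> {a<..<b}" for t
    using smooth_on_curve_derivative[of "{a<..<b}" c t] assms(1) that by (auto simp: geodesic_on_def)
  have "norm (c s - c t) \<le> 1 * norm (s - t)"
    using assms d
    by (intro differentiable_bound[of "{a<..<b}" c "\<lambda>t h. h *\<^sub>R velocity c t"])
      (auto intro: has_derivative_at_withinI onorm_le simp: has_vector_derivative_def)
  then show ?thesis by simp
qed

text \<open>The constants do not depend on the curves, because in a chart all nearby geodesics solve
  the same first order system, with Lipschitz right side on a compact set. Gronwall's inequality
  gives the first claim. Unit speed bounds the chart velocities and with them the accelerations,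
  which gives the second.\<close>

lemma geodesic_local_stability:
  assumes S: "regular_surface S" and P0: "P0 \<in> S"
  shows "\<exists>\<rho>>0. \<exists>C\<ge>1. \<forall>c1 c2 a1 b1 a2 b2 s0 s1.
    geodesic_on S a1 b1 c1 \<longrightarrow> geodesic_on S a2 b2 c2 \<longrightarrow> a1 < s0 \<longrightarrow> a2 < s0 \<longrightarrow> s0 \<le> s1 \<longrightarrow> s1 < b1 \<longrightarrow>
    s1 < b2 \<longrightarrow> s1 - s0 \<le> \<rho> \<longrightarrow> dist (c1 s0) P0 \<le> \<rho> \<longrightarrow> dist (c2 s0) P0 \<le> \<rho> \<longrightarrow>
    norm (c1 s1 - c2 s1) + norm (velocity c1 s1 - velocity c2 s1)
      \<le> C * (norm (c1 s0 - c2 s0) + norm (velocity c1 s0 - velocity c2 s0))"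
    and "\<exists>\<rho>>0. \<exists>K\<ge>0. \<forall>c a b s. geodesic_on S a b c \<longrightarrow> s \<in> {a<..<b} \<longrightarrow> dist (c s) P0 \<le> \<rho> \<longrightarrow>
      norm (velocity (velocity c) s) \<le> K"
proof -
  obtain N U X Y where "surface_chart S N U X Y" and PN: "P0 \<in> N"
    using regular_surface_chart[OF S P0] by metis
  then interpret surface_chart S N U X Y by simp
  define u0 where "u0 = Y P0"
  have u0: "u0 \<in> U" using Y_in P0 PN by (simp add: u0_def)
  obtain r C0 where r: "r > 0" "C0 > 0" "cball u0 r \<subseteq> U"
    and C0: "\<forall>u\<in>cball u0 r. \<forall>v\<in>cball u0 r. norm (u - v) \<le> C0 * norm (X u - X v)"
    using lower_lipschitz[OF u0] by metis
  obtain d1 where d1: "d1 > 0" "\<And>P. P \<in> S \<Longrightarrow> P \<in> N \<Longrightarrow> dist P P0 < d1 \<Longrightarrow> dist (Y P) u0 < r"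
    using cont_Y P0 PN r(1) unfolding continuous_on_iff u0_def by (metis IntI)
  obtain d2 where d2: "d2 > 0" "ball P0 d2 \<subseteq> N" using open_N PN open_contains_ball by blast
  \<comment> \<open>A geodesic that starts within \<rho> of \<open>P0\<close> and runs for time at
    most \<rho> stays within 2 \<rho> by unit speed; the divisor 3 keeps 2 \<rho> below both
    radii.\<close>
  define \<rho> where "\<rho> = min d1 d2 / 3"
  have \<rho>: "\<rho> > 0" using d1 d2 by (simp add: \<rho>_def)
  have near: "P \<in> N" "Y P \<in> cball u0 r" if "P \<in> S" "dist P P0 \<le> 2 * \<rho>" for P
  proof -
    have "dist P P0 < d1" "dist P P0 < d2" using that(2) \<rho> by (auto simp: \<rho>_def)
    then show "P \<in> N" using d2(2) by (auto simp: dist_commute)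
    then show "Y P \<in> cball u0 r" using d1(2)[OF that(1)] \<open>dist P P0 < d1\<close> by (force simp: dist_commute)
  qed
  let ?K1 = "cball u0 r"
  have lp: "lipb (?K1 \<times> cball (0::real^3) 1) (\<lambda>z. pinv X (fst z) (snd z))"
    by (rule lipb_pinv[OF r(3) lipb_snd])
  \<comment> \<open>\<open>R\<close> bounds the chart velocities of unit tangent vectors, so the
    states of nearby geodesics lie in the compact set \<open>?K2\<close>.\<close>
  obtain R where R: "R \<ge> 0" "\<And>u w. u \<in> ?K1 \<Longrightarrow> norm w \<le> 1 \<Longrightarrow> norm (pinv X u w) \<le> R"
    using lipbD_bounded[OF lp] by auto
  obtain L2 where L2: "L2 \<ge> 0" "\<And>u w u' w'. u \<in> ?K1 \<Longrightarrow> norm w \<le> 1 \<Longrightarrow> u' \<in> ?K1 \<Longrightarrow> norm w' \<le> 1 \<Longrightarrow>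
      norm (pinv X u w - pinv X u' w') \<le> L2 * dist (u, w) (u', w')"
    using lipbD_lipschitz[OF lp] by (auto simp: Ball_def) 
  let ?K2 = "?K1 \<times> cball (0::real^2) R"
  let ?F = "\<lambda>z. - pinv X (fst z) (ddX X (fst z) (snd z))"
  have lF: "lipb ?K2 ?F"
    by (intro lipb_minus lipb_pinv lipb_ddX r(3))
  have "lipb ?K2 (\<lambda>z. (snd z, ?F z))"
    by (intro lipb_Pair lipb_snd lF)
  then obtain L where L: "L \<ge> 0" "\<And>z z'. z \<in> ?K2 \<Longrightarrow> z' \<in> ?K2 \<Longrightarrow> norm ((snd z, ?F z) - (snd z', ?F z')) \<le> L * dist z z'"
    using lipbD_lipschitz by meson
  have "lipb ?K2 (\<lambda>z. (X (fst z), dX X (fst z) (snd z)))"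
    by (intro lipb_Pair lipb_fst smooth_on_imp_lipb[OF smooth] lipb_dX r(3))
  then obtain L1 where L1: "L1 \<ge> 0" "\<And>z z'. z \<in> ?K2 \<Longrightarrow> z' \<in> ?K2 \<Longrightarrow>
      norm ((X (fst z), dX X (fst z) (snd z)) - (X (fst z'), dX X (fst z') (snd z'))) \<le> L1 * dist z z'"
    using lipbD_lipschitz by meson
  have geo: "c s \<in> N \<and> c s \<in> S \<and> Y (c s) \<in> ?K1 \<and> X (Y (c s)) = c s \<and> norm (velocity c s) = 1 \<and>
      (Y (c s), pinv X (Y (c s)) (velocity c s)) \<in> ?K2"
    if "geodesic_on S a b c" "s \<in> {a<..<b}" "dist (c s) P0 \<le> 2 * \<rho>" for a b c s
  proof -
    have "c s \<in> S" "norm (velocity c s) = 1" using that(1,2) by (auto simp: geodesic_on_def)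
    then show ?thesis using near[of "c s"] that(3) XY R(2)[of "Y (c s)" "velocity c s"] by auto
  qed
  show "\<exists>\<rho>>0. \<exists>K\<ge>0. \<forall>c a b s. geodesic_on S a b c \<longrightarrow> s \<in> {a<..<b} \<longrightarrow> dist (c s) P0 \<le> \<rho> \<longrightarrow>
      norm (velocity (velocity c) s) \<le> K"
  proof -
    obtain M1 where M1: "\<And>z. z \<in> ?K2 \<Longrightarrow> norm (ddX X (fst z) (snd z)) \<le> M1" "M1 \<ge> 0"
      using lipbD_bounded[OF lipb_ddX[OF r(3), of R]] by blast
    obtain M2 where M2: "\<And>z. z \<in> ?K2 \<Longrightarrow> norm (?F z) \<le> M2" "M2 \<ge> 0"
      using lipbD_bounded[OF lF] by blast
    obtain M3 where M3: "\<And>z. z \<in> ?K1 \<times> cball (0::real^2) M2 \<Longrightarrow> norm (dX X (fst z) (snd z)) \<le> M3" "M3 \<ge> 0"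
      using lipbD_bounded[OF lipb_dX[OF r(3), of M2]] by blast
    show ?thesis
    proof (intro exI conjI allI impI)
      fix c a b s assume g: "geodesic_on S a b c" "s \<in> {a<..<b}" "dist (c s) P0 \<le> \<rho>"
      define z where "z = (Y (c s), pinv X (Y (c s)) (velocity c s))"
      have cs: "c s \<in> N" and z: "z \<in> ?K2"
        using geo[OF g(1,2)] g(3) \<rho> by (auto simp: z_def)
      have "norm (dX X (fst z) (- ?F z)) \<le> M3"
        using M3(1)[of "(fst z, - ?F z)"] z M2(1)[OF z] by auto
      moreover have "velocity (velocity c) s = ddX X (fst z) (snd z) - dX X (fst z) (- ?F z)"
        using geodesic_second_derivative[OF g(1,2) cs] by (simp add: z_def)
      ultimately show "norm (velocity (velocity c) s) \<le> M1 + M3"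
        using order_trans[OF norm_triangle_ineq4 add_mono[OF M1(1)[OF z]]] by simp
    qed (use \<rho> M1 M3 in auto)
  qed
  \<comment> \<open>A product of Lipschitz constants: \<open>C0\<close> and
    \<open>L2 * (C0 + 1)\<close> lead from space to the chart, exp (L \<rho>) is Gronwall's factor,
    \<open>L1\<close> leads back to space, and 2 compares a sum of two norms with the norm of the
    pair.\<close>
  define C where "C = max 1 (2 * L1 * (exp (L * \<rho>) * (C0 + L2 * (C0 + 1))))"
  show "\<exists>\<rho>>0. \<exists>C\<ge>1. \<forall>c1 c2 a1 b1 a2 b2 s0 s1.
    geodesic_on S a1 b1 c1 \<longrightarrow> geodesic_on S a2 b2 c2 \<longrightarrow> a1 < s0 \<longrightarrow> a2 < s0 \<longrightarrow> s0 \<le> s1 \<longrightarrow> s1 < b1 \<longrightarrow>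
    s1 < b2 \<longrightarrow> s1 - s0 \<le> \<rho> \<longrightarrow> dist (c1 s0) P0 \<le> \<rho> \<longrightarrow> dist (c2 s0) P0 \<le> \<rho> \<longrightarrow>
    norm (c1 s1 - c2 s1) + norm (velocity c1 s1 - velocity c2 s1)
      \<le> C * (norm (c1 s0 - c2 s0) + norm (velocity c1 s0 - velocity c2 s0))"
  proof (rule exI[of _ \<rho>], rule conjI[OF \<rho>], rule exI[of _ C], rule conjI, simp add: C_def, intro allI impI)
    fix c1 c2 a1 b1 a2 b2 s0 s1
    assume g: "geodesic_on S a1 b1 c1" "geodesic_on S a2 b2 c2"
      and ab: "a1 < s0" "a2 < s0" and s01: "s0 \<le> s1" and ab': "s1 < b1" "s1 < b2"
      and d: "s1 - s0 \<le> \<rho>" and c0: "dist (c1 s0) P0 \<le> \<rho>" "dist (c2 s0) P0 \<le> \<rho>"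
    define z where "z c s = (Y (c s), pinv X (Y (c s)) (velocity c s))" for c s
    have geo': "c s \<in> N \<and> c s \<in> S \<and> Y (c s) \<in> ?K1 \<and> X (Y (c s)) = c s \<and> norm (velocity c s) = 1 \<and> z c s \<in> ?K2"
      and zd: "(z c has_vector_derivative (snd (z c s), ?F (z c s))) (at s)"
      and Xz: "(X (fst (z c s)), dX X (fst (z c s)) (snd (z c s))) = (c s, velocity c s)"
      if "geodesic_on S a b c" "a < s0" "s1 < b" "dist (c s0) P0 \<le> \<rho>" "s \<in> {s0..s1}" for a b c s
    proof -
      have s: "s \<in> {a<..<b}" "s0 \<in> {a<..<b}" using that s01 by auto
      have "dist (c s) (c s0) \<le> \<rho>"
        using geodesic_on_lipschitz[OF that(1) s] that(5) d by (simp add: dist_norm)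
      then have "dist (c s) P0 \<le> 2 * \<rho>"
        using that(4) dist_triangle[of "c s" P0 "c s0"] by linarith
      from geo[OF that(1) s(1) this]
      show *: "c s \<in> N \<and> c s \<in> S \<and> Y (c s) \<in> ?K1 \<and> X (Y (c s)) = c s \<and> norm (velocity c s) = 1 \<and> z c s \<in> ?K2"
        by (simp add: z_def)
      show "(z c has_vector_derivative (snd (z c s), ?F (z c s))) (at s)"
        using has_vector_derivative_Pair[OF geodesic_ode1[OF that(1) s(1)] geodesic_ode2[OF that(1) s(1)]] *
        by (simp add: z_def[abs_def])
      show "(X (fst (z c s)), dX X (fst (z c s)) (snd (z c s))) = (c s, velocity c s)"
        using geodesic_velocity[OF that(1) s(1)] * by (simp add: z_def)
    qed
    note A1 = geo'[OF g(1) ab(1) ab'(1) c0(1)] and A2 = geo'[OF g(2) ab(2) ab'(2) c0(2)]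
    note X1 = Xz[OF g(1) ab(1) ab'(1) c0(1)] and X2 = Xz[OF g(2) ab(2) ab'(2) c0(2)]
    let ?d0 = "norm (c1 s0 - c2 s0)" and ?e0 = "norm (velocity c1 s0 - velocity c2 s0)"
    have gr: "norm (z c1 s1 - z c2 s1) \<le> norm (z c1 s0 - z c2 s0) * exp (L * (s1 - s0))"
    proof (rule gronwall_norm[OF s01 zd[OF g(1) ab(1) ab'(1) c0(1)] zd[OF g(2) ab(2) ab'(2) c0(2)]])
      fix t assume "t \<in> {s0..s1}"
      then show "norm ((snd (z c1 t), ?F (z c1 t)) - (snd (z c2 t), ?F (z c2 t))) \<le> L * norm (z c1 t - z c2 t)"
        using L(2)[of "z c1 t" "z c2 t"] A1[of t] A2[of t] by (simp add: dist_norm)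
    qed auto
    have s0: "s0 \<in> {s0..s1}" and s1: "s1 \<in> {s0..s1}" using s01 by auto
    have u: "norm (Y (c1 s0) - Y (c2 s0)) \<le> C0 * ?d0"
      using C0 A1[OF s0] A2[OF s0] by force
    have "norm (pinv X (Y (c1 s0)) (velocity c1 s0) - pinv X (Y (c2 s0)) (velocity c2 s0))
        \<le> L2 * dist (Y (c1 s0), velocity c1 s0) (Y (c2 s0), velocity c2 s0)"
      using A1[OF s0] A2[OF s0] by (intro L2(2)) auto
    also have "dist (Y (c1 s0), velocity c1 s0) (Y (c2 s0), velocity c2 s0) \<le> C0 * ?d0 + ?e0"
      unfolding dist_norm using norm_Pair_le[of "Y (c1 s0) - Y (c2 s0)" "velocity c1 s0 - velocity c2 s0"] u
      by simp
    finally have v: "norm (pinv X (Y (c1 s0)) (velocity c1 s0) - pinv X (Y (c2 s0)) (velocity c2 s0))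
        \<le> L2 * (C0 * ?d0 + ?e0)"
      using L2(1) by (simp add: mult_left_mono)
    have "norm (z c1 s0 - z c2 s0) \<le> C0 * ?d0 + L2 * (C0 * ?d0 + ?e0)"
      using order_trans[OF norm_Pair_le add_mono[OF u v]] by (simp add: z_def)
    also have "\<dots> \<le> (C0 + L2 * (C0 + 1)) * (?d0 + ?e0)"
    proof -
      have "0 \<le> C0 * ?e0 + L2 * (C0 * ?e0) + L2 * ?d0" using r(2) L2(1) by simp
      then show ?thesis by (simp add: algebra_simps)
    qed
    finally have "norm (z c1 s1 - z c2 s1) \<le> (C0 + L2 * (C0 + 1)) * (?d0 + ?e0) * exp (L * (s1 - s0))"
      using gr by (meson exp_ge_zero mult_right_mono order_trans)
    also have "\<dots> \<le> (C0 + L2 * (C0 + 1)) * (?d0 + ?e0) * exp (L * \<rho>)"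
      using d L(1) L2(1) r(2) by (intro mult_left_mono) (auto intro!: mult_left_mono)
    finally have z1: "norm (z c1 s1 - z c2 s1) \<le> exp (L * \<rho>) * (C0 + L2 * (C0 + 1)) * (?d0 + ?e0)"
      by (simp add: mult_ac)
    have "norm ((c1 s1, velocity c1 s1) - (c2 s1, velocity c2 s1)) \<le> L1 * norm (z c1 s1 - z c2 s1)"
      using L1(2)[of "z c1 s1" "z c2 s1"] A1[OF s1] A2[OF s1] X1[OF s1] X2[OF s1] by (simp add: dist_norm)
    also have "\<dots> \<le> L1 * (exp (L * \<rho>) * (C0 + L2 * (C0 + 1)) * (?d0 + ?e0))"
      using z1 L1(1) by (rule mult_left_mono)
    finally have fin: "norm (c1 s1 - c2 s1, velocity c1 s1 - velocity c2 s1)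
        \<le> L1 * (exp (L * \<rho>) * (C0 + L2 * (C0 + 1)) * (?d0 + ?e0))" by simp
    have "norm (c1 s1 - c2 s1) + norm (velocity c1 s1 - velocity c2 s1)
        \<le> 2 * norm (c1 s1 - c2 s1, velocity c1 s1 - velocity c2 s1)"
      using norm_fst_le[of "c1 s1 - c2 s1" "velocity c1 s1 - velocity c2 s1"]
        norm_snd_le[of "velocity c1 s1 - velocity c2 s1" "c1 s1 - c2 s1"] by linarith
    also have "\<dots> \<le> (2 * L1 * (exp (L * \<rho>) * (C0 + L2 * (C0 + 1)))) * (?d0 + ?e0)"
      using mult_left_mono[OF fin, of 2] by (simp add: mult.assoc)
    also have "\<dots> \<le> C * (?d0 + ?e0)"
      by (intro mult_right_mono) (auto simp: C_def)
    finally show "norm (c1 s1 - c2 s1) + norm (velocity c1 s1 - velocity c2 s1) \<le> C * (?d0 + ?e0)" .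
  qed
qed


subsection \<open>Uniqueness and stability of geodesics\<close>

definition cdist :: "(real \<Rightarrow> real^3) \<Rightarrow> (real \<Rightarrow> real^3) \<Rightarrow> real \<Rightarrow> real" where
  "cdist c1 c2 s = norm (c1 s - c2 s) + norm (velocity c1 s - velocity c2 s)"

lemma cdist_nonneg: "0 \<le> cdist c1 c2 s"
  by (simp add: cdist_def)

text \<open>The local estimates are chained along the compact parameter interval by
  \<open>Bolzano\<close>. The second geodesic may end before \<open>t\<close>; the estimate holds as
  far as it is defined.\<close>

lemma geodesic_stability:
  assumes S: "regular_surface S" and g: "geodesic_on S a b c" and st: "a < s" "s \<le> t" "t < b"
  shows "\<exists>C\<ge>1. \<exists>\<eta>>0. \<forall>c2 a2 b2 r. geodesic_on S a2 b2 c2 \<longrightarrow> a2 < s \<longrightarrow> s \<le> r \<longrightarrow> r \<le> t \<longrightarrow> r < b2 \<longrightarrow>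
    cdist c c2 s < \<eta> \<longrightarrow> cdist c c2 r \<le> C * cdist c c2 s"
proof -
  define Q where "Q x y C \<eta> \<longleftrightarrow> (\<forall>c2 a2 b2 r. geodesic_on S a2 b2 c2 \<longrightarrow> a2 < x \<longrightarrow> x \<le> r \<longrightarrow>
    r \<le> y \<longrightarrow> r < b2 \<longrightarrow> cdist c c2 x < \<eta> \<longrightarrow> cdist c c2 r \<le> C * cdist c c2 x)" for x y C \<eta>
  define P where "P x y \<longleftrightarrow> (a < x \<longrightarrow> y < b \<longrightarrow> (\<exists>C\<ge>1. \<exists>\<eta>>0. Q x y C \<eta>))" for x y
  have "P s t"
  proof (rule Bolzano[OF st(2)])
    fix x y z assume xy: "P x y" and yz: "P y z" and le: "x \<le> y" "y \<le> z"
    show "P x z"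
      unfolding P_def
    proof (intro impI)
      assume xb: "a < x" "z < b"
      obtain C1 \<eta>1 where 1: "C1 \<ge> 1" "\<eta>1 > 0" "Q x y C1 \<eta>1" using xy xb le by (auto simp: P_def)
      obtain C2 \<eta>2 where 2: "C2 \<ge> 1" "\<eta>2 > 0" "Q y z C2 \<eta>2" using yz xb le by (auto simp: P_def)
      \<comment> \<open>The threshold \<open>\<eta>2 / C1\<close> keeps the distance at the middle
        parameter \<open>y\<close> below \<eta>2, where the second estimate takes over.\<close>
      have "Q x z (C2 * C1) (min \<eta>1 (\<eta>2 / C1))"
        unfolding Q_def
      proof (intro allI impI)
        fix c2 a2 b2 r
        assume c2: "geodesic_on S a2 b2 c2" "a2 < x" "x \<le> r" "r \<le> z" "r < b2"
          "cdist c c2 x < min \<eta>1 (\<eta>2 / C1)"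
        show "cdist c c2 r \<le> C2 * C1 * cdist c c2 x"
        proof (cases "r \<le> y")
          case True
          then have "cdist c c2 r \<le> C1 * cdist c c2 x" using c2 1(3) by (auto simp: Q_def)
          also have "\<dots> \<le> C2 * (C1 * cdist c c2 x)"
            using 1(1) 2(1) cdist_nonneg[of c c2 x] mult_right_mono[of 1 C2 "C1 * cdist c c2 x"] by simp
          finally show ?thesis by simp
        next
          case False
          then have y: "cdist c c2 y \<le> C1 * cdist c c2 x" using c2 1(3) le by (auto simp: Q_def)
          also have "\<dots> < \<eta>2" using c2(6) 1(1) by (simp add: field_simps)
          finally have "cdist c c2 r \<le> C2 * cdist c c2 y"
            using c2 2(3) le False by (auto simp: Q_def)
          also have "\<dots> \<le> C2 * (C1 * cdist c c2 x)" using y 2(1) by (intro mult_left_mono) auto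
          finally show ?thesis by simp
        qed
      qed
      moreover have "C2 * C1 \<ge> 1" using 1(1) 2(1) mult_mono[of 1 C2 1 C1] by simp
      moreover have "min \<eta>1 (\<eta>2 / C1) > 0" using 1 2 by simp
      ultimately show "\<exists>C\<ge>1. \<exists>\<eta>>0. Q x z C \<eta>" by blast
    qed
  next
    fix x assume x: "s \<le> x" "x \<le> t"
    then have xab: "x \<in> {a<..<b}" using st by auto
    then have "c x \<in> S" using g by (auto simp: geodesic_on_def)
    from geodesic_local_stability(1)[OF S this] obtain \<rho> C where \<rho>: "\<rho> > 0" "C \<ge> 1" and loc:
      "\<And>c1 c2 a1 b1 a2 b2 s0 s1. geodesic_on S a1 b1 c1 \<Longrightarrow> geodesic_on S a2 b2 c2 \<Longrightarrow> a1 < s0 \<Longrightarrow> a2 < s0 \<Longrightarrow>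
        s0 \<le> s1 \<Longrightarrow> s1 < b1 \<Longrightarrow> s1 < b2 \<Longrightarrow> s1 - s0 \<le> \<rho> \<Longrightarrow> dist (c1 s0) (c x) \<le> \<rho> \<Longrightarrow> dist (c2 s0) (c x) \<le> \<rho> \<Longrightarrow>
        cdist c1 c2 s1 \<le> C * cdist c1 c2 s0"
      unfolding cdist_def by metis
    \<comment> \<open>Half of \<rho> is spent on the motion of \<open>c\<close> inside the short
      interval, the other half on the initial distance between \<open>c2\<close> and
      \<open>c\<close>.\<close>
    show "\<exists>d>0. \<forall>a b. a \<le> x \<and> x \<le> b \<and> b - a < d \<longrightarrow> P a b"
    proof (intro exI[of _ "\<rho>/2"] conjI allI impI)
      fix y z assume yz: "y \<le> x \<and> x \<le> z \<and> z - y < \<rho>/2"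
      show "P y z"
        unfolding P_def
      proof (intro impI)
        assume ab: "a < y" "z < b"
        have cy: "dist (c y) (c x) \<le> \<rho>/2"
          using geodesic_on_lipschitz[OF g, of y x] xab ab yz by (auto simp: dist_norm)
        have "Q y z C (\<rho>/2)"
          unfolding Q_def
        proof (intro allI impI)
          fix c2 a2 b2 r
          assume c2: "geodesic_on S a2 b2 c2" "a2 < y" "y \<le> r" "r \<le> z" "r < b2" "cdist c c2 y < \<rho>/2"
          have "dist (c y) (c2 y) < \<rho> / 2"
            using c2(6) norm_ge_zero[of "velocity c y - velocity c2 y"]
            unfolding cdist_def dist_norm by linarith
          then have "dist (c2 y) (c x) \<le> \<rho>"
            using cy dist_triangle3[of "c2 y" "c x" "c y"] by linarith
          then show "cdist c c2 r \<le> C * cdist c c2 y"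
            using c2 yz ab cy \<rho> by (intro loc[OF g c2(1)]) auto
        qed
        then show "\<exists>C\<ge>1. \<exists>\<eta>>0. Q y z C \<eta>" using \<rho> by (meson half_gt_zero)
      qed
    qed (use \<rho> in simp)
  qed
  then show ?thesis using st by (auto simp: P_def Q_def)
qed

lemma geodesic_unique:
  assumes "regular_surface S" "geodesic_on S a1 b1 c1" "geodesic_on S a2 b2 c2"
    "a1 < s" "a2 < s" "c1 s = c2 s" "velocity c1 s = velocity c2 s" "s \<le> r" "r < b1" "r < b2"
  shows "c1 r = c2 r" "velocity c1 r = velocity c2 r"
proof -
  have 0: "cdist c1 c2 s = 0" using assms by (simp add: cdist_def)
  from geodesic_stability[OF assms(1,2,4,8,9)] obtain C where "cdist c1 c2 r \<le> C * cdist c1 c2 s"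
    using assms 0 by (metis order_refl)
  then have "cdist c1 c2 r = 0" using 0 cdist_nonneg[of c1 c2 r] by simp
  then show "c1 r = c2 r" "velocity c1 r = velocity c2 r"
    by (auto simp: cdist_def add_nonneg_eq_0_iff)
qed

subsection \<open>Geodesic arcs\<close>

text \<open>\<sigma> = 1 gives time shifts and \<sigma> = -1 reversals; the acceleration is
  multiplied by \<sigma>^2 = 1 and stays orthogonal to the surface.\<close>

lemma geodesic_on_affine:
  assumes g: "geodesic_on S a b c" and \<sigma>: "\<bar>\<sigma>\<bar> = (1::real)"
    and sub: "\<And>s. s \<in> {a'<..<b'} \<Longrightarrow> \<tau> + \<sigma> * s \<in> {a<..<b}"
  shows geodesic_on_reparam: "geodesic_on S a' b' (\<lambda>s. c (\<tau> + \<sigma> * s))"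
    and velocity_reparam: "s \<in> {a'<..<b'} \<Longrightarrow> velocity (\<lambda>s. c (\<tau> + \<sigma> * s)) s = \<sigma> *\<^sub>R velocity c (\<tau> + \<sigma> * s)"
proof -
  have sm: "smooth_on {a<..<b} c" using g by (simp add: geodesic_on_def)
  have aff: "((\<lambda>s. \<tau> + \<sigma> * s) has_vector_derivative \<sigma>) (at s)" for s
    by (auto intro!: derivative_eq_intros simp: has_real_derivative_iff_has_vector_derivative[symmetric])
  have v: "velocity (\<lambda>s. c (\<tau> + \<sigma> * s)) s = \<sigma> *\<^sub>R velocity c (\<tau> + \<sigma> * s)" if "s \<in> {a'<..<b'}" for s
    using vector_diff_chain_at[OF aff smooth_on_curve_derivative[OF sm sub[OF that]]]
    by (intro vector_derivative_at) (simp add: o_def)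
  then show "s \<in> {a'<..<b'} \<Longrightarrow> velocity (\<lambda>s. c (\<tau> + \<sigma> * s)) s = \<sigma> *\<^sub>R velocity c (\<tau> + \<sigma> * s)" .
  have vv: "velocity (velocity (\<lambda>s. c (\<tau> + \<sigma> * s))) s = (\<sigma> * \<sigma>) *\<^sub>R velocity (velocity c) (\<tau> + \<sigma> * s)"
    if "s \<in> {a'<..<b'}" for s
  proof (rule vector_derivative_at)
    have "((\<lambda>s. \<sigma> *\<^sub>R velocity c (\<tau> + \<sigma> * s)) has_vector_derivative
        (\<sigma> * \<sigma>) *\<^sub>R velocity (velocity c) (\<tau> + \<sigma> * s)) (at s)"
      using bounded_linear.has_vector_derivative[OF bounded_linear_scaleR_right[of \<sigma>]
          vector_diff_chain_at[OF aff smooth_on_curve_derivative2[OF sm sub[OF that]]]]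
      by (simp add: o_def)
    then show "(velocity (\<lambda>s. c (\<tau> + \<sigma> * s)) has_vector_derivative
        (\<sigma> * \<sigma>) *\<^sub>R velocity (velocity c) (\<tau> + \<sigma> * s)) (at s)"
      by (rule has_vector_derivative_transform_within_open[OF _ open_greaterThanLessThan that]) (simp add: v)
  qed
  have "smooth_on {a'<..<b'} (\<lambda>s. c (\<tau> + \<sigma> * s))"
    by (rule smooth_on_affine[OF sm]) (use sub in \<open>auto intro: bounded_linear_mult_right\<close>)
  then show "geodesic_on S a' b' (\<lambda>s. c (\<tau> + \<sigma> * s))"
    using g sub unfolding geodesic_on_def by (auto simp: v vv \<sigma> inner_scaleR_left)
qed

lemma geodesic_arcD:
  assumes "geodesic_arc S c l P Q"
  shows "0 < l" "c 0 = P" "c l = Q"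
  using assms by (auto simp: geodesic_arc_def)

lemma geodesic_arc_point:
  assumes "geodesic_arc S c l P Q" "s \<in> {0..l}"
  shows "c s \<in> S" "norm (velocity c s) = 1" "(c has_vector_derivative velocity c s) (at s)"
    "(velocity c has_vector_derivative velocity (velocity c) s) (at s)"
proof -
  obtain a b where "a < 0" "l < b" "geodesic_on S a b c" using assms by (auto simp: geodesic_arc_def)
  moreover from this have "s \<in> {a<..<b}" using assms(2) by auto
  ultimately show "c s \<in> S" "norm (velocity c s) = 1" "(c has_vector_derivative velocity c s) (at s)"
    "(velocity c has_vector_derivative velocity (velocity c) s) (at s)"
    using smooth_on_curve[of "{a<..<b}" c s] by (auto simp: geodesic_on_def)
qed

lemma geodesic_arc_lipschitz:
  assumes "geodesic_arc S c l P Q" "s \<in> {0..l}" "t \<in> {0..l}"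
  shows "norm (c s - c t) \<le> \<bar>s - t\<bar>"
proof -
  obtain a b where "a < 0" "l < b" "geodesic_on S a b c" using assms by (auto simp: geodesic_arc_def)
  then show ?thesis using assms(2,3) by (intro geodesic_on_lipschitz[of S a b]) auto
qed

lemma geodesic_arc_continuous_on: "geodesic_arc S c l P Q \<Longrightarrow> continuous_on {0..l} c"
  using geodesic_arc_point(3)[of S c l P Q]
  by (intro continuous_at_imp_continuous_on ballI has_vector_derivative_continuous) auto

lemma geodesic_arc_velocity_continuous_on: "geodesic_arc S c l P Q \<Longrightarrow> continuous_on {0..l} (velocity c)"
  using geodesic_arc_point(4)[of S c l P Q]
  by (intro continuous_at_imp_continuous_on ballI has_vector_derivative_continuous) auto

lemma geodesic_arc_sub:
  assumes "geodesic_arc S c l P Q" "0 \<le> s" "s < t" "t \<le> l"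
  shows "geodesic_arc S (\<lambda>r. c (s + r)) (t - s) (c s) (c t)"
    and "r \<in> {0..t - s} \<Longrightarrow> velocity (\<lambda>r. c (s + r)) r = velocity c (s + r)"
proof -
  obtain a b where ab: "a < 0" "l < b" "geodesic_on S a b c" using assms by (auto simp: geodesic_arc_def)
  have "s + 1 * x \<in> {a<..<b}" if "x \<in> {a - s<..<b - s}" for x using that by auto
  note * = geodesic_on_affine[OF ab(3) _ this, simplified]
  show "geodesic_arc S (\<lambda>r. c (s + r)) (t - s) (c s) (c t)"
    unfolding geodesic_arc_def using assms ab(1,2) *(1)[of "a - s" "b - s"]
    by (intro conjI exI[of _ "a - s"] exI[of _ "b - s"]) auto
  show "r \<in> {0..t - s} \<Longrightarrow> velocity (\<lambda>r. c (s + r)) r = velocity c (s + r)"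
    using *(2)[of "a - s" "b - s" r] assms ab(1,2) by auto
qed

lemma geodesic_arc_prefix:
  assumes "geodesic_arc S c l P Q" "0 < t" "t \<le> l"
  shows "geodesic_arc S c t P (c t)"
  using assms unfolding geodesic_arc_def by (meson order_le_less_trans)

lemma geodesic_arc_reverse:
  assumes "geodesic_arc S c l P Q"
  shows "geodesic_arc S (\<lambda>r. c (l - r)) l Q P"
    and "r \<in> {0..l} \<Longrightarrow> velocity (\<lambda>r. c (l - r)) r = - velocity c (l - r)"
proof -
  obtain a b where ab: "a < 0" "l < b" "geodesic_on S a b c" using assms by (auto simp: geodesic_arc_def)
  have "l + (-1) * x \<in> {a<..<b}" if "x \<in> {l - b<..<l - a}" for x using that by auto
  note * = geodesic_on_affine[OF ab(3) _ this, simplified]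
  show "geodesic_arc S (\<lambda>r. c (l - r)) l Q P"
    unfolding geodesic_arc_def using ab(1,2) *(1)[of "l - b" "l - a"] geodesic_arcD[OF assms]
    by (intro conjI exI[of _ "l - b"] exI[of _ "l - a"]) auto
  show "r \<in> {0..l} \<Longrightarrow> velocity (\<lambda>r. c (l - r)) r = - velocity c (l - r)"
    using *(2)[of "l - b" "l - a" r] ab(1,2) by auto
qed

lemma geodesic_arc_same_start:
  assumes "regular_surface S" "geodesic_arc S c1 l1 P Q1" "geodesic_arc S c2 l2 P Q2"
    "velocity c1 0 = velocity c2 0" "0 \<le> r" "r \<le> l1" "r \<le> l2"
  shows "c1 r = c2 r" "velocity c1 r = velocity c2 r"
proof -
  obtain a1 b1 where 1: "a1 < 0" "l1 < b1" "geodesic_on S a1 b1 c1" "c1 0 = P"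
    using assms(2) by (auto simp: geodesic_arc_def)
  obtain a2 b2 where 2: "a2 < 0" "l2 < b2" "geodesic_on S a2 b2 c2" "c2 0 = P"
    using assms(3) by (auto simp: geodesic_arc_def)
  show "c1 r = c2 r" "velocity c1 r = velocity c2 r"
    using geodesic_unique[OF assms(1) 1(3) 2(3), of 0 r] 1 2 assms by auto
qed

lemma tangent_plane_subspace:
  assumes "regular_surface S" "P \<in> S"
  shows "subspace (tangent_plane S P)"
proof -
  obtain N U X Y where *: "surface_chart S N U X Y" "P \<in> N"
    using regular_surface_chart[OF assms] by metis
  show ?thesis
    using surface_chart.tangent_plane_eq[OF *(1) assms(2) *(2)] linear_subspace_image[OF linear_dX subspace_UNIV] by simp
qed

lemma geodesic_arc_velocity_tangent:
  assumes "geodesic_arc S c l P Q"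
  shows "velocity c 0 \<in> tangent_plane S P"
proof -
  obtain a b where ab: "a < 0" "l < b" "geodesic_on S a b c" and c: "c 0 = P" "0 < l"
    using assms by (auto simp: geodesic_arc_def)
  define \<epsilon> where "\<epsilon> = min (-a) b"
  have \<epsilon>: "{-\<epsilon><..<\<epsilon>} \<subseteq> {a<..<b}" "\<epsilon> > 0" using ab c by (auto simp: \<epsilon>_def)
  have "smooth_on {-\<epsilon><..<\<epsilon>} c"
    using ab(3) \<epsilon> by (auto simp: geodesic_on_def intro: smooth_on_subset)
  moreover have "c ` {-\<epsilon><..<\<epsilon>} \<subseteq> S" using ab(3) \<epsilon> by (auto simp: geodesic_on_def)
  ultimately show ?thesis
    unfolding tangent_plane_def using \<epsilon>(2) c geodesic_arc_point(3)[OF assms, of 0] by auto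
qed

subsection \<open>Normal neighborhoods\<close>

lemma exp_graph_unique:
  assumes "regular_surface S" "exp_graph S P v Q" "exp_graph S P v Q'"
  shows "Q = Q'"
proof (cases "v = 0")
  case False
  then obtain c c' where "geodesic_arc S c (norm v) P Q" "geodesic_arc S c' (norm v) P Q'"
      "velocity c 0 = velocity c' 0"
    using assms(2,3) by (auto simp: exp_graph_def)
  from geodesic_arc_same_start(1)[OF assms(1) this, of "norm v"] this show ?thesis
    by (auto simp: geodesic_arc_def)
qed (use assms in \<open>auto simp: exp_graph_def\<close>)

lemma exp_map_eq: "regular_surface S \<Longrightarrow> exp_graph S P v Q \<Longrightarrow> exp_map S P v = Q"
  unfolding exp_map_def using exp_graph_unique by blast

locale normal_nbhd =
  fixes S W :: "(real^3) set" and \<delta> :: real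
  assumes surface: "regular_surface S" and normal: "normal_nbhd_of_all_points S W \<delta>"
begin

lemma W_openin: "openin (top_of_set S) W" and \<delta>_pos: "0 < \<delta>"
  and exp_inj: "P \<in> W \<Longrightarrow> inj_on (exp_map S P) (tangent_ball S P \<delta>)"
  and exp_onto: "P \<in> W \<Longrightarrow> Q \<in> W \<Longrightarrow> \<exists>v\<in>tangent_ball S P \<delta>. exp_map S P v = Q"
  and exp_exists: "P \<in> W \<Longrightarrow> v \<in> tangent_ball S P \<delta> \<Longrightarrow> \<exists>Q. exp_graph S P v Q"
  using normal unfolding normal_nbhd_of_all_points_def diffeo_onto_image_def by (blast, blast, blast, fast, blast)

lemma W_sub: "P \<in> W \<Longrightarrow> P \<in> S"
  using openin_subset[OF W_openin] by auto

lemma exp_graph_exp: "P \<in> W \<Longrightarrow> v \<in> tangent_ball S P \<delta> \<Longrightarrow> exp_graph S P v (exp_map S P v)"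
  using exp_exists exp_map_eq[OF surface] by metis

lemma exp_arc:
  assumes "P \<in> W" "v \<in> tangent_ball S P \<delta>" "v \<noteq> 0"
  obtains c where "geodesic_arc S c (norm v) P (exp_map S P v)" "velocity c 0 = v /\<^sub>R norm v" "norm v < \<delta>"
  using exp_graph_exp[OF assms(1,2)] assms that by (auto simp: exp_graph_def tangent_ball_def)

text \<open>Arcs of length \<open>l < \<delta>\<close> correspond to the nonzero vectors
  \<open>l *\<^sub>R velocity c 0\<close> of the ball. Through this dictionary, injectivity and
  surjectivity of \<open>exp_map\<close> become uniqueness and existence of arcs.\<close>

lemma arc_exp:
  assumes "P \<in> S" "geodesic_arc S c l P Q" "l < \<delta>"
  shows "l *\<^sub>R velocity c 0 \<in> tangent_ball S P \<delta>" "exp_map S P (l *\<^sub>R velocity c 0) = Q"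
proof -
  have l: "l > 0" and n: "norm (velocity c 0) = 1"
    using geodesic_arcD[OF assms(2)] geodesic_arc_point(2)[OF assms(2), of 0] by auto
  have "l *\<^sub>R velocity c 0 \<in> tangent_plane S P"
    using tangent_plane_subspace[OF surface assms(1)] geodesic_arc_velocity_tangent[OF assms(2)]
    by (simp add: subspace_scale)
  then show "l *\<^sub>R velocity c 0 \<in> tangent_ball S P \<delta>"
    using l n assms(3) by (simp add: tangent_ball_def)
  have "exp_graph S P (l *\<^sub>R velocity c 0) Q"
    unfolding exp_graph_def using l n assms(2) by auto
  then show "exp_map S P (l *\<^sub>R velocity c 0) = Q" by (rule exp_map_eq[OF surface])
qed

lemma zero_in_ball: "P \<in> S \<Longrightarrow> 0 \<in> tangent_ball S P \<delta>"
  using tangent_plane_subspace[OF surface] \<delta>_pos by (simp add: tangent_ball_def subspace_0)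

lemma exp_0: "exp_map S P 0 = P"
  by (rule exp_map_eq[OF surface]) (simp add: exp_graph_def)

lemma arc_exists:
  assumes "P \<in> W" "Q \<in> W" "P \<noteq> Q"
  obtains c l where "geodesic_arc S c l P Q" "l < \<delta>"
proof -
  obtain v where v: "v \<in> tangent_ball S P \<delta>" "exp_map S P v = Q" using exp_onto assms by blast
  then have "v \<noteq> 0" using assms(3) exp_0 by auto
  then show ?thesis using exp_arc[OF assms(1) v(1)] v(2) that by metis
qed

lemma arc_unique:
  assumes P: "P \<in> W" and 1: "geodesic_arc S c1 l1 P Q" "l1 < \<delta>" and 2: "geodesic_arc S c2 l2 P Q" "l2 < \<delta>"
  shows "l1 = l2" "velocity c1 0 = velocity c2 0" "r \<in> {0..l1} \<Longrightarrow> c1 r = c2 r"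
proof -
  have eq: "l1 *\<^sub>R velocity c1 0 = l2 *\<^sub>R velocity c2 0"
    using inj_onD[OF exp_inj[OF P]] arc_exp[OF W_sub[OF P] 1] arc_exp[OF W_sub[OF P] 2] by metis
  have l: "l1 > 0" "l2 > 0" using 1 2 geodesic_arcD by auto
  have n: "norm (velocity c1 0) = 1" "norm (velocity c2 0) = 1"
    using geodesic_arc_point(2)[OF 1(1), of 0] geodesic_arc_point(2)[OF 2(1), of 0] l by auto
  have "norm (l1 *\<^sub>R velocity c1 0) = norm (l2 *\<^sub>R velocity c2 0)" using eq by simp
  then show l12: "l1 = l2" using l n by simp
  then show v: "velocity c1 0 = velocity c2 0" using eq l by simp
  show "c1 r = c2 r" if "r \<in> {0..l1}"
    using geodesic_arc_same_start(1)[OF surface 1(1) 2(1) v] that l12 by auto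
qed

lemma arc_distinct:
  assumes "P \<in> W" "geodesic_arc S c l P Q" "l < \<delta>"
  shows "P \<noteq> Q"
proof
  assume "P = Q"
  then have "l *\<^sub>R velocity c 0 = 0"
    using inj_onD[OF exp_inj[OF assms(1)]] arc_exp[OF W_sub[OF assms(1)] assms(2,3)] exp_0
      zero_in_ball[OF W_sub[OF assms(1)]] by metis
  then show False using geodesic_arcD(1)[OF assms(2)] geodesic_arc_point(2)[OF assms(2), of 0] by auto
qed

lemma direction_eq:
  assumes "P \<in> W" "geodesic_arc S c l P Q" "l < \<delta>"
  shows "direction S \<delta> P Q = velocity c 0"
  unfolding direction_def
proof (rule the_equality)
  fix u assume "\<exists>c l. geodesic_arc S c l P Q \<and> l < \<delta> \<and> u = velocity c 0"
  then show "u = velocity c 0" using arc_unique(2)[OF assms(1)] assms(2,3) by blast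
qed (use assms in blast)

lemma segment_eq:
  assumes "P \<in> W" "geodesic_arc S c l P Q" "l < \<delta>"
  shows "segment S \<delta> P Q = c ` {0..l}"
proof -
  have "c' ` {0..l'} = c ` {0..l}" if "geodesic_arc S c' l' P Q" "l' < \<delta>" for c' l'
    using arc_unique[OF assms(1) that assms(2,3)] by (intro image_cong) auto
  then show ?thesis unfolding segment_def using assms(2,3) by blast
qed

lemma dist_exp:
  assumes "P \<in> W" "v \<in> tangent_ball S P \<delta>"
  shows "norm (exp_map S P v - P) \<le> norm v"
proof (cases "v = 0")
  case False
  then obtain c where c: "geodesic_arc S c (norm v) P (exp_map S P v)" using exp_arc[OF assms] by metis
  then show ?thesis
    using geodesic_arc_lipschitz[OF c, of "norm v" 0] geodesic_arcD[OF c] by auto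
qed (simp add: exp_0)

text \<open>For nonzero \<open>v\<close> the initial data converge and stability applies. Since the
  arcs also differ in length, they are compared at the smaller length \<open>r\<close>, and unit
  speed accounts for the rest.\<close>

lemma exp_continuous:
  fixes Pn vn :: "nat \<Rightarrow> real^3"
  assumes Pn: "\<And>n. Pn n \<in> W" and vn: "\<And>n. vn n \<in> tangent_ball S (Pn n) \<delta>"
    and P: "P \<in> W" and v: "v \<in> tangent_ball S P \<delta>"
    and lim: "Pn \<longlonglongrightarrow> P" "vn \<longlonglongrightarrow> v"
  shows "(\<lambda>n. exp_map S (Pn n) (vn n)) \<longlonglongrightarrow> exp_map S P v"
proof (cases "v = 0")
  case True
  \<comment> \<open>At v = 0 the directions of the \<open>vn n\<close> need not converge; the length
    of the arc bounds the displacement directly.\<close>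
  have "(\<lambda>n. exp_map S (Pn n) (vn n) - Pn n) \<longlonglongrightarrow> 0"
  proof (rule Lim_null_comparison)
    show "\<forall>\<^sub>F n in sequentially. norm (exp_map S (Pn n) (vn n) - Pn n) \<le> norm (vn n)"
      using dist_exp[OF Pn vn] by simp
    show "(\<lambda>n. norm (vn n)) \<longlonglongrightarrow> 0" using tendsto_norm[OF lim(2)] True by simp
  qed
  from tendsto_add[OF this lim(1)] show ?thesis using True by (simp add: exp_0)
next
  case False
  obtain c where c: "geodesic_arc S c (norm v) P (exp_map S P v)" "velocity c 0 = v /\<^sub>R norm v"
    using exp_arc[OF P v False] by metis
  define l where "l = norm v"
  obtain a b where ab: "a < 0" "l < b" "geodesic_on S a b c" using c by (auto simp: geodesic_arc_def l_def)
  obtain C \<eta> where C: "\<eta> > 0" "C \<ge> 1" and stab: "\<And>c2 a2 b2 r. geodesic_on S a2 b2 c2 \<Longrightarrow> a2 < 0 \<Longrightarrow> 0 \<le> r \<Longrightarrow> r \<le> l \<Longrightarrow>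
      r < b2 \<Longrightarrow> cdist c c2 0 < \<eta> \<Longrightarrow> cdist c c2 r \<le> C * cdist c c2 0"
    using geodesic_stability[OF surface ab(3,1) _ ab(2)] by (auto simp: l_def)
  define e where "e n = norm (P - Pn n) + norm (v /\<^sub>R norm v - vn n /\<^sub>R norm (vn n))" for n
  have ln: "(\<lambda>n. norm (vn n)) \<longlonglongrightarrow> l" unfolding l_def by (rule tendsto_norm[OF lim(2)])
  have un: "(\<lambda>n. vn n /\<^sub>R norm (vn n)) \<longlonglongrightarrow> v /\<^sub>R norm v"
    using False by (intro tendsto_intros lim) auto
  have "(\<lambda>n. norm (P - Pn n) + norm (v /\<^sub>R norm v - vn n /\<^sub>R norm (vn n)))
      \<longlonglongrightarrow> norm (P - P) + norm (v /\<^sub>R norm v - v /\<^sub>R norm v)"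
    by (intro tendsto_add tendsto_norm tendsto_diff tendsto_const lim(1) un)
  then have e0: "e \<longlonglongrightarrow> 0" by (simp add: e_def[abs_def] del: norm_scaleR)
  have ev: "\<forall>\<^sub>F n in sequentially. norm (exp_map S (Pn n) (vn n) - exp_map S P v)
      \<le> 2 * \<bar>norm (vn n) - l\<bar> + C * e n"
    using order_tendstoD(2)[OF e0 C(1)] tendsto_imp_eventually_ne[OF lim(2) False]
  proof eventually_elim
    case (elim n)
    obtain cn where cn: "geodesic_arc S cn (norm (vn n)) (Pn n) (exp_map S (Pn n) (vn n))"
        "velocity cn 0 = vn n /\<^sub>R norm (vn n)"
      using exp_arc[OF Pn vn elim(2)] by metis
    obtain a' b' where ab': "a' < 0" "norm (vn n) < b'" "geodesic_on S a' b' cn"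
      using cn by (auto simp: geodesic_arc_def)
    define r where "r = min (norm (vn n)) l"
    have r: "r \<in> {0..l}" "r \<in> {0..norm (vn n)}" by (auto simp: r_def l_def)
    have cd: "cdist c cn 0 = e n"
      using c cn geodesic_arcD[OF c(1)] geodesic_arcD[OF cn(1)] by (simp add: cdist_def e_def)
    have "cdist c cn r \<le> C * e n"
      using stab[OF ab'(3,1), of r] r ab'(2) elim(1) cd by auto
    then have 1: "norm (c r - cn r) \<le> C * e n"
      using norm_ge_zero[of "velocity c r - velocity cn r"] unfolding cdist_def by linarith
    have 2: "norm (cn (norm (vn n)) - cn r) \<le> \<bar>norm (vn n) - r\<bar>"
      by (rule geodesic_arc_lipschitz[OF cn(1)]) (use r in auto)
    have 3: "norm (c r - c l) \<le> \<bar>r - l\<bar>"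
      by (rule geodesic_arc_lipschitz[OF c(1)]) (use r in \<open>auto simp: l_def\<close>)
    have "norm (cn (norm (vn n)) - c l) \<le> norm (cn (norm (vn n)) - cn r) + norm (c r - cn r) + norm (c r - c l)"
      using norm_triangle_ineq[of "cn (norm (vn n)) - cn r" "cn r - c l"]
        norm_triangle_ineq[of "cn r - c r" "c r - c l"] norm_minus_commute[of "cn r" "c r"] by simp
    also have "\<dots> \<le> \<bar>norm (vn n) - r\<bar> + C * e n + \<bar>r - l\<bar>" using 1 2 3 by linarith
    also have "\<dots> \<le> 2 * \<bar>norm (vn n) - l\<bar> + C * e n"
      by (simp add: r_def min_def)
    finally show ?case using geodesic_arcD[OF c(1)] geodesic_arcD[OF cn(1)] by (simp add: l_def)
  qed
  have "(\<lambda>n. exp_map S (Pn n) (vn n) - exp_map S P v) \<longlonglongrightarrow> 0"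
  proof (rule Lim_null_comparison[OF ev])
    have "(\<lambda>n. 2 * \<bar>norm (vn n) - l\<bar> + C * e n) \<longlonglongrightarrow> 2 * \<bar>l - l\<bar> + C * 0"
      by (intro tendsto_intros ln e0)
    then show "(\<lambda>n. 2 * \<bar>norm (vn n) - l\<bar> + C * e n) \<longlonglongrightarrow> 0" by simp
  qed
  then show ?thesis by (rule LIM_zero_cancel)
qed

end


section \<open>Continuity of the inverse exponential map\<close>

context normal_nbhd
begin

text \<open>
  In charts \<open>X\<^sub>1\<close> at \<open>P\<close> and \<open>X\<^sub>2\<close> at \<open>Q\<close> the injective map \<open>(P, v) \<mapsto> (P, exp\<^sub>P v)\<close> goes between open
  subsets of a four-dimensional space, so by invariance of domain its inverse is continuous.
\<close>

lemma exp_inverse_continuous: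
  fixes Pn Qn vn :: "nat \<Rightarrow> real^3"
  assumes Pn: "\<And>n. Pn n \<in> W" and vn: "\<And>n. vn n \<in> tangent_ball S (Pn n) \<delta>"
    and Qn: "\<And>n. exp_map S (Pn n) (vn n) = Qn n" "\<And>n. Qn n \<in> W"
    and P: "P \<in> W" and v: "v \<in> tangent_ball S P \<delta>" and Q: "exp_map S P v = Q" "Q \<in> W"
    and lim: "Pn \<longlonglongrightarrow> P" "Qn \<longlonglongrightarrow> Q"
  shows "vn \<longlonglongrightarrow> v"
proof -
  obtain N1 U1 X1 Y1 where c1: "surface_chart S N1 U1 X1 Y1" and PN: "P \<in> N1"
    using regular_surface_chart[OF surface W_sub[OF P]] by metis
  obtain N2 U2 X2 Y2 where c2: "surface_chart S N2 U2 X2 Y2" and QN: "Q \<in> N2"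
    using regular_surface_chart[OF surface W_sub[OF Q(2)]] by metis
  interpret c1: surface_chart S N1 U1 X1 Y1 by fact
  interpret c2: surface_chart S N2 U2 X2 Y2 by fact
  obtain \<Omega> where \<Omega>: "open \<Omega>" "W = S \<inter> \<Omega>" using W_openin by (auto simp: openin_open)
  define G where "G z = dX X1 (fst z) (snd z)" for z :: "(real^2) \<times> (real^2)"
  define E where "E z = exp_map S (X1 (fst z)) (G z)" for z
  define U where "U = U1 \<inter> X1 -` \<Omega>"
  \<comment> \<open>Coordinates (u, \<xi>) of the pairs of a base point \<open>X1 u\<close> in
    \<open>W\<close> and a tangent vector of length below \<delta>.\<close>
  define O0 where "O0 = {z \<in> U \<times> UNIV. norm (G z) < \<delta>}"
  have "open U" unfolding U_def
    by (rule continuous_open_preimage[OF c1.cont_X c1.open_U \<Omega>(1)])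
  have UW: "X1 u \<in> W" if "u \<in> U" for u using that c1.X_in \<Omega>(2) by (auto simp: U_def)
  have "continuous_on U1 (Xd X1 i)" for i
    by (rule smooth_on_imp_continuous_on[OF c1.Xd_smooth])
  then have "continuous_on (U \<times> UNIV) (\<lambda>z. Xd X1 i (fst z))" for i
    by (rule continuous_on_compose2[OF _ continuous_on_fst[OF continuous_on_id]]) (auto simp: U_def)
  then have contG: "continuous_on (U \<times> UNIV) G"
    unfolding G_def dX_def by (intro continuous_intros)
  have openUU: "open (U \<times> (UNIV :: (real^2) set))" using \<open>open U\<close> by (simp add: open_Times)
  have openO0: "open O0"
  proof -
    have "open ((U \<times> UNIV) \<inter> (\<lambda>z. norm (G z)) -` {..<\<delta>})"
      by (rule continuous_open_preimage[OF continuous_on_norm[OF contG] openUU]) auto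
    moreover have "O0 = (U \<times> UNIV) \<inter> (\<lambda>z. norm (G z)) -` {..<\<delta>}" by (auto simp: O0_def)
    ultimately show ?thesis by simp
  qed
  have ball: "G z \<in> tangent_ball S (X1 (fst z)) \<delta>" and X1W: "X1 (fst z) \<in> W" and fU: "fst z \<in> U1"
    if "z \<in> O0" for z
  proof -
    have u: "fst z \<in> U" "fst z \<in> U1" using that by (auto simp: O0_def U_def)
    then show "X1 (fst z) \<in> W" "fst z \<in> U1" using UW by auto
    have "G z \<in> tangent_plane S (X1 (fst z))"
      using c1.tangent_plane_eq[of "X1 (fst z)"] c1.X_in[OF u(2)] c1.YX[OF u(2)] by (auto simp: G_def)
    then show "G z \<in> tangent_ball S (X1 (fst z)) \<delta>" using that by (simp add: tangent_ball_def O0_def)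
  qed
  have contE: "continuous_on O0 E"
    unfolding continuous_on_sequentially
  proof (intro allI ballI impI)
    fix x :: "nat \<Rightarrow> (real^2) \<times> (real^2)" and z
    assume z: "z \<in> O0" and x: "(\<forall>n. x n \<in> O0) \<and> x \<longlonglongrightarrow> z"
    have G: "(\<lambda>n. G (x n)) \<longlonglongrightarrow> G z"
      by (rule continuous_on_tendsto_compose[OF contG]) (use x z in \<open>auto simp: O0_def\<close>)
    have X: "(\<lambda>n. X1 (fst (x n))) \<longlonglongrightarrow> X1 (fst z)"
      by (rule continuous_on_tendsto_compose[OF c1.cont_X]) (use x fU z in \<open>auto intro: tendsto_fst\<close>)
    show "(E \<circ> x) \<longlonglongrightarrow> E z"
      unfolding E_def o_def
      by (rule exp_continuous[OF X1W ball X1W ball X G]) (use x z in auto)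
  qed
  define D0 where "D0 = O0 \<inter> E -` N2"
  have openD0: "open D0" unfolding D0_def
    by (rule continuous_open_preimage[OF contE openO0 c2.open_N])
  \<comment> \<open>The image of the ball may leave \<open>W\<close>, but it stays in
    \<open>S\<close>, so \<open>Y2\<close> applies to those values that lie in
    \<open>N2\<close>.\<close>
  have ES: "E z \<in> S" if zO: "z \<in> O0" for z
  proof (cases "G z = 0")
    case True
    then show ?thesis using W_sub[OF X1W[OF zO]] by (simp add: E_def exp_0)
  next
    case False
    obtain c where c: "geodesic_arc S c (norm (G z)) (X1 (fst z)) (E z)"
      using exp_arc[OF X1W[OF zO] ball[OF zO] False] unfolding E_def by metis
    show ?thesis using geodesic_arc_point(1)[OF c, of "norm (G z)"] geodesic_arcD[OF c] by auto
  qed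
  define F where "F z = (fst z, Y2 (E z))" for z
  have contF: "continuous_on D0 F"
    unfolding F_def
  proof (intro continuous_on_Pair continuous_on_fst continuous_on_id)
    show "continuous_on D0 (\<lambda>z. Y2 (E z))"
      by (rule continuous_on_compose2[OF c2.cont_Y continuous_on_subset[OF contE]])
        (use ES in \<open>auto simp: D0_def\<close>)
  qed
  have injF: "inj_on F D0"
  proof (rule inj_onI)
    fix z z' assume z: "z \<in> D0" "z' \<in> D0" "F z = F z'"
    then have O0: "z \<in> O0" "z' \<in> O0" and f: "fst z = fst z'" and "Y2 (E z) = Y2 (E z')"
      by (auto simp: D0_def F_def)
    moreover have "E z \<in> N2" "E z' \<in> N2" using z by (auto simp: D0_def)
    ultimately have "E z = E z'"
      using c2.XY[OF ES[OF O0(1)]] c2.XY[OF ES[OF O0(2)]] \<open>Y2 (E z) = Y2 (E z')\<close> by metis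
    then have "G z = G z'"
      using inj_onD[OF exp_inj[OF X1W[OF O0(1)]]] ball[OF O0(1)] ball[OF O0(2)] f by (simp add: E_def)
    then have "snd z = snd z'" using injD[OF c1.inj_dX[OF fU[OF O0(1)]]] f by (simp add: G_def)
    then show "z = z'" using f by (rule prod_eqI[rotated])
  qed
  obtain \<xi> where \<xi>: "v = dX X1 (Y1 P) \<xi>"
    using v c1.tangent_plane_eq[OF W_sub[OF P] PN] by (auto simp: tangent_ball_def)
  define z0 where "z0 = (Y1 P, \<xi>)"
  have XP: "X1 (Y1 P) = P" using c1.XY[OF W_sub[OF P] PN] .
  have z0: "z0 \<in> D0" "G z0 = v" "E z0 = Q"
  proof -
    show G: "G z0 = v" by (simp add: G_def z0_def \<xi>)
    then show E: "E z0 = Q" using XP Q by (simp add: E_def z0_def)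
    have "Y1 P \<in> U" using c1.Y_in[OF W_sub[OF P] PN] XP P \<Omega>(2) by (auto simp: U_def)
    then have "z0 \<in> O0" using v G by (auto simp: O0_def z0_def tangent_ball_def)
    then show "z0 \<in> D0" using E QN by (simp add: D0_def)
  qed
  show ?thesis
  proof (rule tendstoI)
    fix e :: real assume e: "e > 0"
    have "isCont G z0"
      using contG openUU z0(1) by (auto simp: D0_def O0_def continuous_on_eq_continuous_at)
    then obtain d where d: "d > 0" "\<And>z. dist z z0 < d \<Longrightarrow> dist (G z) (G z0) < e"
      using e unfolding continuous_at_eps_delta by blast
    \<comment> \<open>\<open>F\<close> maps this small neighborhood of \<open>z0\<close> onto an
      open set, which therefore contains the coordinates of (Pn n, Qn n) for large n. Injectivity of
      the exponential map at \<open>Pn n\<close> identifies the preimage found there with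
      \<open>vn n\<close>.\<close>
    define OB where "OB = D0 \<inter> ball z0 d"
    have "open (F ` OB)"
      unfolding OB_def using openD0
      by (intro invariance_of_domain continuous_on_subset[OF contF] inj_on_subset[OF injF]) auto
    moreover have "(Y1 P, Y2 Q) \<in> F ` OB"
      using z0 d(1) by (intro image_eqI[of _ _ z0]) (auto simp: F_def OB_def z0_def)
    moreover have evN: "\<forall>\<^sub>F n in sequentially. Pn n \<in> N1" "\<forall>\<^sub>F n in sequentially. Qn n \<in> N2"
      using lim c1.open_N c2.open_N PN QN by (auto dest: topological_tendstoD)
    moreover have "(\<lambda>n. (Y1 (Pn n), Y2 (Qn n))) \<longlonglongrightarrow> (Y1 P, Y2 Q)"
    proof (rule tendsto_Pair)
      show "(\<lambda>n. Y1 (Pn n)) \<longlonglongrightarrow> Y1 P"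
        by (rule continuous_on_tendsto_compose[OF c1.cont_Y lim(1)])
          (use W_sub Pn P PN in \<open>auto intro!: eventually_mono[OF evN(1)]\<close>)
      show "(\<lambda>n. Y2 (Qn n)) \<longlonglongrightarrow> Y2 Q"
        by (rule continuous_on_tendsto_compose[OF c2.cont_Y lim(2)])
          (use W_sub Qn Q QN in \<open>auto intro!: eventually_mono[OF evN(2)]\<close>)
    qed
    ultimately have "\<forall>\<^sub>F n in sequentially. (Y1 (Pn n), Y2 (Qn n)) \<in> F ` OB"
      by (intro topological_tendstoD)
    then show "\<forall>\<^sub>F n in sequentially. dist (vn n) v < e"
      using evN
    proof eventually_elim
      case (elim n)
      then obtain z where z: "z \<in> OB" "fst z = Y1 (Pn n)" "Y2 (E z) = Y2 (Qn n)"
        by (auto simp: F_def)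
      have zO: "z \<in> O0" "E z \<in> N2" "dist z z0 < d" using z(1) by (auto simp: OB_def D0_def dist_commute)
      have "X1 (fst z) = Pn n" using z(2) c1.XY[OF W_sub[OF Pn] elim(2)] by simp
      moreover have "E z = Qn n"
        using z(3) c2.XY[OF ES[OF zO(1)] zO(2)] c2.XY[OF W_sub[OF Qn(2)] elim(3)] by metis
      ultimately have "vn n = G z"
        using inj_onD[OF exp_inj[OF Pn] _ vn] ball[OF zO(1)] Qn(1)[of n] by (simp add: E_def)
      then show ?case using d(2)[OF zO(3)] z0(2) by simp
    qed
  qed
qed

text \<open>
  The lengths of the initial pieces from \<open>P\<close> are the norms of the \<open>exp\<^sub>P\<close>-preimages of their endpoints.
  These are less than \<open>\<delta>\<close> and vary continuously, so the length cannot reach \<open>\<delta>\<close>.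
\<close>

lemma arc_in_W_short:
  assumes c: "geodesic_arc S c l P Q" and cW: "c ` {0..l} \<subseteq> W"
  shows "l < \<delta>"
proof (rule ccontr)
  assume "\<not> l < \<delta>"
  then have \<delta>l: "\<delta> \<le> l" by simp
  note cd = geodesic_arcD[OF c]
  have P: "P \<in> W" using cW cd by force
  have Q: "c \<delta> \<in> W" using cW \<delta>l \<delta>_pos by auto
  obtain v where v: "v \<in> tangent_ball S P \<delta>" "exp_map S P v = c \<delta>" using exp_onto[OF P Q] by auto
  \<comment> \<open>Times tending to \<delta> from below; the summand 2 makes already
    \<open>t 0\<close> positive.\<close>
  define t where "t n = \<delta> - \<delta> / (real n + 2)" for n
  have t: "0 < t n" "t n < \<delta>" for n using \<delta>_pos by (auto simp: t_def field_simps add_pos_nonneg)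
  have "(\<lambda>n. \<delta> - \<delta> * inverse (real (n + 2))) \<longlonglongrightarrow> \<delta> - \<delta> * 0"
    by (intro tendsto_intros LIMSEQ_ignore_initial_segment[OF lim_inverse_n])
  then have tl: "t \<longlonglongrightarrow> \<delta>" by (simp add: t_def[abs_def] divide_inverse add.commute)
  have cp: "geodesic_arc S c (t n) P (c (t n))" for n
    using geodesic_arc_prefix[OF c] t[of n] \<delta>l by simp
  have "(\<lambda>n. t n *\<^sub>R velocity c 0) \<longlonglongrightarrow> v"
  proof (rule exp_inverse_continuous)
    show "t n *\<^sub>R velocity c 0 \<in> tangent_ball S P \<delta>" "exp_map S P (t n *\<^sub>R velocity c 0) = c (t n)" for n
      using arc_exp[OF W_sub[OF P] cp t(2)] by auto
    show "c (t n) \<in> W" for n using cW t[of n] \<delta>l by auto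
    show "(\<lambda>n. c (t n)) \<longlonglongrightarrow> c \<delta>"
      by (rule continuous_on_tendsto_compose[OF geodesic_arc_continuous_on[OF c] tl])
        (use \<delta>l \<delta>_pos less_imp_le[OF t(1)] order.trans[OF less_imp_le[OF t(2)] \<delta>l] in auto)
  qed (use P Q v in auto)
  moreover have "(\<lambda>n. t n *\<^sub>R velocity c 0) \<longlonglongrightarrow> \<delta> *\<^sub>R velocity c 0"
    by (intro tendsto_intros tl)
  ultimately have "v = \<delta> *\<^sub>R velocity c 0" using LIMSEQ_unique by blast
  then have "norm v = \<delta>" using geodesic_arc_point(2)[OF c, of 0] cd \<delta>_pos by simp
  then show False using v by (simp add: tangent_ball_def)
qed

end


subsection \<open>Angles\<close>

text \<open>Division by 0 yields 0, so zero vectors are covered as well.\<close>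

lemma cos_ratio_bounds: "- 1 \<le> (v \<bullet> w) / (norm v * norm w)" "(v \<bullet> w) / (norm v * norm w) \<le> 1"
proof -
  have "\<bar>(v \<bullet> w) / (norm v * norm w)\<bar> \<le> 1"
    using Cauchy_Schwarz_ineq2[of v w] by (auto simp: abs_mult divide_le_eq_1)
  then show "- 1 \<le> (v \<bullet> w) / (norm v * norm w)" "(v \<bullet> w) / (norm v * norm w) \<le> 1"
    unfolding abs_le_iff by linarith+
qed

lemma vector_angle_bounds: "0 \<le> vector_angle v w" "vector_angle v w \<le> pi"
  using cos_ratio_bounds[of v w] by (auto simp: vector_angle_def intro!: arccos_lbound arccos_ubound)

lemma cos_vector_angle: "cos (vector_angle v w) = (v \<bullet> w) / (norm v * norm w)"
  using cos_ratio_bounds[of v w] by (simp add: vector_angle_def cos_arccos)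

lemma vector_angle_commute: "vector_angle v w = vector_angle w v"
  by (simp add: vector_angle_def inner_commute mult.commute)

lemma vector_angle_minus_left: "vector_angle (- v) w = pi - vector_angle v w"
  using cos_ratio_bounds[of v w] by (simp add: vector_angle_def arccos_minus)

lemma vector_angle_sgn: "vector_angle (sgn v) (sgn w) = vector_angle v w"
  by (simp add: vector_angle_def sgn_div_norm divide_simps mult.commute)

lemma vector_angle_self: "norm v = 1 \<Longrightarrow> vector_angle v v = 0"
  by (simp add: vector_angle_def power2_norm_eq_inner[symmetric])

lemma vector_angle_zero_imp_eq:
  assumes "norm v = 1" "norm w = 1" "vector_angle v w = 0"
  shows "v = w"
proof -
  have "v \<bullet> w = 1" using cos_vector_angle[of v w] assms by simp
  then have "(norm (v - w))\<^sup>2 = 0"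
    using assms by (simp add: power2_norm_eq_inner inner_diff_left inner_diff_right inner_commute
        norm_eq_1)
  then show ?thesis by simp
qed

text \<open>None of the four sequences has to converge, so continuity of \<open>arccos\<close> at a
  point is not enough; its uniform continuity on [-1, 1] takes that place.\<close>

lemma vector_angle_perturb:
  fixes v w v' w' :: "nat \<Rightarrow> real^3"
  assumes "\<And>n. norm (v n) = 1" "\<And>n. norm (w n) = 1" "\<And>n. norm (v' n) = 1" "\<And>n. norm (w' n) = 1"
    and "(\<lambda>n. v n - v' n) \<longlonglongrightarrow> 0" "(\<lambda>n. w n - w' n) \<longlonglongrightarrow> 0"
  shows "(\<lambda>n. vector_angle (v n) (w n) - vector_angle (v' n) (w' n)) \<longlonglongrightarrow> 0"
proof (rule tendstoI)
  fix e :: real assume e: "e > 0"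
  have "uniformly_continuous_on {-1..1::real} arccos"
    by (intro compact_uniformly_continuous continuous_on_arccos') auto
  then obtain d where d: "d > 0" "\<And>x y. x \<in> {-1..1::real} \<Longrightarrow> y \<in> {-1..1} \<Longrightarrow> dist y x < d \<Longrightarrow> dist (arccos y) (arccos x) < e"
    using e unfolding uniformly_continuous_on_def by metis
  have d2: "0 < d / 2" using d(1) by simp
  show "\<forall>\<^sub>F n in sequentially. dist (vector_angle (v n) (w n) - vector_angle (v' n) (w' n)) 0 < e"
    using tendstoD[OF assms(5) d2] tendstoD[OF assms(6) d2]
  proof eventually_elim
    case (elim n)
    have "v n \<bullet> w n - v' n \<bullet> w' n = (v n - v' n) \<bullet> w n + v' n \<bullet> (w n - w' n)"
      by (simp add: inner_diff_left inner_diff_right)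
    then have "\<bar>v n \<bullet> w n - v' n \<bullet> w' n\<bar> \<le> norm (v n - v' n) + norm (w n - w' n)"
      using Cauchy_Schwarz_ineq2[of "v n - v' n" "w n"] Cauchy_Schwarz_ineq2[of "v' n" "w n - w' n"] assms(1-4)
      by simp
    then have "dist (v n \<bullet> w n) (v' n \<bullet> w' n) < d" using elim by (simp add: dist_real_def)
    moreover have "v n \<bullet> w n \<in> {-1..1}" "v' n \<bullet> w' n \<in> {-1..1}"
      using cos_ratio_bounds[of "v n" "w n"] cos_ratio_bounds[of "v' n" "w' n"] assms(1-4) by auto
    ultimately show ?case
      using d(2)[of "v' n \<bullet> w' n" "v n \<bullet> w n"] assms(1-4) by (simp add: vector_angle_def dist_real_def)
  qed
qed

lemma tendsto_vector_angle:
  fixes v w :: "nat \<Rightarrow> real^3"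
  assumes "v \<longlonglongrightarrow> v0" "w \<longlonglongrightarrow> w0" "\<And>n. norm (v n) = 1" "\<And>n. norm (w n) = 1"
  shows "(\<lambda>n. vector_angle (v n) (w n)) \<longlonglongrightarrow> vector_angle v0 w0"
proof -
  have "norm v0 = 1" "norm w0 = 1"
    using tendsto_norm[OF assms(1)] tendsto_norm[OF assms(2)] assms(3,4) LIMSEQ_unique[OF _ tendsto_const]
    by auto
  from vector_angle_perturb[OF assms(3,4) this] show ?thesis
    using assms(1,2) by (simp add: LIM_zero_iff)
qed

text \<open>Expressing two angles by the side lengths yields cos (A + B) = - cos C; the sign of sin
  (A + B) then selects the right solution. Collinear points are covered too.\<close>

lemma triangle_angle_sum:
  fixes P Q R :: "real^3"
  assumes "P \<noteq> Q" "Q \<noteq> R" "P \<noteq> R"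
  shows "vector_angle (Q - P) (R - P) + vector_angle (P - Q) (R - Q) + vector_angle (P - R) (Q - R) = pi"
proof -
  define a b where "a = Q - P" and "b = R - P"
  have ab: "a \<noteq> 0" "b \<noteq> 0" "a \<noteq> b" using assms by (auto simp: a_def b_def)
  define x y z where "x = norm a" and "y = norm b" and "z = norm (b - a)"
  have pos: "x > 0" "y > 0" "z > 0" using ab by (auto simp: x_def y_def z_def)
  define c where "c = a \<bullet> b"
  have z2: "z\<^sup>2 = x\<^sup>2 + y\<^sup>2 - 2 * c"
    by (simp add: z_def x_def y_def c_def power2_norm_eq_inner inner_diff_left inner_diff_right inner_commute)
  \<comment> \<open>Twice the area of the triangle; the sine of an angle is \<open>D\<close> divided
    by the product of the adjacent sides.\<close>
  define D where "D = sqrt (x\<^sup>2 * y\<^sup>2 - c\<^sup>2)"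
  have D2: "D\<^sup>2 = x\<^sup>2 * y\<^sup>2 - c\<^sup>2" and D0: "D \<ge> 0"
    using Cauchy_Schwarz_ineq[of a b] by (auto simp: D_def x_def y_def c_def power2_norm_eq_inner)
  define A B C where "A = vector_angle a b" and "B = vector_angle (-a) (b - a)" and "C = vector_angle (-b) (a - b)"
  have nm: "norm (a - b) = z" by (simp add: z_def norm_minus_commute)
  have cA: "cos A = c / (x * y)" and cB: "cos B = (x\<^sup>2 - c) / (x * z)" and cC: "cos C = (y\<^sup>2 - c) / (y * z)"
    unfolding A_def B_def C_def cos_vector_angle nm norm_minus_cancel
    by (simp_all add: c_def x_def y_def z_def[symmetric] power2_norm_eq_inner inner_diff_right inner_commute)
  have range: "0 \<le> A" "A \<le> pi" "0 \<le> B" "B \<le> pi" "0 \<le> C" "C \<le> pi"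
    using vector_angle_bounds by (auto simp: A_def B_def C_def)
  have sA: "sin A = D / (x * y)"
  proof -
    have "(sin A)\<^sup>2 = (D / (x * y))\<^sup>2"
      using pos by (simp add: sin_squared_eq cA power_divide D2 power_mult_distrib field_simps)
    then show ?thesis using range D0 pos sin_ge_zero[of A] by (simp add: power2_eq_iff_nonneg)
  qed
  have sB: "sin B = D / (x * z)"
  proof -
    have "(sin B)\<^sup>2 = (x\<^sup>2 * z\<^sup>2 - (x\<^sup>2 - c)\<^sup>2) / (x * z)\<^sup>2"
      using pos by (simp add: sin_squared_eq cB power_divide power_mult_distrib field_simps)
    also have "x\<^sup>2 * z\<^sup>2 - (x\<^sup>2 - c)\<^sup>2 = D\<^sup>2"
      unfolding z2 D2 by (simp add: power2_eq_square algebra_simps)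
    finally have "(sin B)\<^sup>2 = (D / (x * z))\<^sup>2" by (simp add: power_divide)
    then show ?thesis using range D0 pos sin_ge_zero[of B] by (simp add: power2_eq_iff_nonneg)
  qed
  have cAB: "cos (A + B) = cos (pi - C)"
  proof -
    have "cos (A + B) = (c * (x\<^sup>2 - c) - D\<^sup>2) / (x\<^sup>2 * y * z)"
      using pos by (simp add: cos_add cA cB sA sB field_simps power2_eq_square)
    also have "c * (x\<^sup>2 - c) - D\<^sup>2 = - (x\<^sup>2 * (y\<^sup>2 - c))"
      unfolding D2 by (simp add: power2_eq_square algebra_simps)
    also have "- (x\<^sup>2 * (y\<^sup>2 - c)) / (x\<^sup>2 * y * z) = - cos C"
      using pos by (simp add: cC field_simps)
    finally show ?thesis by simp
  qed
  have "sin (A + B) = D / (y * z)"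
  proof -
    have "sin (A + B) = D * (x\<^sup>2 - c + c) / (x\<^sup>2 * y * z)"
      using pos by (simp add: sin_add cA cB sA sB field_simps power2_eq_square)
    then show ?thesis using pos by (simp add: field_simps)
  qed
  then have sAB: "sin (A + B) \<ge> 0" using D0 pos by simp
  \<comment> \<open>The cosine determines A + B only within [0, \<pi>]. Beyond \<pi>, a nonnegative
    sine leaves only 2 \<pi>, and two straight angles would make both \<open>c\<close> and
    \<open>x\<^sup>2 - c\<close> negative.\<close>
  have "A + B \<le> pi"
  proof (rule ccontr)
    assume gt: "\<not> A + B \<le> pi"
    have "A + B = 2 * pi"
    proof (rule ccontr)
      assume "A + B \<noteq> 2 * pi"
      then have "sin (A + B) < 0" using gt range by (intro sin_lt_zero) auto
      then show False using sAB by simp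
    qed
    then have "A = pi" "B = pi" using range by auto
    then have "c / (x * y) = -1" "(x\<^sup>2 - c) / (x * z) = -1" using cA cB by auto
    then have "c < 0" "x\<^sup>2 - c < 0" using pos
      by (auto simp: divide_eq_eq mult_less_0_iff) 
    then show False using zero_le_power2[of x] by linarith
  qed
  then have "A + B = pi - C" using cos_inj_pi[OF _ _ _ _ cAB] range by simp
  then show ?thesis by (simp add: A_def B_def C_def a_def b_def)
qed

subsection \<open>Geodesics and chords\<close>

text \<open>Two errors of at most |x - l v| / l each: one from replacing l v by x, the other from
  dividing by |x| instead of l. For x = 0 the bound reads 1 \<le> 2, as
  \<open>sgn 0 = 0\<close>.\<close>

lemma norm_sgn_diff_le:
  fixes v x :: "'a::real_normed_vector"
  assumes "norm v = 1" "0 < l"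
  shows "norm (v - sgn x) \<le> 2 * norm (x - l *\<^sub>R v) / l"
proof (cases "x = 0")
  case False
  have "v - sgn x = (1 / l) *\<^sub>R (l *\<^sub>R v - x) + ((norm x - l) / (l * norm x)) *\<^sub>R x"
    using False assms(2) by (simp add: sgn_div_norm algebra_simps diff_divide_distrib divide_inverse)
  also have "norm \<dots> \<le> norm (l *\<^sub>R v - x) / l + \<bar>norm x - l\<bar> / l"
    using False assms(2) by (intro order_trans[OF norm_triangle_ineq]) (simp add: abs_mult)
  also have "\<dots> \<le> norm (x - l *\<^sub>R v) / l + norm (x - l *\<^sub>R v) / l"
    using norm_triangle_ineq3[of x "l *\<^sub>R v"] assms
    by (intro add_mono divide_right_mono) (simp_all add: norm_minus_commute)
  finally show ?thesis by simp
qed (use assms in auto)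

text \<open>Two mean value estimates: the velocity changes by at most K l, so the displacement
  differs from l times the initial velocity by at most K l^2, and normalising divides by l.\<close>

lemma geodesic_arc_chord:
  assumes c: "geodesic_arc S c l P Q" and K: "\<And>s. s \<in> {0..l} \<Longrightarrow> norm (velocity (velocity c) s) \<le> K"
  shows "norm (velocity c 0 - sgn (Q - P)) \<le> 2 * K * l"
proof -
  note cd = geodesic_arcD[OF c]
  have K0: "0 \<le> K" by (rule order_trans[OF norm_ge_zero K[of 0]]) (use cd(1) in simp)
  have v: "norm (velocity c s - velocity c 0) \<le> K * l" if s: "s \<in> {0..l}" for s
  proof -
    have "norm (velocity c s - velocity c 0) \<le> K * norm (s - 0)"
    proof (rule differentiable_bound[of "{0..l}" "velocity c" "\<lambda>t h. h *\<^sub>R velocity (velocity c) t"])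
      fix t assume t: "t \<in> {0..l}"
      show "(velocity c has_derivative (\<lambda>h. h *\<^sub>R velocity (velocity c) t)) (at t within {0..l})"
        using geodesic_arc_point(4)[OF c t]
        by (simp add: has_vector_derivative_def has_derivative_at_withinI)
      show "onorm (\<lambda>h. h *\<^sub>R velocity (velocity c) t) \<le> K"
        using mult_right_mono[OF K[OF t] abs_ge_zero] by (intro onorm_le) (simp add: mult.commute)
    qed (use s cd in auto)
    also have "\<dots> \<le> K * l" using s K0 by (intro mult_left_mono) auto
    finally show ?thesis .
  qed
  define f where "f s = c s - s *\<^sub>R velocity c 0" for s
  have "norm (f l - f 0) \<le> (K * l) * norm (l - 0)"
  proof (rule differentiable_bound[of "{0..l}" f "\<lambda>t h. h *\<^sub>R (velocity c t - velocity c 0)"])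
    fix s assume s: "s \<in> {0..l}"
    have "(f has_vector_derivative (velocity c s - velocity c 0)) (at s)"
      unfolding f_def using geodesic_arc_point(3)[OF c s] by (auto intro!: derivative_eq_intros)
    then show "(f has_derivative (\<lambda>h. h *\<^sub>R (velocity c s - velocity c 0))) (at s within {0..l})"
      by (auto simp: has_vector_derivative_def intro: has_derivative_at_withinI)
    show "onorm (\<lambda>h. h *\<^sub>R (velocity c s - velocity c 0)) \<le> K * l"
      using mult_right_mono[OF v[OF s] abs_ge_zero] by (intro onorm_le) (simp add: mult.commute)
  qed (use cd in auto)
  then have "norm ((Q - P) - l *\<^sub>R velocity c 0) \<le> K * l * l"
    using cd by (simp add: f_def algebra_simps)
  then have "2 * norm ((Q - P) - l *\<^sub>R velocity c 0) / l \<le> 2 * (K * l * l) / l"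
    using cd(1) by (intro divide_right_mono mult_left_mono) auto
  then show ?thesis
    using norm_sgn_diff_le[of "velocity c 0" l "Q - P"] geodesic_arc_point(2)[OF c, of 0] cd(1) by simp
qed

section \<open>Directions, chords and shrinking geodesic triangles\<close>

context normal_nbhd
begin

lemma direction_arc:
  assumes "P \<in> W" "Q \<in> W" "P \<noteq> Q"
  obtains c l where "geodesic_arc S c l P Q" "l < \<delta>" "direction S \<delta> P Q = velocity c 0"
  using arc_exists[OF assms] direction_eq[OF assms(1)] by metis

lemma norm_direction: "P \<in> W \<Longrightarrow> Q \<in> W \<Longrightarrow> P \<noteq> Q \<Longrightarrow> norm (direction S \<delta> P Q) = 1"
  by (metis direction_arc geodesic_arc_point(2) geodesic_arcD(1) atLeastAtMost_iff less_imp_le order_refl)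

lemma direction_reverse:
  assumes "Q \<in> W" "geodesic_arc S c l P Q" "l < \<delta>"
  shows "direction S \<delta> Q P = - velocity c l"
  using direction_eq[OF assms(1) geodesic_arc_reverse(1)[OF assms(2)] assms(3)]
    geodesic_arc_reverse(2)[OF assms(2), of 0] geodesic_arcD(1)[OF assms(2)] by simp

text \<open>The preimages under the exponential maps converge; as the limit points are distinct, the
  limit vector is nonzero and normalising by \<open>sgn\<close> is continuous there.\<close>

lemma tendsto_direction:
  fixes Pn Qn :: "nat \<Rightarrow> real^3"
  assumes "\<And>n. Pn n \<in> W" "\<And>n. Qn n \<in> W" "\<And>n. Pn n \<noteq> Qn n" "P \<in> W" "Q \<in> W" "P \<noteq> Q"
    and "Pn \<longlonglongrightarrow> P" "Qn \<longlonglongrightarrow> Q"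
  shows "(\<lambda>n. direction S \<delta> (Pn n) (Qn n)) \<longlonglongrightarrow> direction S \<delta> P Q"
proof -
  have "\<exists>c l. geodesic_arc S c l (Pn n) (Qn n) \<and> l < \<delta> \<and> direction S \<delta> (Pn n) (Qn n) = velocity c 0" for n
    using direction_arc[OF assms(1,2,3)] by metis
  then obtain cn ln where cn: "\<And>n. geodesic_arc S (cn n) (ln n) (Pn n) (Qn n)" "\<And>n. ln n < \<delta>"
      "\<And>n. direction S \<delta> (Pn n) (Qn n) = velocity (cn n) 0" by metis
  obtain c l where c: "geodesic_arc S c l P Q" "l < \<delta>" "direction S \<delta> P Q = velocity c 0"
    using direction_arc[OF assms(4,5,6)] by metis
  have lim: "(\<lambda>n. ln n *\<^sub>R velocity (cn n) 0) \<longlonglongrightarrow> l *\<^sub>R velocity c 0"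
    using arc_exp[OF W_sub[OF assms(1)] cn(1,2)] arc_exp[OF W_sub[OF assms(4)] c(1,2)]
    by (intro exp_inverse_continuous[OF assms(1) _ _ assms(2) assms(4) _ _ assms(5) assms(7,8)]) auto
  have sg: "sgn (l *\<^sub>R velocity c 0) = velocity c 0" if "geodesic_arc S c l P Q" for c l P Q
    using geodesic_arcD(1)[OF that] geodesic_arc_point(2)[OF that, of 0] by (simp add: sgn_div_norm)
  have "l *\<^sub>R velocity c 0 \<noteq> 0"
    using sg[OF c(1)] geodesic_arc_point(2)[OF c(1), of 0] geodesic_arcD(1)[OF c(1)] by auto
  from tendsto_sgn[OF lim this] show ?thesis by (simp add: sg[OF cn(1)] sg[OF c(1)] cn(3) c(3))
qed

text \<open>Both points tend to \<open>P\<close>, so the directions need not converge. Still they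
  approach the chord directions, since the arc lengths tend to 0 while the accelerations stay
  bounded near \<open>P\<close>.\<close>

lemma direction_chord:
  fixes Pn Qn :: "nat \<Rightarrow> real^3"
  assumes "\<And>n. Pn n \<in> W" "\<And>n. Qn n \<in> W" "\<And>n. Pn n \<noteq> Qn n" "P \<in> W"
    and "Pn \<longlonglongrightarrow> P" "Qn \<longlonglongrightarrow> P"
  shows "(\<lambda>n. direction S \<delta> (Pn n) (Qn n) - sgn (Qn n - Pn n)) \<longlonglongrightarrow> 0"
proof -
  have "\<exists>c l. geodesic_arc S c l (Pn n) (Qn n) \<and> l < \<delta> \<and> direction S \<delta> (Pn n) (Qn n) = velocity c 0" for n
    using direction_arc[OF assms(1,2,3)] by metis
  then obtain cn ln where cn: "\<And>n. geodesic_arc S (cn n) (ln n) (Pn n) (Qn n)" "\<And>n. ln n < \<delta>"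
      "\<And>n. direction S \<delta> (Pn n) (Qn n) = velocity (cn n) 0" by metis
  \<comment> \<open>Continuity of the inverse exponential map at the pair (P, P), whose preimage is
    0.\<close>
  have "(\<lambda>n. ln n *\<^sub>R velocity (cn n) 0) \<longlonglongrightarrow> 0"
    using arc_exp[OF W_sub[OF assms(1)] cn(1,2)] zero_in_ball[OF W_sub[OF assms(4)]] exp_0
    by (intro exp_inverse_continuous[OF assms(1) _ _ assms(2) assms(4) _ _ assms(4) assms(5,6)]) auto
  from tendsto_norm[OF this] have ln: "ln \<longlonglongrightarrow> 0"
    using geodesic_arc_point(2)[OF cn(1), of 0] geodesic_arcD(1)[OF cn(1)] by (simp add: less_imp_le)
  obtain \<rho> K where \<rho>: "\<rho> > 0" "K \<ge> 0" and K: "\<And>c a b s. geodesic_on S a b c \<Longrightarrow> s \<in> {a<..<b} \<Longrightarrow>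
      dist (c s) P \<le> \<rho> \<Longrightarrow> norm (velocity (velocity c) s) \<le> K"
    using geodesic_local_stability(2)[OF surface W_sub[OF assms(4)]] by metis
  \<comment> \<open>Half of \<rho> for the starting point, half for the length of the arc.\<close>
  have \<rho>2: "\<rho> / 2 > 0" using \<rho> by simp
  have "\<forall>\<^sub>F n in sequentially. norm (direction S \<delta> (Pn n) (Qn n) - sgn (Qn n - Pn n)) \<le> 2 * K * ln n"
    using tendstoD[OF assms(5) \<rho>2] order_tendstoD(2)[OF ln \<rho>2]
  proof eventually_elim
    case (elim n)
    note cnD = geodesic_arcD[OF cn(1)[of n]]
    have "norm (velocity (velocity (cn n)) s) \<le> K" if s: "s \<in> {0..ln n}" for s
    proof -
      obtain a b where ab: "a < 0" "ln n < b" "geodesic_on S a b (cn n)"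
        using cn(1)[of n] by (auto simp: geodesic_arc_def)
      have "norm (cn n s - cn n 0) \<le> \<bar>s - 0\<bar>"
        by (rule geodesic_arc_lipschitz[OF cn(1)]) (use s in auto)
      then have "dist (cn n s) (Pn n) \<le> \<rho> / 2" using s elim(2) cnD(2) by (simp add: dist_norm)
      then have "dist (cn n s) P \<le> \<rho>" using elim(1) dist_triangle[of "cn n s" P "Pn n"] by linarith
      then show ?thesis using K[OF ab(3)] s ab by auto
    qed
    from geodesic_arc_chord[OF cn(1) this] show ?case by (simp add: cn(3))
  qed
  moreover have "(\<lambda>n. 2 * K * ln n) \<longlonglongrightarrow> 0" using tendsto_mult_left[OF ln, of "2 * K"] by simp
  ultimately show ?thesis by (rule Lim_null_comparison)
qed

text \<open>The chord angles add up to \<pi> for every n, so it suffices that each geodesic angle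
  differs from its chord angle by a null sequence.\<close>

lemma geodesic_triangle_angle_sum_limit:
  fixes P Q R :: "nat \<Rightarrow> real^3"
  assumes W: "\<And>n. P n \<in> W" "\<And>n. Q n \<in> W" "\<And>n. R n \<in> W" "V \<in> W"
    and ne: "\<And>n. P n \<noteq> Q n" "\<And>n. Q n \<noteq> R n" "\<And>n. P n \<noteq> R n"
    and lim: "P \<longlonglongrightarrow> V" "Q \<longlonglongrightarrow> V" "R \<longlonglongrightarrow> V"
  shows "(\<lambda>n. geodesic_angle S \<delta> (Q n) (P n) (R n) + geodesic_angle S \<delta> (P n) (Q n) (R n)
      + geodesic_angle S \<delta> (P n) (R n) (Q n)) \<longlonglongrightarrow> pi"
proof -
  have *: "(\<lambda>n. geodesic_angle S \<delta> (Y n) (X n) (Z n) - vector_angle (Y n - X n) (Z n - X n)) \<longlonglongrightarrow> 0"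
    if "\<And>n. X n \<in> W" "\<And>n. Y n \<in> W" "\<And>n. Z n \<in> W" "\<And>n. X n \<noteq> Y n" "\<And>n. X n \<noteq> Z n"
      "X \<longlonglongrightarrow> V" "Y \<longlonglongrightarrow> V" "Z \<longlonglongrightarrow> V" for X Y Z :: "nat \<Rightarrow> real^3"
  proof -
    have n: "norm (sgn (Y n - X n)) = 1" "norm (sgn (Z n - X n)) = 1" for n
      using that(4,5)[of n] by (auto simp: norm_sgn)
    show ?thesis
      using vector_angle_perturb[OF norm_direction[OF that(1,2,4)] norm_direction[OF that(1,3,5)] n
          direction_chord[OF that(1,2,4) W(4) that(6,7)] direction_chord[OF that(1,3,5) W(4) that(6,8)]]
      by (simp add: geodesic_angle_def vector_angle_sgn)
  qed
  have "(\<lambda>n. (geodesic_angle S \<delta> (Q n) (P n) (R n) - vector_angle (Q n - P n) (R n - P n))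
      + (geodesic_angle S \<delta> (P n) (Q n) (R n) - vector_angle (P n - Q n) (R n - Q n))
      + (geodesic_angle S \<delta> (P n) (R n) (Q n) - vector_angle (P n - R n) (Q n - R n))) \<longlonglongrightarrow> 0 + 0 + 0"
    using W ne lim ne[symmetric] by (intro tendsto_add *) auto
  moreover have "(geodesic_angle S \<delta> (Q n) (P n) (R n) - vector_angle (Q n - P n) (R n - P n))
      + (geodesic_angle S \<delta> (P n) (Q n) (R n) - vector_angle (P n - Q n) (R n - Q n))
      + (geodesic_angle S \<delta> (P n) (R n) (Q n) - vector_angle (P n - R n) (Q n - R n))
      = geodesic_angle S \<delta> (Q n) (P n) (R n) + geodesic_angle S \<delta> (P n) (Q n) (R n)
      + geodesic_angle S \<delta> (P n) (R n) (Q n) - pi" for n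
    using triangle_angle_sum[OF ne(1,2,3)[of n]] by linarith
  ultimately show ?thesis by (simp add: LIM_zero_iff)
qed

end


subsection \<open>Two sides issuing from a vertex\<close>

lemma half_open: "s \<in> {0<..l} \<Longrightarrow> s \<in> {0..l::real}"
  by auto

text \<open>The side AB is left out, as it changes at every step of the construction. The data are
  symmetric in the two sides, so a lemma proved for one is transferred to the other by
  \<open>swapped\<close>.\<close>

locale wedge = normal_nbhd +
  fixes V :: "real^3" and cA :: "real \<Rightarrow> real^3" and lA :: real and cB :: "real \<Rightarrow> real^3" and lB :: real
  assumes arcA: "geodesic_arc S cA lA V (cA lA)" and arcB: "geodesic_arc S cB lB V (cB lB)"
    and A_in: "cA ` {0..lA} \<subseteq> W" and B_in: "cB ` {0..lB} \<subseteq> W"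
    and disjoint: "cA ` {0..lA} \<inter> cB ` {0..lB} = {V}"
    and not_opposite: "vector_angle (velocity cA 0) (velocity cB 0) < pi"
begin

lemma V_in: "V \<in> W"
  using disjoint A_in by auto

lemma side_in: "a \<in> {0..lA} \<Longrightarrow> cA a \<in> W" "b \<in> {0..lB} \<Longrightarrow> cB b \<in> W"
  using A_in B_in by auto

lemma lA_short: "lA < \<delta>"
  by (rule arc_in_W_short[OF arcA A_in])

lemma prefixA: "a \<in> {0<..lA} \<Longrightarrow> geodesic_arc S cA a V (cA a)"
  using geodesic_arc_prefix[OF arcA] by auto

lemma prefixB: "b \<in> {0<..lB} \<Longrightarrow> geodesic_arc S cB b V (cB b)"
  using geodesic_arc_prefix[OF arcB] by auto

lemma start: "cA 0 = V" "cB 0 = V" "0 < lA" "0 < lB"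
  using geodesic_arcD[OF arcA] geodesic_arcD[OF arcB] by auto

lemma unit: "norm (velocity cA 0) = 1" "norm (velocity cB 0) = 1"
  using geodesic_arc_point(2)[OF arcA, of 0] geodesic_arc_point(2)[OF arcB, of 0] start by auto

lemma swapped: "wedge S W \<delta> V cB lB cA lA"
  using arcA arcB A_in B_in disjoint not_opposite
  by unfold_locales (auto simp: vector_angle_commute Int_commute)

lemma A_ne_V:
  assumes a: "a \<in> {0<..lA}"
  shows "cA a \<noteq> V"
  using arc_distinct[OF V_in prefixA[OF a]] a lA_short by auto

lemma direction_VA:
  assumes a: "a \<in> {0<..lA}"
  shows "direction S \<delta> V (cA a) = velocity cA 0" "direction S \<delta> (cA a) V = - velocity cA a"
    "segment S \<delta> V (cA a) = cA ` {0..a}"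
  using direction_eq[OF V_in prefixA[OF a]] direction_reverse[OF _ prefixA[OF a]] segment_eq[OF V_in prefixA[OF a]]
    side_in(1)[of a] a lA_short by auto

lemma A_inj:
  assumes "cA s = cA t" "s \<in> {0..lA}" "t \<in> {0..lA}"
  shows "s = t"
proof (cases "s = 0 \<or> t = 0")
  case True
  then show ?thesis using assms start A_ne_V[of s] A_ne_V[of t] by force
next
  case False
  then have "s \<in> {0<..lA}" "t \<in> {0<..lA}" using assms by auto
  then show ?thesis
    using arc_unique(1)[OF V_in prefixA[of s] _ prefixA[of t, folded assms(1)]] lA_short by auto
qed

lemma A_ne_B:
  assumes a: "a \<in> {0<..lA}" and b: "b \<in> {0..lB}"
  shows "cA a \<noteq> cB b"
proof
  assume "cA a = cB b"
  moreover have "cA a \<in> cA ` {0..lA}" "cB b \<in> cB ` {0..lB}" using a b by auto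
  ultimately have "cA a \<in> cA ` {0..lA} \<inter> cB ` {0..lB}" by simp
  then show False using disjoint A_ne_V[OF a] by auto
qed

text \<open>Otherwise the geodesic from B to A runs back along the side towards \<open>V\<close>.
  Either it ends on that side, against disjointness, or it passes through \<open>V\<close> with
  velocity \<open>- velocity cB 0\<close>. As the direction from \<open>V\<close> to A this equals
  \<open>velocity cA 0\<close>, so the angle at \<open>V\<close> would be \<pi>.\<close>

lemma direction_to_vertex_ne:
  assumes a: "a \<in> {0<..lA}" and b: "b \<in> {0<..lB}"
  shows "direction S \<delta> (cB b) V \<noteq> direction S \<delta> (cB b) (cA a)"
proof
  assume eq: "direction S \<delta> (cB b) V = direction S \<delta> (cB b) (cA a)"
  interpret sw: wedge S W \<delta> V cB lB cA lA by (rule swapped)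
  have in': "cB b \<in> W" "cA a \<in> W" using side_in a b by auto
  note ne = A_ne_B[OF a, of b]
  obtain c l where c: "geodesic_arc S c l (cB b) (cA a)" "l < \<delta>"
    "direction S \<delta> (cB b) (cA a) = velocity c 0"
    using direction_arc[OF in'(1,2)] ne half_open[OF b] by metis
  note r = geodesic_arc_reverse[OF prefixB[OF b]]
  have v0: "velocity c 0 = velocity (\<lambda>r. cB (b - r)) 0"
    using eq c(3) sw.direction_VA(2)[OF b] r(2)[of 0] b by simp
  note same = geodesic_arc_same_start[OF surface c(1) r(1) v0]
  show False
  proof (cases "l \<le> b")
    case True
    then have "cA a = cB (b - l)" using same(1)[of l] geodesic_arcD[OF c(1)] by simp
    moreover have "b - l \<in> {0..lB}" using True b geodesic_arcD(1)[OF c(1)] by auto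
    ultimately show False using A_ne_B[OF a] by blast
  next
    case False
    then have cb: "c b = V" "velocity c b = - velocity cB 0"
      using same[of b] r(2)[of b] b start by auto
    have s: "geodesic_arc S (\<lambda>r. c (b + r)) (l - b) V (cA a)" "velocity (\<lambda>r. c (b + r)) 0 = velocity c b"
      using geodesic_arc_sub(1)[OF c(1), of b l] geodesic_arc_sub(2)[OF c(1), of b l 0]
        False b cb geodesic_arcD[OF c(1)] by auto
    have "direction S \<delta> V (cA a) = - velocity cB 0"
      using direction_eq[OF V_in s(1)] s(2) cb c(2) b by auto
    then have "vector_angle (velocity cA 0) (velocity cB 0) = pi"
      using direction_VA(1)[OF a] vector_angle_minus_left[of "velocity cB 0" "velocity cB 0"]
        vector_angle_self[OF unit(2)] by simp
    then show False using not_opposite by simp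
  qed
qed

text \<open>The dividing geodesic cannot end at \<open>V\<close>: then \<theta> = 0, hence also
  \<kappa> \<theta> = 0, and it would point both to \<open>V\<close> and to A. Staying inside
  \<open>W\<close> makes it shorter than \<delta>, so its initial velocity is the
  \<open>direction\<close> by which angles are measured.\<close>

lemma dividing_step:
  assumes a: "a \<in> {0<..lA}" and b: "b \<in> {0<..lB}"
    and d: "dividing_geodesic S W \<delta> V (cB b) (cA a) \<theta> (\<kappa> * \<theta>) Y"
  shows "\<exists>a'\<in>{0<..a}. Y = cA a' \<and> geodesic_angle S \<delta> V (cB b) Y = \<theta>"
proof -
  interpret sw: wedge S W \<delta> V cB lB cA lA by (rule swapped)
  obtain c l R where c: "geodesic_arc S c l (cB b) Y" "c ` {0..l} \<subseteq> R" "R \<subseteq> W"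
    and ang: "vector_angle (velocity c 0) (direction S \<delta> (cB b) V) = \<theta>"
      "vector_angle (velocity c 0) (direction S \<delta> (cB b) (cA a)) = \<kappa> * \<theta>"
    and Y: "Y \<in> segment S \<delta> V (cA a)"
    using d unfolding dividing_geodesic_def by blast
  have l: "l < \<delta>" by (rule arc_in_W_short[OF c(1)]) (use c in blast)
  have in': "cB b \<in> W" "cA a \<in> W" using side_in a b by auto
  have dir: "direction S \<delta> (cB b) Y = velocity c 0" by (rule direction_eq[OF in'(1) c(1) l])
  obtain a' where a': "a' \<in> {0..a}" "Y = cA a'" using Y direction_VA(3)[OF a] by auto
  have unit': "norm (velocity c 0) = 1"
    using geodesic_arc_point(2)[OF c(1), of 0] geodesic_arcD(1)[OF c(1)] by simp
  have "a' \<noteq> 0"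
  proof
    assume "a' = 0"
    then have dV: "velocity c 0 = direction S \<delta> (cB b) V" using a' start dir by simp
    then have "\<theta> = 0" using ang(1) vector_angle_self unit' by simp
    then have "velocity c 0 = direction S \<delta> (cB b) (cA a)"
      using ang(2) A_ne_B[OF a, of b] b in'
      by (intro vector_angle_zero_imp_eq unit' norm_direction) auto
    then show False using direction_to_vertex_ne[OF a b] dV by simp
  qed
  moreover have "geodesic_angle S \<delta> V (cB b) Y = \<theta>"
    unfolding geodesic_angle_def dir using ang(1) by (simp add: vector_angle_commute)
  ultimately show ?thesis using a' by auto
qed

lemma angle_limit_regular:
  fixes a b :: "nat \<Rightarrow> real"
  assumes "\<And>n. a n \<in> {0<..lA}" "\<And>n. b n \<in> {0<..lB}" "a \<longlonglongrightarrow> a0" "b \<longlonglongrightarrow> b0"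
    and a0: "a0 \<in> {0<..lA}" and b0: "b0 \<in> {0<..lB}"
  shows "(\<lambda>n. geodesic_angle S \<delta> V (cB (b n)) (cA (a n))) \<longlonglongrightarrow> geodesic_angle S \<delta> V (cB b0) (cA a0)"
proof -
  interpret sw: wedge S W \<delta> V cB lB cA lA by (rule swapped)
  have ca: "(\<lambda>n. cA (a n)) \<longlonglongrightarrow> cA a0"
    by (rule continuous_on_tendsto_compose[OF geodesic_arc_continuous_on[OF arcA] assms(3)])
      (use a0 assms(1) in \<open>auto simp: less_imp_le\<close>)
  have cb: "(\<lambda>n. cB (b n)) \<longlonglongrightarrow> cB b0"
    by (rule continuous_on_tendsto_compose[OF geodesic_arc_continuous_on[OF arcB] assms(4)])
      (use b0 assms(2) in \<open>auto simp: less_imp_le\<close>)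
  have W: "\<And>n. cA (a n) \<in> W" "\<And>n. cB (b n) \<in> W" "cA a0 \<in> W" "cB b0 \<in> W"
    using side_in(1)[OF half_open] side_in(2)[OF half_open] assms(1,2) a0 b0 by blast+
  have ne: "\<And>n. cB (b n) \<noteq> cA (a n)" "cB b0 \<noteq> cA a0"
    using sw.A_ne_B[OF _ half_open] assms(1,2) a0 b0 by blast+
  have neV: "\<And>n. cB (b n) \<noteq> V" "cB b0 \<noteq> V" using sw.A_ne_V assms(2) b0 by auto
  show ?thesis
    unfolding geodesic_angle_def
    by (intro tendsto_vector_angle tendsto_direction norm_direction W ne neV V_in cb ca tendsto_const)
qed

text \<open>The triangle collapses onto a side: seen from A, the direction to B tends to
  \<open>velocity cB 0\<close> and the direction back to \<open>V\<close> tends to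
  \<open>- velocity cA 0\<close>, which leaves the exterior angle at \<open>V\<close>.\<close>

lemma angle_limit_degenerate:
  fixes a b :: "nat \<Rightarrow> real"
  assumes "\<And>n. a n \<in> {0<..lA}" "\<And>n. b n \<in> {0<..lB}" "a \<longlonglongrightarrow> 0" "b \<longlonglongrightarrow> b0"
    and b0: "b0 \<in> {0<..lB}"
  shows "(\<lambda>n. geodesic_angle S \<delta> V (cA (a n)) (cB (b n)))
    \<longlonglongrightarrow> pi - vector_angle (velocity cA 0) (velocity cB 0)"
proof -
  interpret sw: wedge S W \<delta> V cB lB cA lA by (rule swapped)
  have a0: "(\<lambda>n. cA (a n)) \<longlonglongrightarrow> cA 0"
    by (rule continuous_on_tendsto_compose[OF geodesic_arc_continuous_on[OF arcA] assms(3)])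
      (use start assms(1) in \<open>auto simp: less_imp_le\<close>)
  \<comment> \<open>The points A and \<open>V\<close> have the same limit, so
    \<open>tendsto_direction\<close> does not apply to them; the direction from A to
    \<open>V\<close> is \<open>- velocity cA (a n)\<close>, and this velocity is continuous.\<close>
  have va: "(\<lambda>n. velocity cA (a n)) \<longlonglongrightarrow> velocity cA 0"
    by (rule continuous_on_tendsto_compose[OF geodesic_arc_velocity_continuous_on[OF arcA] assms(3)])
      (use start assms(1) in \<open>auto simp: less_imp_le\<close>)
  have cb: "(\<lambda>n. cB (b n)) \<longlonglongrightarrow> cB b0"
    by (rule continuous_on_tendsto_compose[OF geodesic_arc_continuous_on[OF arcB] assms(4)])
      (use b0 assms(2) in \<open>auto simp: less_imp_le\<close>)
  have W: "\<And>n. cA (a n) \<in> W" "\<And>n. cB (b n) \<in> W" "cB b0 \<in> W"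
    using side_in(1)[OF half_open] side_in(2)[OF half_open] assms(1,2) b0 by blast+
  have ne: "\<And>n. cA (a n) \<noteq> cB (b n)" "V \<noteq> cB b0"
    using A_ne_B[OF _ half_open] assms(1,2) sw.A_ne_V[OF b0] by blast+
  have "(\<lambda>n. direction S \<delta> (cA (a n)) (cB (b n))) \<longlonglongrightarrow> direction S \<delta> V (cB b0)"
    using a0 start by (intro tendsto_direction W ne V_in cb) auto
  then have d: "(\<lambda>n. direction S \<delta> (cA (a n)) (cB (b n))) \<longlonglongrightarrow> velocity cB 0"
    using sw.direction_VA(1)[OF b0] by simp
  have "(\<lambda>n. vector_angle (- velocity cA (a n)) (direction S \<delta> (cA (a n)) (cB (b n))))
      \<longlonglongrightarrow> vector_angle (- velocity cA 0) (velocity cB 0)"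
  proof (intro tendsto_vector_angle tendsto_minus va d norm_direction W ne)
    show "norm (- velocity cA (a n)) = 1" for n
      using geodesic_arc_point(2)[OF arcA, of "a n"] assms(1)[of n] by auto
  qed
  then show ?thesis
    unfolding geodesic_angle_def direction_VA(2)[OF assms(1)] by (simp add: vector_angle_minus_left)
qed

text \<open>The angle at \<open>V\<close> is the same in all these triangles, since their sides
  start along the same two geodesics.\<close>

lemma angle_sum_limit:
  fixes a b :: "nat \<Rightarrow> real"
  assumes "\<And>n. a n \<in> {0<..lA}" "\<And>n. b n \<in> {0<..lB}" "a \<longlonglongrightarrow> 0" "b \<longlonglongrightarrow> 0"
  shows "(\<lambda>n. geodesic_angle S \<delta> V (cA (a n)) (cB (b n)) + geodesic_angle S \<delta> V (cB (b n)) (cA (a n)))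
    \<longlonglongrightarrow> pi - vector_angle (velocity cA 0) (velocity cB 0)"
proof -
  interpret sw: wedge S W \<delta> V cB lB cA lA by (rule swapped)
  have ca: "(\<lambda>n. cA (a n)) \<longlonglongrightarrow> V"
    using continuous_on_tendsto_compose[OF geodesic_arc_continuous_on[OF arcA] assms(3)] start assms(1)
    by (auto simp: less_imp_le)
  have cb: "(\<lambda>n. cB (b n)) \<longlonglongrightarrow> V"
    using continuous_on_tendsto_compose[OF geodesic_arc_continuous_on[OF arcB] assms(4)] start assms(2)
    by (auto simp: less_imp_le)
  have W: "\<And>n. cA (a n) \<in> W" "\<And>n. cB (b n) \<in> W"
    using side_in(1)[OF half_open] side_in(2)[OF half_open] assms(1,2) by blast+
  have ne: "\<And>n. cA (a n) \<noteq> cB (b n)" "\<And>n. V \<noteq> cB (b n)" "\<And>n. V \<noteq> cA (a n)"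
    using A_ne_B[OF assms(1) half_open[OF assms(2)]] sw.A_ne_V[OF assms(2)] A_ne_V[OF assms(1)] by metis+
  have "(\<lambda>n. geodesic_angle S \<delta> (cA (a n)) V (cB (b n)) + geodesic_angle S \<delta> V (cA (a n)) (cB (b n))
      + geodesic_angle S \<delta> V (cB (b n)) (cA (a n))) \<longlonglongrightarrow> pi"
    by (rule geodesic_triangle_angle_sum_limit[OF V_in W V_in ne(3,1,2) tendsto_const ca cb])
  moreover have "geodesic_angle S \<delta> (cA (a n)) V (cB (b n)) = vector_angle (velocity cA 0) (velocity cB 0)" for n
    using direction_VA(1)[OF assms(1)] sw.direction_VA(1)[OF assms(2)] by (simp add: geodesic_angle_def)
  ultimately have "(\<lambda>n. (vector_angle (velocity cA 0) (velocity cB 0) + geodesic_angle S \<delta> V (cA (a n)) (cB (b n))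
      + geodesic_angle S \<delta> V (cB (b n)) (cA (a n))) - vector_angle (velocity cA 0) (velocity cB 0))
      \<longlonglongrightarrow> pi - vector_angle (velocity cA 0) (velocity cB 0)"
    by (intro tendsto_diff tendsto_const) simp
  then show ?thesis by (simp add: algebra_simps)
qed

end

subsection \<open>The recursion\<close>

text \<open>The limit is the fixed point of x = r x + s; the distance to it shrinks by the factor
  \<open>r\<close> at each step, up to a vanishing error.\<close>

lemma contraction_sequence_limit:
  fixes x :: "nat \<Rightarrow> real"
  assumes r: "0 \<le> r" "r < 1" and lim: "(\<lambda>n. x (Suc n) - r * x n) \<longlonglongrightarrow> s"
  shows "x \<longlonglongrightarrow> s / (1 - r)"
proof (rule LIMSEQ_I)
  define L where "L = s / (1 - r)"
  have "L * (1 - r) = s" using r(2) by (simp add: L_def)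
  then have L: "s = L - r * L" by (simp add: algebra_simps)
  fix e :: real assume e: "0 < e"
  \<comment> \<open>Errors of e' (1 - r) per step accumulate to at most e' by the geometric series;
    the other half of \<open>e\<close> is for the initial distance.\<close>
  define e' where "e' = e / 2"
  have e': "0 < e' * (1 - r)" using e r by (simp add: e'_def)
  then obtain N where N: "\<And>n. n \<ge> N \<Longrightarrow> norm (x (Suc n) - r * x n - s) < e' * (1 - r)"
    using LIMSEQ_D[OF lim] by blast
  have step: "\<bar>x (Suc n) - L\<bar> \<le> r * \<bar>x n - L\<bar> + e' * (1 - r)" if "n \<ge> N" for n
  proof -
    have "x (Suc n) - L = r * (x n - L) + (x (Suc n) - r * x n - s)" by (simp add: L algebra_simps)
    then have "\<bar>x (Suc n) - L\<bar> \<le> \<bar>r * (x n - L)\<bar> + \<bar>x (Suc n) - r * x n - s\<bar>" by linarith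
    then show ?thesis using N[OF that] r by (simp add: abs_mult)
  qed
  have bd: "\<bar>x (N + k) - L\<bar> \<le> r ^ k * \<bar>x N - L\<bar> + e'" for k
  proof (induction k)
    case (Suc k)
    have "\<bar>x (N + Suc k) - L\<bar> \<le> r * \<bar>x (N + k) - L\<bar> + e' * (1 - r)" using step[of "N + k"] by simp
    also have "\<dots> \<le> r * (r ^ k * \<bar>x N - L\<bar> + e') + e' * (1 - r)"
      using mult_left_mono[OF Suc r(1)] by simp
    finally show ?case by (simp add: algebra_simps)
  qed (use e in \<open>simp add: e'_def\<close>)
  have "(\<lambda>k. r ^ k * \<bar>x N - L\<bar>) \<longlonglongrightarrow> 0"
    using LIMSEQ_realpow_zero[OF r] by (auto intro: tendsto_mult_left_zero)
  then obtain K where K: "\<And>k. k \<ge> K \<Longrightarrow> norm (r ^ k * \<bar>x N - L\<bar> - 0) < e'"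
    using LIMSEQ_D e by (metis e'_def half_gt_zero)
  show "\<exists>no. \<forall>n\<ge>no. norm (x n - s / (1 - r)) < e"
  proof (intro exI allI impI)
    fix n assume "n \<ge> N + K"
    then obtain k where k: "n = N + k" "k \<ge> K" by (metis add.assoc le_add1 le_iff_add)
    then have "\<bar>x n - L\<bar> < e" using bd[of k] K[of k] by (simp add: e'_def)
    then show "norm (x n - s / (1 - r)) < e" by (simp add: L_def)
  qed
qed

text \<open>Eliminating \<beta> leaves a limit for
  \<open>\<alpha> (Suc n) - 1 / d * \<alpha> n\<close> with d = (1 + p0) (1 + q0) > 1, hence a
  contraction; d - 1 is the denominator in the result.\<close>

lemma recursion_limit:
  fixes \<alpha> \<beta> p q :: "nat \<Rightarrow> real"
  assumes pq: "0 < p0" "0 < q0" "p \<longlonglongrightarrow> p0" "q \<longlonglongrightarrow> q0"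
    and bd: "\<And>n. \<bar>\<alpha> n\<bar> \<le> M" "\<And>n. \<bar>\<beta> n\<bar> \<le> M"
    and sum1: "(\<lambda>n. \<alpha> n + (1 + q n) * \<beta> n) \<longlonglongrightarrow> \<nu>"
    and sum2: "(\<lambda>n. (1 + p n) * \<alpha> (Suc n) + \<beta> n) \<longlonglongrightarrow> \<nu>"
  shows "\<alpha> \<longlonglongrightarrow> q0 * \<nu> / (p0 + q0 + p0 * q0)" "\<beta> \<longlonglongrightarrow> p0 * \<nu> / (p0 + q0 + p0 * q0)"
proof -
  \<comment> \<open>Boundedness of the angles allows \<open>p n\<close> and \<open>q n\<close> to be
    replaced by their limits before the angles are known to converge.\<close>
  have small: "(\<lambda>n. (f n - f0) * g n) \<longlonglongrightarrow> 0"
    if "f \<longlonglongrightarrow> f0" "\<And>n. \<bar>g n\<bar> \<le> M" for f g :: "nat \<Rightarrow> real" and f0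
  proof (rule Lim_null_comparison)
    show "\<forall>\<^sub>F n in sequentially. norm ((f n - f0) * g n) \<le> \<bar>f n - f0\<bar> * M"
      using that(2) by (simp add: abs_mult mult_left_mono)
    have "(\<lambda>n. \<bar>f n - f0\<bar> * M) \<longlonglongrightarrow> \<bar>f0 - f0\<bar> * M" by (intro tendsto_intros that(1))
    then show "(\<lambda>n. \<bar>f n - f0\<bar> * M) \<longlonglongrightarrow> 0" by simp
  qed
  have "(\<lambda>n. (\<alpha> n + (1 + q n) * \<beta> n) - (q n - q0) * \<beta> n) \<longlonglongrightarrow> \<nu> - 0"
    by (intro tendsto_diff sum1 small pq bd)
  then have sum1': "(\<lambda>n. \<alpha> n + (1 + q0) * \<beta> n) \<longlonglongrightarrow> \<nu>" by (simp add: algebra_simps)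
  have "(\<lambda>n. ((1 + p n) * \<alpha> (Suc n) + \<beta> n) - (p n - p0) * \<alpha> (Suc n)) \<longlonglongrightarrow> \<nu> - 0"
    by (intro tendsto_diff sum2 small pq bd)
  then have sum2': "(\<lambda>n. (1 + p0) * \<alpha> (Suc n) + \<beta> n) \<longlonglongrightarrow> \<nu>" by (simp add: algebra_simps)
  define d where "d = (1 + p0) * (1 + q0)"
  have d: "d > 1" using pq(1,2) by (simp add: d_def algebra_simps add_pos_pos)
  have "(\<lambda>n. ((1 + q0) * ((1 + p0) * \<alpha> (Suc n) + \<beta> n) - (\<alpha> n + (1 + q0) * \<beta> n)) / d)
      \<longlonglongrightarrow> ((1 + q0) * \<nu> - \<nu>) / d"
    using d by (intro tendsto_intros sum1' sum2') simp
  moreover have "((1 + q0) * ((1 + p0) * \<alpha> (Suc n) + \<beta> n) - (\<alpha> n + (1 + q0) * \<beta> n)) / d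
      = \<alpha> (Suc n) - 1 / d * \<alpha> n" for n
    using d by (simp add: field_simps d_def)
  ultimately have "\<alpha> \<longlonglongrightarrow> ((1 + q0) * \<nu> - \<nu>) / d / (1 - 1 / d)"
    using d by (intro contraction_sequence_limit) auto
  moreover have "((1 + q0) * \<nu> - \<nu>) / d / (1 - 1 / d) = q0 * \<nu> / (p0 + q0 + p0 * q0)"
  proof -
    have "d * (1 - 1 / d) = p0 + q0 + p0 * q0" using d by (simp add: d_def field_simps)
    then show ?thesis by (simp add: algebra_simps)
  qed
  ultimately show \<alpha>: "\<alpha> \<longlonglongrightarrow> q0 * \<nu> / (p0 + q0 + p0 * q0)" by simp
  have "(\<lambda>n. ((1 + p0) * \<alpha> (Suc n) + \<beta> n) - (1 + p0) * \<alpha> (Suc n))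
      \<longlonglongrightarrow> \<nu> - (1 + p0) * (q0 * \<nu> / (p0 + q0 + p0 * q0))"
    by (intro tendsto_intros sum2' LIMSEQ_Suc \<alpha>)
  moreover have "\<nu> - (1 + p0) * (q0 * \<nu> / (p0 + q0 + p0 * q0)) = p0 * \<nu> / (p0 + q0 + p0 * q0)"
  proof -
    have "p0 + q0 + p0 * q0 \<noteq> 0" using pq(1,2) by (simp add: add_pos_pos less_imp_neq[symmetric])
    then show ?thesis by (simp add: field_simps)
  qed
  ultimately show "\<beta> \<longlonglongrightarrow> p0 * \<nu> / (p0 + q0 + p0 * q0)" by simp
qed

lemma geodesic_angle_bounds: "0 \<le> geodesic_angle S \<delta> X P Y" "geodesic_angle S \<delta> X P Y \<le> pi"
  unfolding geodesic_angle_def by (rule vector_angle_bounds)+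

text \<open>\<open>a n\<close> and \<open>b n\<close> are arc lengths from \<open>V\<close> along
  the sides. Being decreasing they converge; once both limits are shown to be 0, the angle sums give
  the linear recursion.\<close>

lemma (in wedge) zigzag_limit:
  fixes a b :: "nat \<Rightarrow> real" and p q :: "real^3 \<Rightarrow> real"
  defines "\<alpha> \<equiv> \<lambda>n. geodesic_angle S \<delta> V (cA (a n)) (cB (b n))"
    and "\<beta> \<equiv> \<lambda>n. geodesic_angle S \<delta> V (cB (b n)) (cA (a (Suc n)))"
    and "\<nu> \<equiv> pi - vector_angle (velocity cA 0) (velocity cB 0)"
  assumes a: "\<And>n. a n \<in> {0<..lA}" "decseq a" and b: "\<And>n. b n \<in> {0<..lB}" "decseq b"
    and p: "continuous_on W p" "\<And>x. x \<in> W \<Longrightarrow> 0 < p x" and q: "continuous_on W q" "\<And>x. x \<in> W \<Longrightarrow> 0 < q x"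
    and \<beta>: "\<And>n. geodesic_angle S \<delta> V (cB (b n)) (cA (a n)) = (1 + q (cB (b n))) * \<beta> n"
    and \<alpha>: "\<And>n. geodesic_angle S \<delta> V (cA (a (Suc n))) (cB (b n)) = (1 + p (cA (a (Suc n)))) * \<alpha> (Suc n)"
  shows "\<alpha> \<longlonglongrightarrow> q V * \<nu> / (p V + q V + p V * q V)" "\<beta> \<longlonglongrightarrow> p V * \<nu> / (p V + q V + p V * q V)"
proof -
  interpret sw: wedge S W \<delta> V cB lB cA lA by (rule swapped)
  have \<nu>: "\<nu> > 0" using not_opposite by (simp add: \<nu>_def)
  have a': "\<And>n. a (Suc n) \<in> {0<..lA}" and b': "\<And>n. b (Suc n) \<in> {0<..lB}" using a b by auto
  have "\<forall>n. 0 \<le> a n" "\<forall>n. 0 \<le> b n" using a(1) b(1) by (auto simp: less_imp_le)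
  then obtain a0 b0 where lim: "a \<longlonglongrightarrow> a0" "b \<longlonglongrightarrow> b0"
    using decseq_convergent[OF a(2)] decseq_convergent[OF b(2)] by metis
  note lim' = LIMSEQ_Suc[OF lim(1)] LIMSEQ_Suc[OF lim(2)]
  have a0: "a0 \<in> {0..lA}" and b0: "b0 \<in> {0..lB}"
    using a(1) b(1) by (auto intro!: LIMSEQ_le_const[OF lim(1)] LIMSEQ_le_const2[OF lim(1)]
        LIMSEQ_le_const[OF lim(2)] LIMSEQ_le_const2[OF lim(2)] simp: less_imp_le)
  have cA: "(\<lambda>n. cA (a (Suc n))) \<longlonglongrightarrow> cA a0"
    by (rule continuous_on_tendsto_compose[OF geodesic_arc_continuous_on[OF arcA] lim'(1) a0])
      (use a(1) in \<open>auto simp: less_imp_le\<close>)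
  have cB: "(\<lambda>n. cB (b n)) \<longlonglongrightarrow> cB b0"
    by (rule continuous_on_tendsto_compose[OF geodesic_arc_continuous_on[OF arcB] lim(2) b0])
      (use b(1) in \<open>auto simp: less_imp_le\<close>)
  have W: "cA (a n) \<in> W" "cB (b n) \<in> W" for n
    using side_in a(1)[of n] b(1)[of n] by auto
  have pA: "(\<lambda>n. p (cA (a (Suc n)))) \<longlonglongrightarrow> p (cA a0)"
    by (rule continuous_on_tendsto_compose[OF p(1) cA]) (use side_in a0 W in auto)
  have qB: "(\<lambda>n. q (cB (b n))) \<longlonglongrightarrow> q (cB b0)"
    by (rule continuous_on_tendsto_compose[OF q(1) cB]) (use side_in b0 W in auto)
  \<comment> \<open>Here \<open>g\<close> is the divided angle and (1 + f) g the undivided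
    one.\<close>
  have no_limit: False if "g \<longlonglongrightarrow> \<omega>" "(\<lambda>n. (1 + f n) * g n) \<longlonglongrightarrow> \<omega>" "f \<longlonglongrightarrow> f0" "0 < f0" "\<omega> \<noteq> 0"
    for f g :: "nat \<Rightarrow> real" and f0 \<omega>
  proof -
    have "(\<lambda>n. (1 + f n) * g n) \<longlonglongrightarrow> (1 + f0) * \<omega>" by (intro tendsto_intros that)
    then have "(1 + f0) * \<omega> = \<omega>" using LIMSEQ_unique that(2) by blast
    then show False using that(4,5) by (simp add: algebra_simps)
  qed
  have "a0 = 0 \<and> b0 = 0"
  proof (rule ccontr)
    assume "\<not> (a0 = 0 \<and> b0 = 0)"
    then consider "a0 \<in> {0<..lA}" "b0 \<in> {0<..lB}" | "a0 = 0" "b0 \<in> {0<..lB}" | "a0 \<in> {0<..lA}" "b0 = 0"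
      using a0 b0 by force
    then show False
    proof cases
      case 1
      define \<omega> where "\<omega> = geodesic_angle S \<delta> V (cB b0) (cA a0)"
      have "\<omega> \<noteq> 0"
      proof
        assume "\<omega> = 0"
        moreover have "cB b0 \<noteq> V" "cB b0 \<noteq> cA a0" using sw.A_ne_V[OF 1(2)] sw.A_ne_B[OF 1(2) a0] .
        ultimately have "direction S \<delta> (cB b0) V = direction S \<delta> (cB b0) (cA a0)"
          using side_in a0 b0 V_in unfolding \<omega>_def geodesic_angle_def
          by (intro vector_angle_zero_imp_eq norm_direction) auto
        then show False using direction_to_vertex_ne[OF 1] by simp
      qed
      moreover have "\<beta> \<longlonglongrightarrow> \<omega>"
        unfolding \<beta>_def \<omega>_def by (rule angle_limit_regular[OF a' b(1) lim'(1) lim(2) 1])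
      moreover have "(\<lambda>n. (1 + q (cB (b n))) * \<beta> n) \<longlonglongrightarrow> \<omega>"
        using angle_limit_regular[OF a(1) b(1) lim 1] by (simp add: \<beta> \<omega>_def)
      ultimately show False using no_limit[OF _ _ qB] q(2) side_in(2)[OF b0] by blast
    next
      \<comment> \<open>At A_(n+1) the angles towards B_n and towards B_(n+1) both tend to the
        exterior angle \<nu>.\<close>
      case 2
      have "(\<lambda>n. \<alpha> (Suc n)) \<longlonglongrightarrow> \<nu>"
        unfolding \<alpha>_def \<nu>_def by (rule angle_limit_degenerate[OF a' b' lim'[unfolded 2(1)] 2(2)])
      moreover have "(\<lambda>n. (1 + p (cA (a (Suc n)))) * \<alpha> (Suc n)) \<longlonglongrightarrow> \<nu>"
        using angle_limit_degenerate[OF a' b(1) lim'(1)[unfolded 2(1)] lim(2) 2(2)] by (simp add: \<alpha> \<nu>_def)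
      ultimately show False using no_limit[OF _ _ pA] p(2) side_in(1)[OF a0] \<nu> by blast
    next
      case 3
      have "\<beta> \<longlonglongrightarrow> \<nu>"
        using sw.angle_limit_degenerate[OF b(1) a' lim(2)[unfolded 3(2)] lim'(1) 3(1)]
        by (simp add: \<beta>_def \<nu>_def vector_angle_commute)
      moreover have "(\<lambda>n. (1 + q (cB (b n))) * \<beta> n) \<longlonglongrightarrow> \<nu>"
        using sw.angle_limit_degenerate[OF b(1) a(1) lim(2)[unfolded 3(2)] lim(1) 3(1)]
        by (simp add: \<beta> \<nu>_def vector_angle_commute)
      ultimately show False using no_limit[OF _ _ qB] q(2) side_in(2)[OF b0] \<nu> by blast
    qed
  qed
  then have zero: "a0 = 0" "b0 = 0" by auto
  have lims: "a \<longlonglongrightarrow> 0" "b \<longlonglongrightarrow> 0" "(\<lambda>n. a (Suc n)) \<longlonglongrightarrow> 0" using lim lim'(1) zero by auto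
  have sum1: "(\<lambda>n. \<alpha> n + (1 + q (cB (b n))) * \<beta> n) \<longlonglongrightarrow> \<nu>"
    using angle_sum_limit[OF a(1) b(1) lims(1,2)] by (simp add: \<alpha>_def \<nu>_def \<beta>)
  have sum2: "(\<lambda>n. (1 + p (cA (a (Suc n)))) * \<alpha> (Suc n) + \<beta> n) \<longlonglongrightarrow> \<nu>"
    using angle_sum_limit[OF a' b(1) lims(3,2)] by (simp add: \<beta>_def \<nu>_def \<alpha>)
  have bounds: "\<bar>\<alpha> n\<bar> \<le> pi" "\<bar>\<beta> n\<bar> \<le> pi" for n
    unfolding \<alpha>_def \<beta>_def using geodesic_angle_bounds by simp_all
  have V0: "cA a0 = V" "cB b0 = V" using zero start by auto
  show "\<alpha> \<longlonglongrightarrow> q V * \<nu> / (p V + q V + p V * q V)" "\<beta> \<longlonglongrightarrow> p V * \<nu> / (p V + q V + p V * q V)"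
    using recursion_limit[OF p(2)[OF V_in] q(2)[OF V_in] pA[unfolded V0] qB[unfolded V0] bounds sum1 sum2] .
qed

section \<open>From the recursive construction to arc length parameters on the two sides\<close>

theorem theorem1:
  fixes S W T :: "(real^3) set" and V A\<^sub>0 B\<^sub>0 :: "real^3" and \<delta> \<mu> :: real
    and p q :: "real^3 \<Rightarrow> real"
    and A B :: "nat \<Rightarrow> real^3" and \<alpha> \<beta> :: "nat \<Rightarrow> real"
  assumes "regular_surface S"
    and "small_triangle S W \<delta> V A\<^sub>0 B\<^sub>0 T"
    and "geodesic_angle S \<delta> A\<^sub>0 V B\<^sub>0 = \<mu>" and "\<mu> < pi"
    and "continuous_on S p" and "\<forall>x\<in>S. 0 < p x"
    and "continuous_on S q" and "\<forall>x\<in>S. 0 < q x"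
    and "A 1 = A\<^sub>0" and "B 1 = B\<^sub>0" and "\<alpha> 1 = geodesic_angle S \<delta> V (A 1) (B 1)"
    and "\<forall>k\<ge>1. \<beta> k = geodesic_angle S \<delta> V (B k) (A k) / (1 + q (B k))"
    and "\<forall>k\<ge>1. dividing_geodesic S W \<delta> V (B k) (A k) (\<beta> k) (q (B k) * \<beta> k) (A (k + 1))"
    and "\<forall>k\<ge>1. \<alpha> (k + 1) = geodesic_angle S \<delta> V (A (k + 1)) (B k) / (1 + p (A (k + 1)))"
    and "\<forall>k\<ge>1. dividing_geodesic S W \<delta> V (A (k + 1)) (B k)
                  (\<alpha> (k + 1)) (p (A (k + 1)) * \<alpha> (k + 1)) (B (k + 1))"
  shows "\<alpha> \<longlonglongrightarrow> q V * (pi - \<mu>) / (p V + q V + p V * q V) \<and>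
         \<beta> \<longlonglongrightarrow> p V * (pi - \<mu>) / (p V + q V + p V * q V)"
proof -
  interpret normal_nbhd S W \<delta>
    using assms(1,2) by unfold_locales (auto simp: small_triangle_def)
  obtain cA lA cB lB and c :: "real \<Rightarrow> real^3" and l :: real
    where bd: "region_bounded_by T (cA ` {0..lA} \<union> cB ` {0..lB} \<union> c ` {0..l})" and T: "T \<subseteq> W"
    and arcs: "geodesic_arc S cA lA V A\<^sub>0" "geodesic_arc S cB lB V B\<^sub>0"
    and int: "cA ` {0..lA} \<inter> cB ` {0..lB} = {V}"
    using assms(2) unfolding small_triangle_def geodesic_triangle_def
    by blast
  \<comment> \<open>The boundary lies in the region and hence in \<open>W\<close>, which makes both
    sides shorter than \<delta>.\<close>
  have "cA ` {0..lA} \<union> cB ` {0..lB} \<union> c ` {0..l} \<subseteq> T"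
    using bd image_mono[OF sphere_cball] unfolding region_bounded_by_def homeomorphism_def by metis
  then have AW: "cA ` {0..lA} \<subseteq> W" and BW: "cB ` {0..lB} \<subseteq> W" using T by auto
  note arcs' = arcs[folded geodesic_arcD(3)[OF arcs(1)] geodesic_arcD(3)[OF arcs(2)]]
  have V: "V \<in> W" using int AW by auto
  have \<mu>: "\<mu> = vector_angle (velocity cA 0) (velocity cB 0)"
    using direction_eq[OF V arcs(1) arc_in_W_short[OF arcs(1) AW]]
      direction_eq[OF V arcs(2) arc_in_W_short[OF arcs(2) BW]] assms(3) by (simp add: geodesic_angle_def)
  have ends: "cA lA = A\<^sub>0" "cB lB = B\<^sub>0" "0 < lA" "0 < lB"
    using geodesic_arcD[OF arcs(1)] geodesic_arcD[OF arcs(2)] by auto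
  interpret wedge S W \<delta> V cA lA cB lB
    using arcs ends AW BW int assms(4) \<mu> by unfold_locales auto
  interpret sw: wedge S W \<delta> V cB lB cA lA by (rule swapped)
  have pos: "0 < p x" "0 < q x" if "x \<in> W" for x using assms(6,8) W_sub that by auto
  \<comment> \<open>One round of the construction: the geodesic from B yields the new A, then the
    geodesic from the new A yields the new B. Indices start at 1, hence
    \<open>Suc n\<close>.\<close>
  have step: "\<exists>a'\<in>{0<..a}. \<exists>b'\<in>{0<..b}. A (Suc (Suc n)) = cA a' \<and> B (Suc (Suc n)) = cB b' \<and>
      geodesic_angle S \<delta> V (B (Suc n)) (A (Suc (Suc n))) = \<beta> (Suc n) \<and>
      geodesic_angle S \<delta> V (A (Suc (Suc n))) (B (Suc (Suc n))) = \<alpha> (Suc (Suc n))"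
    if a: "a \<in> {0<..lA}" "A (Suc n) = cA a" and b: "b \<in> {0<..lB}" "B (Suc n) = cB b" for n a b
  proof -
    obtain a' where a': "a' \<in> {0<..a}" "A (Suc (Suc n)) = cA a'"
      "geodesic_angle S \<delta> V (B (Suc n)) (A (Suc (Suc n))) = \<beta> (Suc n)"
      using dividing_step[OF a(1) b(1), of "\<beta> (Suc n)" "q (B (Suc n))" "A (Suc (Suc n))"]
        assms(13)[rule_format, of "Suc n"] a(2) b(2) by auto
    have a'': "a' \<in> {0<..lA}" using a' a by auto
    obtain b' where "b' \<in> {0<..b}" "B (Suc (Suc n)) = cB b'"
      "geodesic_angle S \<delta> V (A (Suc (Suc n))) (B (Suc (Suc n))) = \<alpha> (Suc (Suc n))"
      using sw.dividing_step[OF b(1) a'', of "\<alpha> (Suc (Suc n))" "p (A (Suc (Suc n)))" "B (Suc (Suc n))"]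
        assms(15)[rule_format, of "Suc n"] a'(2) b(2) by auto
    then show ?thesis using a' by blast
  qed
  have "\<exists>a\<in>{0<..lA}. \<exists>b\<in>{0<..lB}. A (Suc n) = cA a \<and> B (Suc n) = cB b" for n
  proof (induction n)
    case 0
    show ?case using assms(9,10) ends by (intro bexI[of _ lA] bexI[of _ lB]) auto
  next
    case (Suc n)
    then obtain a b where "a \<in> {0<..lA}" "b \<in> {0<..lB}" "A (Suc n) = cA a" "B (Suc n) = cB b" by blast
    from step[OF this(1,3,2,4)] this show ?case by fastforce
  qed
  then obtain a b where ab: "\<And>n. a n \<in> {0<..lA}" "\<And>n. b n \<in> {0<..lB}" "\<And>n. A (Suc n) = cA (a n)" "\<And>n. B (Suc n) = cB (b n)"
    by metis
  note step' = step[OF ab(1,3,2,4)]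
  \<comment> \<open>The parameters were chosen for each n separately; injectivity along the sides
    identifies them with the ones that \<open>step\<close> produces.\<close>
  have "a (Suc n) \<le> a n" "b (Suc n) \<le> b n" for n
  proof -
    obtain a' b' where *: "a' \<in> {0<..a n}" "b' \<in> {0<..b n}" "A (Suc (Suc n)) = cA a'" "B (Suc (Suc n)) = cB b'"
      using step'[of n] by blast
    then have "a (Suc n) = a'" "b (Suc n) = b'"
      using A_inj[of "a (Suc n)" a'] sw.A_inj[of "b (Suc n)" b'] ab(1,2)[of "Suc n"] ab(1,2)[of n] ab(3,4)[of "Suc n"]
      by auto
    then show "a (Suc n) \<le> a n" "b (Suc n) \<le> b n" using * by auto
  qed
  then have dec: "decseq a" "decseq b" by (auto simp: decseq_Suc_iff)
  \<comment> \<open>For n = 0 this is the prescribed initial angle; all later values are angles of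
    dividing geodesics.\<close>
  have \<alpha>_eq: "geodesic_angle S \<delta> V (cA (a n)) (cB (b n)) = \<alpha> (Suc n)" for n
  proof (cases n)
    case 0
    then show ?thesis using assms(11) ab(3,4)[of 0] by simp
  next
    case (Suc m)
    then show ?thesis using step'[of m] ab(3,4)[of n] by auto
  qed
  have \<beta>_eq: "geodesic_angle S \<delta> V (cB (b n)) (cA (a (Suc n))) = \<beta> (Suc n)" for n
    using step'[of n] ab(4)[of n] ab(3)[of "Suc n"] by auto
  have inW: "cA (a n) \<in> W" "cB (b n) \<in> W" for n using side_in ab(1,2)[of n] by auto
  have cont: "continuous_on W p" "continuous_on W q"
    using assms(5,7) W_sub by (auto intro: continuous_on_subset)
  have "geodesic_angle S \<delta> V (cB (b n)) (cA (a n)) = (1 + q (cB (b n))) * \<beta> (Suc n)" for n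
    using assms(12) ab(3,4)[of n] pos(2)[OF inW(2)[of n]] by auto
  moreover have "geodesic_angle S \<delta> V (cA (a (Suc n))) (cB (b n)) = (1 + p (cA (a (Suc n)))) * \<alpha> (Suc (Suc n))" for n
    using assms(14)[rule_format, of "Suc n"] ab(3)[of "Suc n"] ab(4)[of n] pos(1)[OF inW(1)[of "Suc n"]] by auto
  ultimately have "(\<lambda>n. \<alpha> (Suc n)) \<longlonglongrightarrow> q V * (pi - \<mu>) / (p V + q V + p V * q V)"
    "(\<lambda>n. \<beta> (Suc n)) \<longlonglongrightarrow> p V * (pi - \<mu>) / (p V + q V + p V * q V)"
    using zigzag_limit[OF ab(1) dec(1) ab(2) dec(2) cont(1) pos(1) cont(2) pos(2)]
    unfolding \<alpha>_eq \<beta>_eq \<mu> by blast+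
  \<comment> \<open>Restoring the unspecified value at index 0 does not affect the limits.\<close>
  then show ?thesis by (simp add: filterlim_sequentially_Suc)
qed

end
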